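(* Let $y^0\in S^{f^{(1)}}$. Then Pontryagin's maximum principle holds for the problem $(P)^{f^{(1)}}_{y^0}$: if $t^*$ is the optimal time, $u^*$ is an optimal control and $y^*$ is the corresponding optimal state for $(P)^{f^{(1)}}_{y^0}$, then there is a nontrivial (not identically zero) function $\psi\in C([0,t^*];\mathbb R^2)$ satisfying $$\psi(t)=\int_t^{t^*}f^{(1)}_y(y^*(\tau))\psi(\tau)\,d\tau\quad\text{for all }t\in[0,t^* ),\qquad \psi(t^* )=0,$$ and $$\max_{\|u\|\le\rho_0}\langle\psi(t),B(t)u\rangle=\langle\psi(t),B(t)u^*(t)\rangle\quad\text{for a.e. }t\in[0,t^*],$$ where the maximum is over $u\in\mathbb R^2$ with $\|u\|\le\rho_0$. Besides, $t^*\le(y_1^0-1)^2$.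
   Context: Notation: $\|\cdot\|$ and $\langle\cdot,\cdot\rangle$ are the Euclidean norm and inner product on $\mathbb R^2$ ($\|\cdot\|$ is also the operator norm for matrices), $R^+=[0,+\infty)$. Fix a nontrivial (not a.e. zero) $B\in L^\infty(0,+\infty;\mathbb R^{2\times2})$ and $\rho_0>0$. Controls: $\mathcal U_{ad}=\{u:R^+\to\mathbb R^2:\ u \text{ Lebesgue measurable},\ \|u(t)\|\le\rho_0\text{ for a.e. }t\in R^+\}$. Put $K_0=\operatorname{ess\,sup}_{s\in R^+}\|B(s)\|\,\rho_0$. Vector field: $f^{(1)}(y)=\left(\frac{y_2}{1-y_1},\,y_1+y_2\right)^T$ for $y=(y_1,y_2)^T$ with $y_1\ne1$. Convention for the derivative: for $g=(g_1,g_2)^T$, $g_y=\begin{pmatrix}\partial g_1/\partial y_1&\partial g_2/\partial y_1\\ \partial g_1/\partial y_2&\partial g_2/\partial y_2\end{pmatrix}$ (the transpose of the usual Jacobian), so $f^{(1)}_y(y)=\begin{pmatrix}\frac{y_2}{(1-y_1)^2}&1\\ \frac1{1-y_1}&1\end{pmatrix}$. Initial data: $S^{f^{(1)}}=\{z\in\mathbb R^2: z_1\in(1-\frac1{2K_0},1),\ z_2\in(K_0+\frac1{K_0}-1,+\infty)\}\cup\{z\in\mathbb R^2: z_1\in(1,1+\frac1{2K_0}),\ z_2\in(K_0+1,+\infty)\}$. For $y^0=(y^0_1,y^0_2)^T\in S^{f^{(1)}}$, $u\in\mathcal U_{ad}$, let $y(\cdot\,;f^{(1)},y^0,u)$ be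 the unique (absolutely continuous, with values in the domain of $f^{(1)}$) solution of $\frac{dy}{dt}=f^{(1)}(y(t))+B(t)u(t)$, $t>0$, $y(0)=y^0$, with maximal interval of existence $[0,T_{max}(f^{(1)},y^0,u))$. For all such $y^0,u$ there is a unique time $T_q(f^{(1)},y^0,u)\le T_{max}(f^{(1)},y^0,u)$, the quenching time, such that $0<T_q<+\infty$, $\lim_{t\to T_q}\|f^{(1)}(y(t;f^{(1)},y^0,u))\|=+\infty$, and $\|f^{(1)}(y(t;f^{(1)},y^0,u))\|<+\infty$ for $t\in[0,T_q)$. Problem $(P)^{f^{(1)}}_{y^0}$: $\min_{u\in\mathcal U_{ad}}T_q(f^{(1)},y^0,u)$. The optimal time is $t^*=\inf_{u\in\mathcal U_{ad}}T_q(f^{(1)},y^0,u)$; an optimal control is a $u^*\in\mathcal U_{ad}$ with $T_q(f^{(1)},y^0,u^* )=t^*$; the corresponding optimal state is $y^*(\cdot)=y(\cdot\,;f^{(1)},y^0,u^* )$. *)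

theory Defs
  imports "HOL-Analysis.Analysis" "HOL-Probability.Essential_Supremum"
begin

subsection \<open>The vector field and its derivative\<close>

definition f1 :: "real^2 \<Rightarrow> real^2" where
  "f1 y = vector [y$2 / (1 - y$1), y$1 + y$2]"

definition dom1 :: "(real^2) set" where
  "dom1 = {y. y$1 \<noteq> 1}"

text \<open>The derivative convention is the transpose of the usual Jacobian: row \<open>i\<close>, column \<open>j\<close>
  holds the partial derivative of \<open>g\<^sub>j\<close> with respect to \<open>y\<^sub>i\<close>.\<close>

definition grad_matrix :: "(real^2 \<Rightarrow> real^2) \<Rightarrow> real^2 \<Rightarrow> real^2^2" where
  "grad_matrix g y = transpose (jacobian g (at y))"

lemma grad_matrix_f1:
  assumes "y \<in> dom1"
  shows "grad_matrix f1 y = vector [vector [y$2 / (1 - y$1)^2, 1], vector [1 / (1 - y$1), 1]]"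
proof -
  have ne: "1 - y$1 \<noteq> 0" using assms by (auto simp: dom1_def)
  define f' :: "real^2 \<Rightarrow> real^2" where
    "f' = (\<lambda>h. vector [y$2 / (1 - y$1)^2 * h$1 + h$2 / (1 - y$1), h$1 + h$2])"
  have c1: "((\<lambda>x::real^2. x$2 / (1 - x$1)) has_derivative
      (\<lambda>h. y$2 / (1 - y$1)^2 * h$1 + h$2 / (1 - y$1))) (at y)"
    by (rule derivative_eq_intros bounded_linear.has_derivative[OF bounded_linear_vec_nth] refl ne)+
       (use ne in \<open>simp add: fun_eq_iff field_simps power2_eq_square\<close>)
  have c2: "((\<lambda>x::real^2. x$1 + x$2) has_derivative (\<lambda>h. h$1 + h$2)) (at y)"
    by (rule derivative_eq_intros bounded_linear.has_derivative[OF bounded_linear_vec_nth] refl)+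
  have "(f1 has_derivative f') (at y)"
    unfolding has_derivative_componentwise_within[of f1]
  proof
    fix b :: "real^2" assume "b \<in> Basis"
    then obtain i where b: "b = axis i 1" by (auto simp: Basis_vec_def)
    show "((\<lambda>x. f1 x \<bullet> b) has_derivative (\<lambda>x. f' x \<bullet> b)) (at y)"
      using exhaust_2[of i] c1 c2
      by (auto simp: b inner_axis f1_def f'_def)
  qed
  then have "frechet_derivative f1 (at y) = f'"
    by (rule frechet_derivative_at[symmetric])
  then show ?thesis
    by (auto simp: grad_matrix_def jacobian_def matrix_def transpose_def f'_def
        vec_eq_iff forall_2 axis_def)
qed

subsection \<open>Controls and initial data\<close>

definition ess_bound :: "(real \<Rightarrow> real^2^2) \<Rightarrow> ereal" where
  "ess_bound B = esssup (lebesgue_on {0..}) (\<lambda>s. ereal (onorm (\<lambda>x. B s *v x)))"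

definition L_infinity :: "(real \<Rightarrow> real^2^2) set" where
  "L_infinity = {B. B \<in> borel_measurable (lebesgue_on {0..}) \<and> ess_bound B < \<infinity>}"

definition K0 :: "(real \<Rightarrow> real^2^2) \<Rightarrow> real \<Rightarrow> real" where
  "K0 B \<rho>0 = real_of_ereal (ess_bound B) * \<rho>0"

definition U_ad :: "real \<Rightarrow> (real \<Rightarrow> real^2) set" where
  "U_ad \<rho>0 = {u. u \<in> borel_measurable (lebesgue_on {0..}) \<and>
                 (AE t in lebesgue_on {0..}. norm (u t) \<le> \<rho>0)}"

definition S_f1 :: "real \<Rightarrow> (real^2) set" where
  "S_f1 K = {z. z$1 \<in> {1 - 1 / (2*K) <..< 1} \<and> z$2 \<in> {K + 1/K - 1 <..}} \<union>
            {z. z$1 \<in> {1 <..< 1 + 1 / (2*K)} \<and> z$2 \<in> {K + 1 <..}}"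

subsection \<open>Trajectories and quenching\<close>

text \<open>Absolute continuity in the epsilon-delta sense. A finite family of non-overlapping closed
  subintervals is given as a division of its union; \<open>Inf k\<close> and \<open>Sup k\<close> are the endpoints
  of \<open>k\<close>.\<close>

definition abs_continuous_on :: "real set \<Rightarrow> (real \<Rightarrow> real^2) \<Rightarrow> bool" where
  "abs_continuous_on I y \<longleftrightarrow>
     (\<forall>\<epsilon>>0. \<exists>\<delta>>0. \<forall>d. d division_of (\<Union>d) \<and> \<Union>d \<subseteq> I \<and> (\<Sum>k\<in>d. Sup k - Inf k) < \<delta> \<longrightarrow>
        (\<Sum>k\<in>d. norm (y (Sup k) - y (Inf k))) < \<epsilon>)"

text \<open>\<open>y\<close> is a solution on \<open>[0,T)\<close> of \<open>y' = f1 y + B u\<close>, \<open>y 0 = y0\<close>, staying in the domain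
  of \<open>f1\<close>; the values of \<open>y\<close> outside \<open>[0,T)\<close> are irrelevant.\<close>

definition solution_on ::
    "(real \<Rightarrow> real^2^2) \<Rightarrow> (real \<Rightarrow> real^2) \<Rightarrow> real^2 \<Rightarrow> real \<Rightarrow> (real \<Rightarrow> real^2) \<Rightarrow> bool" where
  "solution_on B u y0 T y \<longleftrightarrow>
     y 0 = y0 \<and>
     (\<forall>t\<in>{0..<T}. y t \<in> dom1) \<and>
     (\<forall>b\<in>{0..<T}. abs_continuous_on {0..b} y) \<and>
     (AE t in lebesgue_on {0..<T}. (y has_vector_derivative (f1 (y t) + B t *v u t)) (at t))"

text \<open>A solution exists on \<open>[0,T)\<close> exactly when \<open>T\<close> does not exceed the maximal existence time,
  and on \<open>[0,T)\<close> it takes values in \<open>dom1\<close>, where \<open>f1\<close> is finite.\<close>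

definition is_quenching_time ::
    "(real \<Rightarrow> real^2^2) \<Rightarrow> (real \<Rightarrow> real^2) \<Rightarrow> real^2 \<Rightarrow> real \<Rightarrow> bool" where
  "is_quenching_time B u y0 T \<longleftrightarrow>
     0 < T \<and> (\<exists>y. solution_on B u y0 T y \<and> filterlim (\<lambda>t. norm (f1 (y t))) at_top (at_left T))"

definition quenching_time ::
    "(real \<Rightarrow> real^2^2) \<Rightarrow> (real \<Rightarrow> real^2) \<Rightarrow> real^2 \<Rightarrow> real" where
  "quenching_time B u y0 = (THE T. is_quenching_time B u y0 T)"

definition optimal_time :: "(real \<Rightarrow> real^2^2) \<Rightarrow> real \<Rightarrow> real^2 \<Rightarrow> real" where
  "optimal_time B \<rho>0 y0 = (INF u\<in>U_ad \<rho>0. quenching_time B u y0)"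

definition optimal_control ::
    "(real \<Rightarrow> real^2^2) \<Rightarrow> real \<Rightarrow> real^2 \<Rightarrow> (real \<Rightarrow> real^2) \<Rightarrow> bool" where
  "optimal_control B \<rho>0 y0 u \<longleftrightarrow>
     u \<in> U_ad \<rho>0 \<and> quenching_time B u y0 = optimal_time B \<rho>0 y0"

end

theory Submission
  imports Defs
begin

text \<open>Put \<open>w = y\<^sub>1 - 1\<close>, \<open>p = y\<^sub>2\<close> and \<open>b = B u\<close>. The equation becomes \<open>w' = - p / w + b\<^sub>1\<close>,
\<open>p' = 1 + w + p + b\<^sub>2\<close>, it is singular on the line \<open>w = 0\<close>, and quenching means that \<open>w\<close> reaches \<open>0\<close>. In the
coordinates \<open>(v, p)\<close> with \<open>v = w\<^sup>2\<close> the singularity disappears from the field, \<open>v' = - 2 p + 2 w b\<^sub>1\<close>, and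
only a failure of Lipschitz continuity at \<open>v = 0\<close> remains, because \<open>w = \<plusminus> sqrt v\<close>.

The set of initial data is chosen so that \<open>2 K \<bar>w\<bar> < 1\<close> and the lower bound on \<open>p\<close> are preserved: there
\<open>p' \<ge> 0\<close> and \<open>v' \<le> - 1\<close> (\<open>traj_invariant\<close>, \<open>traj_growth\<close>). Hence every trajectory quenches not later
than \<open>w\<^sub>0\<^sup>2\<close>, which is the bound on the optimal time, and on \<open>[0, T)\<close> one has \<open>w\<^sup>2 \<ge> T - t\<close>. So \<open>1 / \<bar>w\<bar>\<close>
is at most \<open>1 / sqrt (T - t)\<close>, which is integrable. This estimate drives everything else: for two
trajectories \<open>w, w'\<close> with the same start, \<open>w' - w = (v' - v) / (w' + w)\<close>, so the differences of \<open>v\<close> and of \<open>p\<close>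
satisfy a linear system with an integrable coefficient, and Gronwall's argument bounds them up to the
quenching time by the distance of the forcings (\<open>traj_comparison\<close>). Uniqueness is the case of equal
forcings; existence up to quenching is obtained by solving the system with a truncated square root and
gluing (\<open>quenching_traj_exists\<close>).

The adjoint equation \<open>\<psi>' = - f\<^sub>y \<psi>\<close> has the coefficient \<open>p / w\<^sup>2\<close>, which is not integrable at \<open>T\<close>. The factor
\<open>\<theta> = exp (- \<integral> p / w\<^sup>2)\<close> removes it, and \<open>\<theta>\<close> is comparable to \<open>\<bar>w\<bar>\<close>. Writing \<open>\<psi>\<^sub>1 = \<theta> \<phi>\<close> leaves a linear system
for \<open>(\<phi>, \<psi>\<^sub>2)\<close> with integrable coefficients, which can be solved backwards from \<open>\<phi> = - sgn w\<^sub>0\<close>, \<open>\<psi>\<^sub>2 = 0\<close>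
(\<open>adjoint_exists\<close>). The solution is nontrivial although \<open>\<psi> T = 0\<close>, and \<open>\<psi>\<^sub>1 w < 0\<close> near \<open>T\<close>.

For the maximum condition, the controls form a convex set and enter linearly, so convex variations suffice. Given an optimal \<open>u\<close> and an admissible \<open>\<upsilon>\<close>, follow the trajectory of \<open>u + \<epsilon> (\<upsilon> - u)\<close>; by optimality it
exists on \<open>[0, T)\<close>, so its \<open>v\<close> is still nonnegative at \<open>T\<close>, where the optimal \<open>v\<close> vanishes. The
pairing of \<open>(\<psi>\<^sub>1 / (2 w), \<psi>\<^sub>2)\<close> with the difference of the two trajectories has, up to a remainder, the derivative
\<open>\<epsilon> \<langle>\<psi>, B (\<upsilon> - u)\<rangle>\<close>. The remainder is at most of order \<open>\<epsilon>\<^sup>2 (T - t)\<^sup>-\<^sup>3\<^sup>/\<^sup>2\<close> and also of order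
\<open>\<epsilon> (T - t)\<^sup>-\<^sup>1\<^sup>/\<^sup>2\<close>; interpolation gives \<open>\<epsilon>\<^sup>5\<^sup>/\<^sup>4 (T - t)\<^sup>-\<^sup>3\<^sup>/\<^sup>4\<close>, which is integrable and of higher order than \<open>\<epsilon>\<close>.
Therefore \<open>\<integral> \<langle>\<psi>, B (\<upsilon> - u)\<rangle> \<le> 0\<close> (\<open>variation_inequality\<close>). Applied to a measurable pointwise maximizer
\<open>\<upsilon>\<close> of \<open>\<langle>\<psi>, B \<upsilon>\<rangle>\<close>, the integrand is nonnegative, hence zero almost everywhere.

The analytic tools are the fundamental theorem of calculus for absolutely continuous functions, the almost
everywhere differentiability of indefinite integrals, and a Picard theorem for integral equations with an
integrable Lipschitz kernel.\<close>

section \<open>Calculus of absolutely continuous functions\<close>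

lemma AE_lebesgue_on_iff_negligible:
  assumes "S \<in> sets lebesgue"
  shows "(AE t in lebesgue_on S. P t) \<longleftrightarrow> (\<exists>N. negligible N \<and> (\<forall>t\<in>S - N. P t))"
proof
  assume "AE t in lebesgue_on S. P t"
  then have "AE t in lebesgue. t \<in> S \<longrightarrow> P t"
    using assms by (simp add: AE_restrict_space_iff)
  then obtain N where "N \<in> null_sets lebesgue" "{t \<in> space lebesgue. \<not> (t \<in> S \<longrightarrow> P t)} \<subseteq> N"
    by (auto simp: eventually_ae_filter)
  then show "\<exists>N. negligible N \<and> (\<forall>t\<in>S - N. P t)"
    by (intro exI[of _ N]) (auto simp: negligible_iff_null_sets)
next
  assume "\<exists>N. negligible N \<and> (\<forall>t\<in>S - N. P t)"
  then obtain N where N: "negligible N" "\<forall>t\<in>S - N. P t" by blast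
  have "AE t in lebesgue. t \<in> S \<longrightarrow> P t"
    using N by (intro AE_I'[of N]) (auto simp: negligible_iff_null_sets)
  then show "AE t in lebesgue_on S. P t"
    using assms by (simp add: AE_restrict_space_iff)
qed

text \<open>The gauge integral is the right tool here: the gauge treats the exceptional null set \<open>N\<close> by means of an open set of
small measure, where absolute continuity bounds the increments of \<open>y\<close>, and elsewhere it makes the increments
close to \<open>f\<close> times the length of the interval. The hypothesis is stated for an arbitrary Euclidean range
so that it covers both vector-valued trajectories and real functions computed from them.\<close>

lemma fundamental_theorem_of_calculus_absolutely_continuous:
  fixes y :: "real \<Rightarrow> 'a::euclidean_space"
  assumes ac: "\<And>e. 0 < e \<Longrightarrow> \<exists>\<delta>>0. \<forall>d. d division_of (\<Union>d) \<and> \<Union>d \<subseteq> {a..b} \<and>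
        (\<Sum>k\<in>d. Sup k - Inf k) < \<delta> \<longrightarrow> (\<Sum>k\<in>d. norm (y (Sup k) - y (Inf k))) < e"
    and "a \<le> b" and N: "negligible N"
    and der: "\<And>t. t \<in> {a<..<b} - N \<Longrightarrow> (y has_vector_derivative f t) (at t)"
  shows "(f has_integral (y b - y a)) {a..b}"
proof -
  define M where "M = N \<union> {a, b}"
  have M: "negligible M" using N by (simp add: M_def)
  define g where "g t = (if t \<in> M then 0 else f t)" for t
  have derM: "(y has_vector_derivative f t) (at t)" if "t \<in> {a..b} - M" for t
    using der[of t] that by (force simp: M_def)
  have int_g: "(g has_integral (y b - y a)) (cbox a b)"
    unfolding has_integral
  proof (intro allI impI)
    fix e :: real assume e: "e > 0"
    obtain \<delta> where \<delta>: "\<delta> > 0" and ac': "\<And>d. d division_of (\<Union>d) \<Longrightarrow> \<Union>d \<subseteq> {a..b} \<Longrightarrow>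
        (\<Sum>k\<in>d. Sup k - Inf k) < \<delta> \<Longrightarrow> (\<Sum>k\<in>d. norm (y (Sup k) - y (Inf k))) < e/2"
      using ac[of "e/2"] e by auto
    have "M \<in> sets lebesgue" using M by (simp add: negligible_imp_sets)
    then obtain U where U: "open U" "M \<subseteq> U" "U - M \<in> lmeasurable" "emeasure lebesgue (U - M) < ennreal \<delta>"
      using sets_lebesgue_outer_open \<delta> by metis
    have Ul: "U \<in> lmeasurable"
      using U(2,3) M by (metis Un_Diff_cancel2 fmeasurable.Un negligible_imp_measurable sup.absorb1)
    have "measure lebesgue U = measure lebesgue (U - M)"
      using M by (metis Ul measure_Diff_null_set negligible_iff_null_sets fmeasurableD)
    also have "\<dots> < \<delta>"
      using U(4) \<delta> by (simp add: emeasure_eq_measure2[OF U(3)] ennreal_less_iff)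
    finally have Um: "measure lebesgue U < \<delta>" .
    define \<eta> where "\<eta> = e / (2 * (b - a + 1))"
    have \<eta>: "\<eta> > 0" using e assms(2) by (auto simp: \<eta>_def)
    have "\<exists>r>0. \<forall>u. \<bar>u - t\<bar> < r \<longrightarrow> norm (y u - y t - (u - t) *\<^sub>R f t) \<le> \<eta> * \<bar>u - t\<bar>"
      if "t \<in> {a..b} - M" for t
      using derM[OF that] \<eta> unfolding has_vector_derivative_def has_derivative_within_alt
      by (auto simp: real_norm_def)
    then obtain r where r: "\<And>t. t \<in> {a..b} - M \<Longrightarrow> r t > 0"
       "\<And>t u. t \<in> {a..b} - M \<Longrightarrow> \<bar>u - t\<bar> < r t \<Longrightarrow> norm (y u - y t - (u - t) *\<^sub>R f t) \<le> \<eta> * \<bar>u - t\<bar>"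
      by metis
    \<comment> \<open>Intervals tagged in the null set stay inside \<open>U\<close>; the others are small enough for
      the derivative estimate.\<close>
    define \<gamma> where "\<gamma> t = (if t \<in> M then U else if t \<in> {a..b} then ball t (r t) else ball t 1)" for t
    have gau: "gauge \<gamma>"
      using U r(1) by (auto simp: gauge_def \<gamma>_def)
    have est: "norm ((\<Sum>(x,K)\<in>p. measure lborel K *\<^sub>R g x) - (y b - y a)) < e"
      if p: "p tagged_division_of cbox a b" "\<gamma> fine p" for p
    proof -
      define h where "h = (\<lambda>(x::real, K). measure lborel K *\<^sub>R g x - (y (Sup K) - y (Inf K)))"
      have fp: "finite p" using p by auto
      have K: "\<exists>u v. K = {u..v} \<and> u \<le> v \<and> u \<le> x \<and> x \<le> v \<and> a \<le> u \<and> v \<le> b" if xK: "(x,K) \<in> p" for x K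
      proof -
        obtain u v where "K = cbox u v" using tagged_division_ofD(4)[OF p(1) xK] by blast
        moreover have "x \<in> K" "K \<subseteq> cbox a b" using tagged_division_ofD(2,3)[OF p(1) xK] by auto
        ultimately show ?thesis by auto
      qed
      have "(\<Sum>(x,K)\<in>p. measure lborel K *\<^sub>R g x) - (y b - y a) = sum h p"
        using additive_tagged_division_1[OF assms(2), of p y] p(1)
        by (simp add: h_def split_def sum_subtractf)
      also have "norm \<dots> \<le> (\<Sum>z\<in>p. norm (h z))" by (rule norm_sum)
      also have "\<dots> = (\<Sum>z\<in>{z\<in>p. fst z \<in> M}. norm (h z)) + (\<Sum>z\<in>{z\<in>p. fst z \<notin> M}. norm (h z))"
        using fp by (subst sum.union_disjoint[symmetric]) (auto intro!: sum.cong)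
      also have "(\<Sum>z\<in>{z\<in>p. fst z \<in> M}. norm (h z)) < e/2"
      proof -
        define q where "q = {z\<in>p. fst z \<in> M}"
        have q: "q tagged_partial_division_of cbox a b"
          using tagged_partial_division_subset[of p "cbox a b" q] p(1)
          by (auto simp: q_def tagged_division_of_def)
        have qd: "q tagged_division_of (\<Union>(snd ` q))"
          using tagged_partial_division_of_Union_self[OF q] .
        have div: "(snd ` q) division_of (\<Union>(snd ` q))"
          by (rule division_of_tagged_division[OF qd])
        have sub: "\<Union>(snd ` q) \<subseteq> {a..b}" using K by (force simp: q_def)
        have subU: "\<Union>(snd ` q) \<subseteq> U"
          using p(2) by (force simp: q_def fine_def \<gamma>_def)
        have "(\<Sum>k\<in>snd ` q. Sup k - Inf k) = (\<Sum>k\<in>snd ` q. measure lebesgue k)"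
        proof (rule sum.cong)
          fix k assume "k \<in> snd ` q"
          then obtain x where "(x,k) \<in> p" by (auto simp: q_def)
          from K[OF this] show "Sup k - Inf k = measure lebesgue k" by auto
        qed simp
        also have "\<dots> = measure lebesgue (\<Union>(snd ` q))"
          using content_division[OF div] .
        also have "\<dots> \<le> measure lebesgue U"
          using subU Ul by (intro measure_mono_fmeasurable) (use lmeasurable_division[OF div] in auto)
        finally have "(\<Sum>k\<in>snd ` q. norm (y (Sup k) - y (Inf k))) < e/2"
          using ac'[OF div sub] Um by simp
        \<comment> \<open>\<open>Sup {}\<close> and \<open>Inf {}\<close> are unspecified, so the empty interval
          must be excluded by hand.\<close>
        moreover define D where "D k = (if k = {} then 0 else norm (y (Sup k) - y (Inf k)))" for k
        have "(\<Sum>z\<in>q. norm (h z)) = (\<Sum>(x,k)\<in>q. D k)"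
        proof (rule sum.cong)
          fix z assume z: "z \<in> q"
          then have "snd z \<noteq> {}" using K[of "fst z" "snd z"] by (auto simp: q_def)
          with z show "norm (h z) = (case z of (x,k) \<Rightarrow> D k)"
            by (auto simp: h_def q_def g_def D_def norm_minus_commute split_beta)
        qed simp
        moreover have "\<dots> = (\<Sum>k\<in>snd ` q. D k)"
          proof (rule sum.over_tagged_division_lemma[OF qd])
          fix u v :: real assume "box u v = {}"
          then have "cbox u v = {} \<or> u = v" by force
          then show "D (cbox u v) = 0" by (auto simp: D_def)
        qed
        moreover have "\<dots> \<le> (\<Sum>k\<in>snd ` q. norm (y (Sup k) - y (Inf k)))"
          by (rule sum_mono) (simp add: D_def)
        ultimately show ?thesis by (simp add: q_def)
      qed
      also have "(\<Sum>z\<in>{z\<in>p. fst z \<notin> M}. norm (h z)) \<le> (\<Sum>z\<in>{z\<in>p. fst z \<notin> M}. \<eta> * measure lborel (snd z))"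
      proof (rule sum_mono)
        fix z assume z: "z \<in> {z\<in>p. fst z \<notin> M}"
        then obtain x k where zx: "z = (x,k)" "(x,k) \<in> p" "x \<notin> M" by (cases z) auto
        obtain u v where uv: "k = {u..v}" "u \<le> v" "u \<le> x" "x \<le> v" "a \<le> u" "v \<le> b"
          using K[OF zx(2)] by blast
        have x: "x \<in> {a..b} - M" using uv zx by auto
        have "k \<subseteq> ball x (r x)" using p(2) zx x by (force simp: fine_def \<gamma>_def)
        moreover have "u \<in> k" "v \<in> k" using uv by auto
          ultimately have "u \<in> ball x (r x)" "v \<in> ball x (r x)" by blast+
        then have 1: "norm (y u - y x - (u - x) *\<^sub>R f x) \<le> \<eta> * \<bar>u - x\<bar>"
            "norm (y v - y x - (v - x) *\<^sub>R f x) \<le> \<eta> * \<bar>v - x\<bar>"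
          using r(2)[OF x] by (auto simp: dist_real_def abs_minus_commute)
        have "h z = (y u - y x - (u - x) *\<^sub>R f x) - (y v - y x - (v - x) *\<^sub>R f x)"
          using uv zx by (simp add: h_def g_def algebra_simps)
        then have "norm (h z) \<le> \<eta> * \<bar>u - x\<bar> + \<eta> * \<bar>v - x\<bar>"
          using norm_triangle_ineq4[of "y u - y x - (u - x) *\<^sub>R f x" "y v - y x - (v - x) *\<^sub>R f x"] 1
          by (smt (verit))
        also have "\<dots> = \<eta> * measure lborel (snd z)" using uv zx by (simp add: algebra_simps)
        finally show "norm (h z) \<le> \<eta> * measure lborel (snd z)" .
      qed
      also have "\<dots> \<le> (\<Sum>z\<in>p. \<eta> * measure lborel (snd z))"
        using \<eta> fp by (intro sum_mono2) auto
      also have "\<dots> = \<eta> * (b - a)"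
        using additive_content_tagged_division[OF p(1)] assms(2)
        by (simp add: sum_distrib_left[symmetric] split_def)
      also have "\<dots> \<le> e/2"
        using e assms(2) by (auto simp: \<eta>_def field_simps)
      finally show ?thesis by simp
    qed
    show "\<exists>\<gamma>. gauge \<gamma> \<and> (\<forall>\<D>. \<D> tagged_division_of cbox a b \<and> \<gamma> fine \<D> \<longrightarrow>
         norm ((\<Sum>(x,K)\<in>\<D>. measure lborel K *\<^sub>R g x) - (y b - y a)) < e)"
      by (rule exI[of _ \<gamma>]) (use gau est in simp)
  qed
  show ?thesis
    by (rule has_integral_spike[OF M, of _ f g]) (use int_g in \<open>auto simp: g_def\<close>)
qed

text \<open>Lebesgue's differentiation theorem on the line, for every gauge-integrable function. At a bad point there are
arbitrarily short intervals on which the difference quotient misses \<open>f\<close> by at least \<open>1 / (n + 1)\<close>. Vitali's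
theorem selects disjoint intervals of this kind that cover almost all bad points, and Henstock's lemma bounds the
sum of the errors on such intervals, and thereby their total length.\<close>

lemma indefinite_integral_has_vector_derivative_ae:
  fixes f :: "real \<Rightarrow> 'a::euclidean_space"
  assumes f: "f integrable_on {a..b}"
  obtains N where "negligible N"
    "\<And>t. t \<in> {a<..<b} - N \<Longrightarrow> ((\<lambda>u. integral {a..u} f) has_vector_derivative f t) (at t)"
proof -
  define F where "F u = integral {a..u} f" for u
  define Bad where "Bad n = {t \<in> {a<..<b}. \<forall>d>0. \<exists>u\<in>{a..b}. u \<noteq> t \<and> \<bar>u - t\<bar> < d \<and>
      \<bar>u - t\<bar> / real (Suc n) < norm (F u - F t - (u - t) *\<^sub>R f t)}" for n
  have Fdiff: "integral {s..t} f = F t - F s" if "a \<le> s" "s \<le> t" "t \<le> b" for s t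
    using Henstock_Kurzweil_Integration.integral_combine[of a s t f] that
      integrable_subinterval_real[OF f, of a t] by (simp add: F_def algebra_simps)
  have "negligible (Bad n)" for n
    unfolding negligible_outer_le
  proof (intro allI impI)
    fix e :: real assume e: "e > 0"
    obtain \<gamma> where \<gamma>: "gauge \<gamma>" and hen: "\<And>p. \<lbrakk>p tagged_partial_division_of (cbox a b); \<gamma> fine p\<rbrakk> \<Longrightarrow>
        (\<Sum>(x,k)\<in>p. norm (measure lborel k *\<^sub>R f x - integral k f)) < e / real (Suc n)"
      using Henstock_lemma[of f a b "e / real (Suc n)"] f e by auto
    define I where "I = (\<lambda>(t::real,u). {min t u..max t u})"
    \<comment> \<open>The Vitali family: short bad intervals with one endpoint \<open>t\<close> in the bad set, fine
      with respect to the gauge.\<close>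
    define K where "K = {(t,u). t \<in> Bad n \<and> u \<in> {a..b} \<and> u \<noteq> t \<and> I (t,u) \<subseteq> \<gamma> t \<and>
      \<bar>u - t\<bar> / real (Suc n) < norm (F u - F t - (u - t) *\<^sub>R f t)}"
    define c where "c = (\<lambda>(t::real,u). (t + u) / 2)"
    define r where "r = (\<lambda>(t::real,u). \<bar>u - t\<bar> / 2)"
    have cb: "cball (c i) (r i) = I i" for i
    proof -
      obtain t u where i: "i = (t,u)" by (cases i)
      have "min t u = (t + u) / 2 - \<bar>u - t\<bar> / 2" "max t u = (t + u) / 2 + \<bar>u - t\<bar> / 2"
        by (simp_all add: min_def max_def abs_if field_simps)
      then show ?thesis by (simp add: i c_def r_def I_def cball_eq_atLeastAtMost)
    qed
    have rpos: "\<And>i. i \<in> K \<Longrightarrow> 0 < r i" by (auto simp: K_def r_def)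
    have vit: "\<exists>i. i \<in> K \<and> x \<in> cball (c i) (r i) \<and> r i < d" if x: "x \<in> Bad n" and d: "d > 0" for x d
    proof -
      have "open (\<gamma> x)" "x \<in> \<gamma> x" using \<gamma> by (auto simp: gauge_def)
      then obtain d' where d': "d' > 0" "ball x d' \<subseteq> \<gamma> x" using openE by blast
      obtain u where u: "u \<in> {a..b}" "u \<noteq> x" "\<bar>u - x\<bar> < min d d'"
         "\<bar>u - x\<bar> / real (Suc n) < norm (F u - F x - (u - x) *\<^sub>R f x)"
      proof -
        have "\<forall>d>0. \<exists>u\<in>{a..b}. u \<noteq> x \<and> \<bar>u - x\<bar> < d \<and>
            \<bar>u - x\<bar> / real (Suc n) < norm (F u - F x - (u - x) *\<^sub>R f x)"
          using x unfolding Bad_def mem_Collect_eq by (rule conjunct2)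
        from this[rule_format, of "min d d'"] d d'(1) that show thesis by auto
      qed
      have "I (x,u) \<subseteq> ball x d'" using u(3) by (auto simp: I_def dist_real_def)
      then have "(x,u) \<in> K" using u x d' by (auto simp: K_def)
      moreover have "x \<in> cball (c (x,u)) (r (x,u))" unfolding cb by (auto simp: I_def)
      moreover have "r (x,u) < d" using u(3) d by (auto simp: r_def)
      ultimately show ?thesis by blast
    qed
    obtain C where C: "countable C" "C \<subseteq> K" "pairwise (\<lambda>i j. disjnt (I i) (I j)) C"
        "negligible (Bad n - (\<Union>i\<in>C. I i))"
      using Vitali_covering_theorem_cballs[of K r "Bad n" c, OF rpos vit] unfolding cb by blast
    have bound: "measure lebesgue (\<Union>i\<in>D. I i) \<le> e" if D: "D \<subseteq> C" "finite D" for D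
    proof -
      define p where "p = (\<lambda>i. (fst i, I i)) ` D"
      have inj: "inj_on (\<lambda>i. (fst i, I i)) D"
      proof (rule inj_onI)
        fix i j assume ij: "i \<in> D" "j \<in> D" "(fst i, I i) = (fst j, I j)"
        have "fst i \<in> I i" "fst i \<in> I j"
          using ij(3) by (simp_all add: I_def split_beta)
        then have "\<not> disjnt (I i) (I j)" by (auto simp: disjnt_def)
        then show "i = j" using C(3) D(1) ij(1,2) by (auto simp: pairwise_def)
      qed
      have DK: "i \<in> K" if "i \<in> D" for i using that D C(2) by blast
      have part: "p tagged_partial_division_of (cbox a b)"
        unfolding tagged_partial_division_of_def
      proof (intro conjI allI impI)
        show "finite p" using D by (simp add: p_def)
        fix x k assume "(x,k) \<in> p"
        then obtain u where xu: "(x,u) \<in> D" "k = I (x,u)" by (auto simp: p_def)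
        show "x \<in> k" using xu by (auto simp: I_def)
        show "k \<subseteq> cbox a b" using DK[OF xu(1)] xu(2) by (auto simp: I_def K_def Bad_def)
        show "\<exists>a b. k = cbox a b" unfolding xu(2) I_def by auto
      next
        fix x1 k1 x2 k2 assume as: "(x1, k1) \<in> p \<and> (x2, k2) \<in> p \<and> (x1, k1) \<noteq> (x2, k2)"
        then obtain i j where ij: "i \<in> D" "j \<in> D" "(x1,k1) = (fst i, I i)" "(x2,k2) = (fst j, I j)"
          unfolding p_def by blast
        with as have "i \<noteq> j" by metis
        with ij C(3) D(1) have "disjnt k1 k2" unfolding pairwise_def by (metis prod.inject subsetD)
        then show "interior k1 \<inter> interior k2 = {}"
          using interior_subset unfolding disjnt_def by blast
      qed
      have fine: "\<gamma> fine p"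
      proof (rule fineI)
        fix x k assume "(x, k) \<in> p"
        then obtain u where "(x,u) \<in> D" "k = I (x,u)" by (auto simp: p_def)
        then show "k \<subseteq> \<gamma> x" using DK[of "(x,u)"] by (simp add: K_def)
      qed
      have eq: "norm (measure lborel (I i) *\<^sub>R f (fst i) - integral (I i) f)
          = norm (F (snd i) - F (fst i) - (snd i - fst i) *\<^sub>R f (fst i))" if "i \<in> D" for i
      proof -
        obtain t u where i: "i = (t,u)" by (cases i)
        have tu: "t \<in> {a..b}" "u \<in> {a..b}" using DK[OF that] by (auto simp: i K_def Bad_def)
        show ?thesis
        proof (cases "t \<le> u")
          case True
          then have "I i = {t..u}" by (simp add: i I_def min_def max_def)
          then show ?thesis using Fdiff[of t u] tu True
            by (simp add: i norm_minus_commute)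
        next
          case False
          then have "I i = {u..t}" by (simp add: i I_def min_def max_def)
          moreover have "(t - u) *\<^sub>R f t - (F t - F u) = F u - F t - (u - t) *\<^sub>R f t"
            by (simp add: algebra_simps)
          moreover have "measure lborel (I i) *\<^sub>R f (fst i) - integral (I i) f = (t - u) *\<^sub>R f t - (F t - F u)"
            using Fdiff[of u t] tu False \<open>I i = {u..t}\<close> by (simp add: i)
          ultimately show ?thesis by (simp only: i fst_conv snd_conv)
        qed
      qed
      have meas: "measure lebesgue (I i) = \<bar>snd i - fst i\<bar>" for i
        by (auto simp: I_def split_beta)
      have "measure lebesgue (\<Union>i\<in>D. I i) \<le> (\<Sum>i\<in>D. measure lebesgue (I i))"
        using D(2) by (intro measure_UNION_le) (auto simp: I_def split_beta)
      also have "\<dots> = real (Suc n) * (\<Sum>i\<in>D. \<bar>snd i - fst i\<bar> / real (Suc n))"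
        by (simp add: meas sum_distrib_left)
      also have "\<dots> \<le> real (Suc n) * (\<Sum>i\<in>D. norm (measure lborel (I i) *\<^sub>R f (fst i) - integral (I i) f))"
      proof (intro mult_left_mono sum_mono)
        fix i assume i: "i \<in> D"
        show "\<bar>snd i - fst i\<bar> / real (Suc n) \<le> norm (measure lborel (I i) *\<^sub>R f (fst i) - integral (I i) f)"
          using DK[OF i] unfolding eq[OF i] K_def by (auto simp: less_imp_le)
      qed simp
      also have "(\<Sum>i\<in>D. norm (measure lborel (I i) *\<^sub>R f (fst i) - integral (I i) f))
          = (\<Sum>(x,k)\<in>p. norm (measure lborel k *\<^sub>R f x - integral k f))"
        unfolding p_def by (subst sum.reindex[OF inj]) simp
      also have "\<dots> \<le> e / real (Suc n)" using hen[OF part fine] by simp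
      finally show ?thesis using e by simp
    qed
    have lm: "(\<Union>i\<in>C. I i) \<in> lmeasurable"
      by (rule fmeasurable_UN_bound[OF C(1) _ bound]) (auto simp: I_def split_beta)
    have le: "measure lebesgue (\<Union>i\<in>C. I i) \<le> e"
      by (rule measure_UN_bound[OF C(1) _ bound]) (auto simp: I_def split_beta)
    let ?T = "(\<Union>i\<in>C. I i) \<union> (Bad n - (\<Union>i\<in>C. I i))"
    have "?T \<in> lmeasurable" using lm negligible_imp_measurable[OF C(4)] by (rule fmeasurable.Un)
    moreover have "measure lebesgue ?T \<le> e"
    proof -
      have "measure lebesgue ?T = measure lebesgue (\<Union>i\<in>C. I i)"
        by (rule measure_Un_null_set) (use C(4) lm in \<open>auto simp: negligible_iff_null_sets\<close>)
      with le show ?thesis by simp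
    qed
    ultimately show "\<exists>T. Bad n \<subseteq> T \<and> T \<in> lmeasurable \<and> measure lebesgue T \<le> e"
      by (intro exI[of _ ?T]) auto
  qed
  then have neg: "negligible (\<Union>n. Bad n)" by (rule negligible_Union_nat)
  have "(F has_vector_derivative f t) (at t)" if t: "t \<in> {a<..<b} - (\<Union>n. Bad n)" for t
  proof -
    have "\<exists>d>0. \<forall>u. \<bar>u - t\<bar> < d \<longrightarrow> norm (F u - F t - (u - t) *\<^sub>R f t) \<le> e * \<bar>u - t\<bar>"
      if e: "e > 0" for e
    proof -
      obtain n where n: "1 / real (Suc n) < e" using nat_approx_posE[OF e] by blast
      obtain d where d: "d > 0" "\<And>u. u \<in> {a..b} \<Longrightarrow> u \<noteq> t \<Longrightarrow> \<bar>u - t\<bar> < d \<Longrightarrow>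
          norm (F u - F t - (u - t) *\<^sub>R f t) \<le> \<bar>u - t\<bar> / real (Suc n)"
      proof -
        have "t \<notin> Bad n" "t \<in> {a<..<b}" using t by auto
        then obtain d where "d > 0" "\<not> (\<exists>u\<in>{a..b}. u \<noteq> t \<and> \<bar>u - t\<bar> < d \<and>
            \<bar>u - t\<bar> / real (Suc n) < norm (F u - F t - (u - t) *\<^sub>R f t))"
          unfolding Bad_def by blast
        then show thesis by (intro that[of d]) (auto simp: not_less)
      qed
      show ?thesis
      proof (intro exI[of _ "min d (min (t - a) (b - t))"] conjI allI impI)
        show "0 < min d (min (t - a) (b - t))" using d t by auto
        fix u assume u: "\<bar>u - t\<bar> < min d (min (t - a) (b - t))"
        show "norm (F u - F t - (u - t) *\<^sub>R f t) \<le> e * \<bar>u - t\<bar>"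
        proof (cases "u = t")
          case False
          have "norm (F u - F t - (u - t) *\<^sub>R f t) \<le> \<bar>u - t\<bar> / real (Suc n)"
            using u False t by (intro d(2)) auto
          also have "\<dots> \<le> e * \<bar>u - t\<bar>"
            using mult_right_mono[OF less_imp_le[OF n], of "\<bar>u - t\<bar>"] by simp
          finally show ?thesis .
        qed simp
      qed
    qed
    then show ?thesis
      unfolding has_vector_derivative_def has_derivative_within_alt
      by (auto intro: bounded_linear_scaleR_left)
  qed
  with neg that show thesis unfolding F_def by blast
qed

section \<open>Integral equations and Lipschitz functions\<close>

text \<open>Picard's theorem with a Lipschitz constant \<open>a s\<close> that may be singular but has a continuous
primitive \<open>A\<close>. In the norm weighted by \<open>exp (- 2 A)\<close> the integral operator is a contraction with factor \<open>1/2\<close>,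
since \<open>a exp (2 A)\<close> is the derivative of \<open>exp (2 A) / 2\<close>, so a single fixed point covers the whole interval.\<close>

lemma integral_equation_has_solution:
  fixes G :: "real \<Rightarrow> 'a::euclidean_space \<Rightarrow> 'a"
  assumes "0 \<le> T"
    and A: "continuous_on {0..T} A" "\<And>t. t \<in> {0<..<T} \<Longrightarrow> (A has_real_derivative a t) (at t)"
    and G: "\<And>x. continuous_on {0..T} x \<Longrightarrow> (\<lambda>s. G s (x s)) integrable_on {0..T}"
    and lip: "\<And>s x y. s \<in> {0<..<T} \<Longrightarrow> norm (G s x - G s y) \<le> a s * norm (x - y)"
  obtains x where "continuous_on {0..T} x"
    "\<And>t. t \<in> {0..T} \<Longrightarrow> x t = x0 + integral {0..t} (\<lambda>s. G s (x s))"
proof -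
  \<comment> \<open>The operator is conjugated with the weight, so that the contraction property holds in the usual
    supremum norm.\<close>
  define h where "h q t = exp (- 2 * A t) *\<^sub>R (x0 + integral {0..t} (\<lambda>s. G s (exp (2 * A s) *\<^sub>R q s)))"
    for q :: "real \<Rightarrow> 'a" and t
  have cq: "continuous_on {0..T} (\<lambda>s. exp (2 * A s) *\<^sub>R q s)" if "continuous_on {0..T} q" for q :: "real \<Rightarrow> 'a"
    by (intro continuous_intros A that)
  have ch: "continuous_on {0..T} (h q)" if "continuous_on {0..T} q" for q
    unfolding h_def by (intro continuous_intros A indefinite_integral_continuous_1 G cq that)
  have hdiff: "norm (h q t - h q' t) \<le> D / 2"
    if q: "continuous_on {0..T} q" "continuous_on {0..T} q'" and D: "\<And>s. norm (q s - q' s) \<le> D"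
      and t: "t \<in> {0..T}" for q q' D t
  proof -
    define I where "I q = (\<lambda>s. G s (exp (2 * A s) *\<^sub>R q s))" for q
    have D0: "D \<ge> 0" using D[of 0] norm_ge_zero order_trans by blast
    have int: "I q integrable_on {0..t}" "I q' integrable_on {0..t}"
      using G[OF cq[OF q(1)]] G[OF cq[OF q(2)]] t
      by (auto simp: I_def intro: integrable_subinterval_real)
    have "((\<lambda>s. exp (2 * A s) / 2 * D) has_real_derivative a s * exp (2 * A s) * D) (at s)"
      if "s \<in> {0<..<t}" for s
      using that t by (auto intro!: derivative_eq_intros A(2))
    moreover have "continuous_on {0..t} (\<lambda>s. exp (2 * A s) / 2 * D)"
      by (intro continuous_intros continuous_on_subset[OF A(1)]) (use t in auto)
    ultimately have aint: "((\<lambda>s. a s * exp (2 * A s) * D) has_integral exp (2 * A t) / 2 * D - exp (2 * A 0) / 2 * D) {0..t}"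
      using t by (intro fundamental_theorem_of_calculus_interior)
        (auto simp: has_real_derivative_iff_has_vector_derivative)
    have "norm (integral {0..t} (\<lambda>s. I q s - I q' s)) = norm (integral {0<..<t} (\<lambda>s. I q s - I q' s))"
      by (simp add: integral_open_interval_real)
    also have "\<dots> \<le> integral {0<..<t} (\<lambda>s. a s * exp (2 * A s) * D)"
    proof (rule integral_norm_bound_integral)
      show "(\<lambda>s. I q s - I q' s) integrable_on {0<..<t}"
        using integrable_diff[OF int] by (simp only: integrable_on_Icc_iff_Ioo)
      show "(\<lambda>s. a s * exp (2 * A s) * D) integrable_on {0<..<t}"
        using has_integral_integrable[OF aint] by (simp only: integrable_on_Icc_iff_Ioo)
      fix s assume s: "s \<in> {0<..<t}"
      then have s': "s \<in> {0<..<T}" using t by auto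
      have a0: "0 \<le> a s"
      proof -
        \<comment> \<open>The hypothesis \<open>lip\<close> forces \<open>a s\<close> to be nonnegative because the
          space contains a nonzero vector.\<close>
        obtain z :: 'a where "norm z = 1" using vector_choose_size[of 1] by auto
        then have "norm (G s z - G s 0) \<le> a s" using lip[OF s', of z 0] by simp
        then show ?thesis using norm_ge_zero order_trans by blast
      qed
      have "norm (I q s - I q' s) \<le> a s * norm (exp (2 * A s) *\<^sub>R (q s - q' s))"
        using lip[OF s'] by (simp add: I_def scaleR_diff_right)
      also have "\<dots> \<le> a s * (exp (2 * A s) * D)"
        using a0 D by (intro mult_left_mono) auto
      finally show "norm (I q s - I q' s) \<le> a s * exp (2 * A s) * D" by (simp add: mult.assoc)
    qed
    also have "\<dots> = exp (2 * A t) / 2 * D - exp (2 * A 0) / 2 * D"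
      using integral_unique[OF aint] by (simp only: integral_open_interval_real)
    also have "\<dots> \<le> exp (2 * A t) / 2 * D" using D0 by simp
    finally have "norm (integral {0..t} (\<lambda>s. I q s - I q' s)) \<le> exp (2 * A t) / 2 * D" .
    moreover have "h q t - h q' t = exp (- 2 * A t) *\<^sub>R integral {0..t} (\<lambda>s. I q s - I q' s)"
      using int by (simp add: h_def I_def[symmetric] scaleR_diff_right[symmetric]
          Henstock_Kurzweil_Integration.integral_diff)
    ultimately have "norm (h q t - h q' t) \<le> exp (- 2 * A t) * (exp (2 * A t) / 2 * D)"
      by simp
    also have "\<dots> = D / 2" by (simp add: exp_minus field_simps)
    finally show ?thesis .
  qed
  have "\<exists>P :: real \<Rightarrow>\<^sub>C 'a. \<forall>t. apply_bcontfun P t = h (apply_bcontfun q) (clamp 0 T t)" for q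
    using continuous_on_cbox_bcontfunE[of 0 T "h (apply_bcontfun q)"] ch[of "apply_bcontfun q"]
    by (metis cbox_interval continuous_on_apply_bcontfun)
  then obtain P :: "(real \<Rightarrow>\<^sub>C 'a) \<Rightarrow> (real \<Rightarrow>\<^sub>C 'a)"
    where P: "\<And>q t. apply_bcontfun (P q) t = h (apply_bcontfun q) (clamp 0 T t)"
    by metis
  have cl: "clamp 0 T t \<in> {0..T}" for t :: real
    using clamp_in_interval[of 0 T t] assms(1) by auto
  have "\<forall>q q'. dist (P q) (P q') \<le> 1/2 * dist q q'"
  proof (intro allI dist_bound)
    fix q q' t
    have "norm (h (apply_bcontfun q) (clamp 0 T t) - h (apply_bcontfun q') (clamp 0 T t)) \<le> dist q q' / 2"
      by (intro hdiff cl continuous_on_apply_bcontfun) (metis dist_bounded dist_norm)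
    then show "dist (apply_bcontfun (P q) t) (apply_bcontfun (P q') t) \<le> 1/2 * dist q q'"
      by (simp add: P dist_norm)
  qed
  then obtain q where q: "P q = q"
    using banach_fix_type[of "1/2" P] by auto
  define x where "x t = exp (2 * A t) *\<^sub>R apply_bcontfun q t" for t
  show thesis
  proof
    show "continuous_on {0..T} x" unfolding x_def by (rule cq) simp
    fix t assume t: "t \<in> {0..T}"
    then have "clamp 0 T t = t" by (simp add: clamp_cancel_cbox)
    then have "apply_bcontfun q t = h (apply_bcontfun q) t" using P[of q t] q by simp
    then have "x t = exp (2 * A t) *\<^sub>R h (apply_bcontfun q) t" by (simp add: x_def)
    also have "\<dots> = x0 + integral {0..t} (\<lambda>s. G s (x s))"
      by (simp add: h_def x_def[symmetric] exp_minus)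
    finally show "x t = x0 + integral {0..t} (\<lambda>s. G s (x s))" .
  qed
qed

text \<open>The existence of some constant \<open>L\<close> with \<open>L-lipschitz_on X f\<close>, for real functions. Without the constant,
the functions on a compact set that have this property are closed under products and quotients.\<close>

definition lip_on :: "real set \<Rightarrow> (real \<Rightarrow> real) \<Rightarrow> bool" where
  "lip_on X f \<longleftrightarrow> (\<exists>L\<ge>0. \<forall>s\<in>X. \<forall>t\<in>X. \<bar>f s - f t\<bar> \<le> L * \<bar>s - t\<bar>)"

lemma lip_onI: "(\<And>s t. s \<in> X \<Longrightarrow> t \<in> X \<Longrightarrow> \<bar>f s - f t\<bar> \<le> L * \<bar>s - t\<bar>) \<Longrightarrow> 0 \<le> L \<Longrightarrow> lip_on X f"
  by (auto simp: lip_on_def)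

lemma lip_on_const: "lip_on X (\<lambda>t. c)"
  by (rule lip_onI[of _ _ 0]) auto

lemma lip_on_subset: "lip_on X f \<Longrightarrow> Y \<subseteq> X \<Longrightarrow> lip_on Y f"
  unfolding lip_on_def by (meson subsetD)

lemma lip_on_cong: "lip_on X f \<Longrightarrow> (\<And>t. t \<in> X \<Longrightarrow> f t = g t) \<Longrightarrow> lip_on X g"
  unfolding lip_on_def by (metis)

lemma lip_on_imp_continuous_on: "lip_on X f \<Longrightarrow> continuous_on X f"
proof -
  assume "lip_on X f"
  then obtain L where "L \<ge> 0" "\<forall>s\<in>X. \<forall>t\<in>X. \<bar>f s - f t\<bar> \<le> L * \<bar>s - t\<bar>"
    unfolding lip_on_def by blast
  then have "L-lipschitz_on X f" by (auto simp: lipschitz_on_def dist_real_def)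
  then show ?thesis by (rule lipschitz_on_continuous_on)
qed

lemma lip_on_bounded:
  assumes "lip_on X f" "compact X"
  obtains C where "C > 0" "\<And>t. t \<in> X \<Longrightarrow> \<bar>f t\<bar> \<le> C"
proof -
  have "bounded (f ` X)"
    using assms by (intro compact_imp_bounded compact_continuous_image lip_on_imp_continuous_on)
  then show thesis using that unfolding bounded_pos by (auto simp: real_norm_def)
qed

lemma lip_on_add: "lip_on X f \<Longrightarrow> lip_on X g \<Longrightarrow> lip_on X (\<lambda>t. f t + g t)"
proof -
  assume "lip_on X f" "lip_on X g"
  then obtain L M where "L \<ge> 0" "M \<ge> 0" "\<And>s t. s\<in>X \<Longrightarrow> t\<in>X \<Longrightarrow> \<bar>f s - f t\<bar> \<le> L * \<bar>s - t\<bar>"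
      "\<And>s t. s\<in>X \<Longrightarrow> t\<in>X \<Longrightarrow> \<bar>g s - g t\<bar> \<le> M * \<bar>s - t\<bar>"
    unfolding lip_on_def by blast
  then show ?thesis
    by (intro lip_onI[of _ _ "L + M"]) (fastforce simp: algebra_simps)+
qed

lemma lip_on_mult:
  assumes "lip_on X f" "lip_on X g" "compact X"
  shows "lip_on X (\<lambda>t. f t * g t)"
proof -
  obtain L M where LM: "L \<ge> 0" "M \<ge> 0" "\<And>s t. s\<in>X \<Longrightarrow> t\<in>X \<Longrightarrow> \<bar>f s - f t\<bar> \<le> L * \<bar>s - t\<bar>"
      "\<And>s t. s\<in>X \<Longrightarrow> t\<in>X \<Longrightarrow> \<bar>g s - g t\<bar> \<le> M * \<bar>s - t\<bar>"
    using assms unfolding lip_on_def by blast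
  obtain C where C: "C > 0" "\<And>t. t \<in> X \<Longrightarrow> \<bar>f t\<bar> \<le> C" using lip_on_bounded assms by metis
  obtain D where D: "D > 0" "\<And>t. t \<in> X \<Longrightarrow> \<bar>g t\<bar> \<le> D" using lip_on_bounded assms by metis
  show ?thesis
  proof (rule lip_onI)
    fix s t assume st: "s \<in> X" "t \<in> X"
    have "f s * g s - f t * g t = f s * (g s - g t) + (f s - f t) * g t" by (simp add: algebra_simps)
    also have "\<bar>\<dots>\<bar> \<le> \<bar>f s\<bar> * \<bar>g s - g t\<bar> + \<bar>f s - f t\<bar> * \<bar>g t\<bar>"
      by (metis abs_mult abs_triangle_ineq)
    also have "\<dots> \<le> C * (M * \<bar>s - t\<bar>) + (L * \<bar>s - t\<bar>) * D"
      using st LM C D by (intro add_mono mult_mono) auto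
    finally show "\<bar>f s * g s - f t * g t\<bar> \<le> (C * M + L * D) * \<bar>s - t\<bar>" by (simp add: algebra_simps)
  qed (use LM C D in auto)
qed

lemma lip_on_cmult: "lip_on X f \<Longrightarrow> lip_on X (\<lambda>t. c * f t)"
proof -
  assume "lip_on X f"
  then obtain L where L: "L \<ge> 0" "\<And>s t. s\<in>X \<Longrightarrow> t\<in>X \<Longrightarrow> \<bar>f s - f t\<bar> \<le> L * \<bar>s - t\<bar>"
    unfolding lip_on_def by blast
  show ?thesis
  proof (rule lip_onI)
    fix s t assume st: "s \<in> X" "t \<in> X"
    have "\<bar>c * f s - c * f t\<bar> = \<bar>c\<bar> * \<bar>f s - f t\<bar>" by (metis abs_mult right_diff_distrib)
    also have "\<dots> \<le> \<bar>c\<bar> * (L * \<bar>s - t\<bar>)" using L(2)[OF st] by (intro mult_left_mono) auto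
    finally show "\<bar>c * f s - c * f t\<bar> \<le> (\<bar>c\<bar> * L) * \<bar>s - t\<bar>" by (simp add: mult.assoc)
  qed (use L in auto)
qed

lemma lip_on_diff: "lip_on X f \<Longrightarrow> lip_on X g \<Longrightarrow> lip_on X (\<lambda>t. f t - g t)"
  using lip_on_add[of X f "\<lambda>t. -1 * g t"] lip_on_cmult[of X g "-1"] by simp

lemma lip_on_inverse:
  assumes "lip_on X f" "compact X" "\<And>t. t \<in> X \<Longrightarrow> f t \<noteq> 0"
  shows "lip_on X (\<lambda>t. inverse (f t))"
proof -
  obtain L where L: "L \<ge> 0" "\<And>s t. s\<in>X \<Longrightarrow> t\<in>X \<Longrightarrow> \<bar>f s - f t\<bar> \<le> L * \<bar>s - t\<bar>"
    using assms unfolding lip_on_def by blast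
  have "bounded ((\<lambda>t. inverse (f t)) ` X)"
    using assms by (intro compact_imp_bounded compact_continuous_image continuous_intros lip_on_imp_continuous_on) auto
  then obtain C where C: "C > 0" "\<And>t. t \<in> X \<Longrightarrow> \<bar>inverse (f t)\<bar> \<le> C"
    unfolding bounded_pos by (auto simp: real_norm_def)
  show ?thesis
  proof (rule lip_onI)
    fix s t assume st: "s \<in> X" "t \<in> X"
    have "\<bar>inverse (f s) - inverse (f t)\<bar> = \<bar>inverse (f s)\<bar> * \<bar>inverse (f t)\<bar> * \<bar>f s - f t\<bar>"
      using assms(3) st by (simp add: inverse_diff_inverse abs_mult)
    also have "\<dots> \<le> C * C * (L * \<bar>s - t\<bar>)"
      using C L st by (intro mult_mono) auto
    finally show "\<bar>inverse (f s) - inverse (f t)\<bar> \<le> (C * C * L) * \<bar>s - t\<bar>" by (simp add: mult.assoc)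
  qed (use L C in auto)
qed

lemma lip_on_divide:
  assumes "lip_on X f" "lip_on X g" "compact X" "\<And>t. t \<in> X \<Longrightarrow> g t \<noteq> 0"
  shows "lip_on X (\<lambda>t. f t / g t)"
  unfolding divide_inverse using assms by (intro lip_on_mult lip_on_inverse)

lemma lip_on_bounded_derivative:
  assumes "\<And>t. t \<in> {a..b} \<Longrightarrow> (f has_real_derivative f' t) (at t within {a..b})"
    and "\<And>t. t \<in> {a..b} \<Longrightarrow> \<bar>f' t\<bar> \<le> L" "0 \<le> L"
  shows "lip_on {a..b} f"
proof (rule lip_onI[OF _ assms(3)])
  fix s t assume "s \<in> {a..b}" "t \<in> {a..b}"
  then show "\<bar>f s - f t\<bar> \<le> L * \<bar>s - t\<bar>"
    using field_differentiable_bound[of "{a..b}" f f' L t s] assms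
    by (auto simp: real_norm_def abs_minus_commute)
qed

lemma lip_on_C1:
  assumes "\<And>t. t \<in> {a..b} \<Longrightarrow> (f has_real_derivative f' t) (at t within {a..b})"
    and "continuous_on {a..b} f'"
  shows "lip_on {a..b} f"
proof -
  have "bounded (f' ` {a..b})" using assms(2) by (intro compact_imp_bounded compact_continuous_image) auto
  then obtain L where "L > 0" "\<And>t. t \<in> {a..b} \<Longrightarrow> \<bar>f' t\<bar> \<le> L"
    unfolding bounded_pos by (auto simp: real_norm_def)
  then show ?thesis using lip_on_bounded_derivative assms(1) by (metis less_imp_le)
qed

lemma lip_on_sqrt:
  assumes "lip_on X f" "\<delta> > 0" "\<And>t. t \<in> X \<Longrightarrow> \<delta> \<le> f t"
  shows "lip_on X (\<lambda>t. sqrt (f t))"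
proof -
  obtain L where L: "L \<ge> 0" "\<And>s t. s\<in>X \<Longrightarrow> t\<in>X \<Longrightarrow> \<bar>f s - f t\<bar> \<le> L * \<bar>s - t\<bar>"
    using assms unfolding lip_on_def by blast
  show ?thesis
  proof (rule lip_onI)
    fix s t assume st: "s \<in> X" "t \<in> X"
    define x y where "x = sqrt (f s)" "y = sqrt (f t)"
    have xy: "sqrt \<delta> \<le> x" "sqrt \<delta> \<le> y" "x\<^sup>2 = f s" "y\<^sup>2 = f t" "0 < sqrt \<delta>"
      using st assms by (auto simp: x_y_def order_trans[of 0 \<delta>] less_imp_le)
    then have "\<bar>x - y\<bar> * sqrt \<delta> \<le> \<bar>x - y\<bar> * \<bar>x + y\<bar>"
      by (intro mult_left_mono) auto
    also have "\<dots> = \<bar>f s - f t\<bar>"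
      using xy by (simp add: abs_mult[symmetric] power2_eq_square algebra_simps)
    also have "\<dots> \<le> L * \<bar>s - t\<bar>" using L st by auto
    finally show "\<bar>sqrt (f s) - sqrt (f t)\<bar> \<le> L / sqrt \<delta> * \<bar>s - t\<bar>"
      using xy(5) by (simp add: x_y_def[symmetric] field_simps)
  qed (use L assms in auto)
qed

lemma lip_on_has_integral:
  assumes "lip_on {a..b} g" "a \<le> b" "negligible N"
    and der: "\<And>t. t \<in> {a<..<b} - N \<Longrightarrow> (g has_real_derivative g' t) (at t)"
  shows "(g' has_integral (g b - g a)) {a..b}"
proof (rule fundamental_theorem_of_calculus_absolutely_continuous[OF _ assms(2,3)])
  show "(g has_vector_derivative g' t) (at t)" if "t \<in> {a<..<b} - N" for t
    using der[OF that] by (simp add: has_real_derivative_iff_has_vector_derivative)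
  fix e :: real assume e: "e > 0"
  obtain L where L: "L \<ge> 0" "\<And>s t. s\<in>{a..b} \<Longrightarrow> t\<in>{a..b} \<Longrightarrow> \<bar>g s - g t\<bar> \<le> L * \<bar>s - t\<bar>"
    using assms(1) unfolding lip_on_def by blast
  have "(\<Sum>k\<in>d. norm (g (Sup k) - g (Inf k))) < e"
    if d: "d division_of \<Union> d" "\<Union> d \<subseteq> {a..b}" "(\<Sum>k\<in>d. Sup k - Inf k) < e / (L + 1)" for d
  proof -
    have "(\<Sum>k\<in>d. norm (g (Sup k) - g (Inf k))) \<le> (\<Sum>k\<in>d. L * (Sup k - Inf k))"
    proof (rule sum_mono)
      fix k assume k: "k \<in> d"
      then obtain u v where "k = {u..v}" "u \<le> v"
        using division_ofD(3,4)[OF d(1) k] by auto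
      moreover from this k d(2) have "{u..v} \<subseteq> {a..b}" by blast
      then have "u \<in> {a..b}" "v \<in> {a..b}" using \<open>u \<le> v\<close> by auto
      ultimately show "norm (g (Sup k) - g (Inf k)) \<le> L * (Sup k - Inf k)"
        using L(2)[of v u] by simp
    qed
    also have "\<dots> = L * (\<Sum>k\<in>d. Sup k - Inf k)" by (simp add: sum_distrib_left)
    also have "\<dots> \<le> L * (e / (L + 1))" using L d(3) by (intro mult_left_mono) auto
    also have "\<dots> < e" using L e by (simp add: field_simps)
    finally show ?thesis .
  qed
  then show "\<exists>\<delta>>0. \<forall>d. d division_of \<Union> d \<and> \<Union> d \<subseteq> {a..b} \<and> (\<Sum>k\<in>d. Sup k - Inf k) < \<delta> \<longrightarrow>
         (\<Sum>k\<in>d. norm (g (Sup k) - g (Inf k))) < e"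
    using L e by (intro exI[of _ "e / (L + 1)"]) auto
qed

text \<open>All differential inequalities below are integrated by this lemma, which accepts that derivative and estimate
fail on a null set. The bound \<open>h\<close> is an integrable function, not a constant, because in the first variation it contains the
control, which is merely measurable.\<close>

lemma lip_on_growth_le:
  assumes "lip_on {a..b} g" "a \<le> b" "negligible N"
    and der: "\<And>t. t \<in> {a<..<b} - N \<Longrightarrow> (g has_real_derivative g' t) (at t) \<and> g' t \<le> h t"
    and h: "(h has_integral I) {a..b}"
  shows "g b - g a \<le> I"
proof -
  define M where "M = N \<union> {a,b}"
  have M: "negligible M" using assms(3) by (simp add: M_def)
  define k where "k t = (if t \<in> M then h t else g' t)" for t
  have "(g' has_integral (g b - g a)) {a..b}"
    using lip_on_has_integral[OF assms(1-3)] der by blast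
  then have "(k has_integral (g b - g a)) {a..b}"
    by (rule has_integral_spike[OF M, rotated]) (auto simp: k_def)
  then show ?thesis
    by (rule has_integral_le[OF _ h]) (use der in \<open>force simp: k_def M_def\<close>)
qed

section \<open>Scalar form of the controlled equation\<close>

text \<open>The only properties of \<open>B u\<close> that matter for the differential equation.\<close>

definition bounded_forcing :: "real \<Rightarrow> (real \<Rightarrow> real^2) \<Rightarrow> bool" where
  "bounded_forcing K b \<longleftrightarrow> b \<in> borel_measurable (lebesgue_on {0..}) \<and>
     (\<exists>N. negligible N \<and> (\<forall>t\<in>{0..} - N. norm (b t) \<le> K))"

text \<open>The equation in the variables \<open>w = y\<^sub>1 - 1\<close> and \<open>p = y\<^sub>2\<close>. Since the forcing is bounded and the field is bounded on
compact parts of the domain, absolutely continuous solutions are Lipschitz on compact subintervals of \<open>[0, T)\<close>, and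
Lipschitz continuity is the more convenient requirement.\<close>

definition trajectory :: "(real \<Rightarrow> real^2) \<Rightarrow> real \<Rightarrow> (real \<Rightarrow> real) \<Rightarrow> (real \<Rightarrow> real) \<Rightarrow> bool" where
  "trajectory b T w p \<longleftrightarrow>
     (\<forall>t\<in>{0..<T}. w t \<noteq> 0) \<and> (\<forall>c<T. lip_on {0..c} w \<and> lip_on {0..c} p) \<and>
     (\<exists>N. negligible N \<and> (\<forall>t\<in>{0<..<T} - N.
        (w has_real_derivative - p t / w t + b t $ 1) (at t) \<and>
        (p has_real_derivative 1 + w t + p t + b t $ 2) (at t)))"

text \<open>Along the trajectories that start in the region considered below, \<open>w\<^sup>2\<close> is decreasing, so this says that \<open>w\<close> tends to \<open>0\<close> at \<open>T\<close>; that is, \<open>T\<close> is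
a quenching time.\<close>

definition vanishing :: "real \<Rightarrow> (real \<Rightarrow> real) \<Rightarrow> bool" where
  "vanishing T w \<longleftrightarrow> (\<forall>\<epsilon>>0. \<exists>t\<in>{0..<T}. (w t)\<^sup>2 < \<epsilon>)"

lemma abs_continuous_on_imp_continuous_on:
  assumes "abs_continuous_on {a..b} y"
  shows "continuous_on {a..b} y"
  unfolding continuous_on_iff
proof (intro ballI allI impI)
  fix x e :: real assume x: "x \<in> {a..b}" and e: "0 < e"
  obtain \<delta> where \<delta>: "\<delta> > 0" "\<forall>d. d division_of (\<Union>d) \<and> \<Union>d \<subseteq> {a..b} \<and>
      (\<Sum>k\<in>d. Sup k - Inf k) < \<delta> \<longrightarrow> (\<Sum>k\<in>d. norm (y (Sup k) - y (Inf k))) < e"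
    using assms e unfolding abs_continuous_on_def by blast
  have *: "norm (y t - y s) < e" if "s \<in> {a..b}" "t \<in> {a..b}" "s \<le> t" "t - s < \<delta>" for s t
  proof -
    have "{{s..t}} division_of (\<Union>{{s..t}})"
      using division_of_self[of s t] that(3) by simp
    then show ?thesis using \<delta>(2)[rule_format, of "{{s..t}}"] that by auto
  qed
  show "\<exists>d>0. \<forall>x'\<in>{a..b}. dist x' x < d \<longrightarrow> dist (y x') (y x) < e"
  proof (intro exI[of _ \<delta>] conjI ballI impI \<delta>(1))
    fix x' assume x': "x' \<in> {a..b}" "dist x' x < \<delta>"
    show "dist (y x') (y x) < e"
      using *[of x x'] *[of x' x] x x'
      by (cases "x \<le> x'") (auto simp: dist_norm dist_real_def norm_minus_commute)
  qed
qed

lemma solution_on_imp_trajectory: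
  fixes B :: "real \<Rightarrow> real^2^2"
  assumes sol: "solution_on B u y0 T y" and bd: "bounded_forcing K (\<lambda>t. B t *v u t)"
  shows "trajectory (\<lambda>t. B t *v u t) T (\<lambda>t. y t $ 1 - 1) (\<lambda>t. y t $ 2)"
proof -
  define b where "b t = B t *v u t" for t
  have dom: "\<And>t. t \<in> {0..<T} \<Longrightarrow> y t \<in> dom1" and ac: "\<And>c. c \<in> {0..<T} \<Longrightarrow> abs_continuous_on {0..c} y"
    using sol by (auto simp: solution_on_def)
  obtain N1 where N1: "negligible N1" "\<And>t. t \<in> {0..<T} - N1 \<Longrightarrow> (y has_vector_derivative (f1 (y t) + b t)) (at t)"
    using sol unfolding solution_on_def b_def by (subst (asm) AE_lebesgue_on_iff_negligible) auto
  obtain N2 where N2: "negligible N2" "\<And>t. t \<in> {0..} - N2 \<Longrightarrow> norm (b t) \<le> K"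
    using bd unfolding bounded_forcing_def b_def by auto
  define N where "N = N1 \<union> N2"
  have N: "negligible N" using N1 N2 by (simp add: N_def)
  have lip: "lip_on {0..c} (\<lambda>t. y t $ 1 - 1) \<and> lip_on {0..c} (\<lambda>t. y t $ 2)" if c: "c < T" for c
  proof (cases "0 \<le> c")
    case True
    have acc: "abs_continuous_on {0..c} y" using ac c True by auto
    have cont: "continuous_on {0..c} y" by (rule abs_continuous_on_imp_continuous_on[OF acc])
    have ne: "1 - y t $ 1 \<noteq> 0" if "t \<in> {0..c}" for t
      using dom[of t] that c by (auto simp: dom1_def)
    have "continuous_on {0..c} (\<lambda>t. norm (y t $ 2 / (1 - y t $ 1)) + norm (y t $ 1 + y t $ 2))"
      by (intro continuous_intros cont) (use ne in auto)
    then have "bounded ((\<lambda>t. norm (y t $ 2 / (1 - y t $ 1)) + norm (y t $ 1 + y t $ 2)) ` {0..c})"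
      by (intro compact_imp_bounded compact_continuous_image) auto
    then obtain M where M: "M > 0" "\<And>t. t \<in> {0..c} \<Longrightarrow>
         norm (norm (y t $ 2 / (1 - y t $ 1)) + norm (y t $ 1 + y t $ 2)) \<le> M"
      unfolding bounded_pos by auto
    have fM: "norm (f1 (y t)) \<le> M" if "t \<in> {0..c}" for t
      using norm_le_l1_cart[of "f1 (y t)"] M(2)[OF that] by (simp add: f1_def sum_2)
    have diff: "norm (y t - y s) \<le> (M + \<bar>K\<bar>) * \<bar>t - s\<bar>" if st: "0 \<le> s" "s \<le> t" "t \<le> c" for s t
    proof -
      have "((\<lambda>r. f1 (y r) + b r) has_integral (y t - y s)) {s..t}"
      proof (rule fundamental_theorem_of_calculus_absolutely_continuous[OF _ st(2) N])
        show "\<And>r. r \<in> {s<..<t} - N \<Longrightarrow> (y has_vector_derivative f1 (y r) + b r) (at r)"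
          using N1(2) st c by (auto simp: N_def)
        fix e :: real assume "e > 0"
        then obtain \<delta> where d: "\<delta> > 0" "\<forall>d. d division_of \<Union> d \<and> \<Union> d \<subseteq> {0..c} \<and> (\<Sum>k\<in>d. Sup k - Inf k) < \<delta> \<longrightarrow>
            (\<Sum>k\<in>d. norm (y (Sup k) - y (Inf k))) < e"
          using acc unfolding abs_continuous_on_def by blast
        have "{s..t} \<subseteq> {0..c}" using st by auto
        then show "\<exists>\<delta>>0. \<forall>d. d division_of \<Union> d \<and> \<Union> d \<subseteq> {s..t} \<and> (\<Sum>k\<in>d. Sup k - Inf k) < \<delta> \<longrightarrow>
            (\<Sum>k\<in>d. norm (y (Sup k) - y (Inf k))) < e"
          using d by (intro exI[of _ \<delta>]) (meson order_trans)
      qed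
      then have int: "((\<lambda>r. if r \<in> N then 0 else f1 (y r) + b r) has_integral (y t - y s)) (cbox s t)"
        unfolding box_real by (rule has_integral_spike[OF N, rotated]) auto
      have "norm (y t - y s) \<le> (M + \<bar>K\<bar>) * measure lborel (cbox s t)"
      proof (rule has_integral_bound[OF _ int])
        fix r assume r: "r \<in> cbox s t"
        show "norm (if r \<in> N then 0 else f1 (y r) + b r) \<le> M + \<bar>K\<bar>"
        proof (cases "r \<in> N")
          case False
          then have "norm (b r) \<le> K" using N2(2)[of r] r st by (auto simp: N_def)
          moreover have "norm (f1 (y r)) \<le> M" using fM r st by auto
          ultimately show ?thesis using norm_triangle_ineq[of "f1 (y r)" "b r"] False by simp
        qed (use M in auto)
      qed (use M in auto)
      then show ?thesis using st by simp
    qed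
    have diff': "norm (y s - y t) \<le> (M + \<bar>K\<bar>) * \<bar>s - t\<bar>" if "s \<in> {0..c}" "t \<in> {0..c}" for s t
      using diff[of s t] diff[of t s] that
      by (cases "s \<le> t") (auto simp: norm_minus_commute abs_minus_commute)
    have "\<bar>y s $ i - y t $ i\<bar> \<le> (M + \<bar>K\<bar>) * \<bar>s - t\<bar>" if "s \<in> {0..c}" "t \<in> {0..c}" for s t i
      using component_le_norm_cart[of "y s - y t" i] diff'[OF that] by simp
    then show ?thesis using M(1) by (intro conjI lip_onI[of _ _ "M + \<bar>K\<bar>"]) auto
  qed (auto intro: lip_onI[of _ _ 0])
  have der: "((\<lambda>t. y t $ 1 - 1) has_real_derivative - y t $ 2 / (y t $ 1 - 1) + b t $ 1) (at t) \<and>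
      ((\<lambda>t. y t $ 2) has_real_derivative 1 + (y t $ 1 - 1) + y t $ 2 + b t $ 2) (at t)"
    if t: "t \<in> {0<..<T} - N" for t
  proof -
    have y: "(y has_vector_derivative (f1 (y t) + b t)) (at t)" using N1(2)[of t] t by (auto simp: N_def)
    have ne: "1 - y t $ 1 \<noteq> 0" using dom[of t] t by (auto simp: dom1_def)
    have c: "((\<lambda>t. y t $ i) has_real_derivative (f1 (y t) + b t) $ i) (at t)" for i
      using bounded_linear.has_vector_derivative[OF bounded_linear_vec_nth y]
      by (simp add: has_real_derivative_iff_has_vector_derivative)
    have "- y t $ 2 / (y t $ 1 - 1) = y t $ 2 / (1 - y t $ 1)" using ne by (simp add: divide_simps) (simp add: algebra_simps)
    then show ?thesis using c[of 1] c[of 2]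
      by (auto simp: f1_def intro!: derivative_eq_intros)
  qed
  show ?thesis
    unfolding trajectory_def b_def[symmetric]
  proof (intro conjI allI impI ballI)
    fix t assume "t \<in> {0..<T}" then show "y t $ 1 - 1 \<noteq> 0" using dom by (auto simp: dom1_def)
  next
    show "\<exists>N. negligible N \<and> (\<forall>t\<in>{0<..<T} - N.
           ((\<lambda>t. y t $ 1 - 1) has_real_derivative - y t $ 2 / (y t $ 1 - 1) + b t $ 1) (at t) \<and>
           ((\<lambda>t. y t $ 2) has_real_derivative 1 + (y t $ 1 - 1) + y t $ 2 + b t $ 2) (at t))"
      using N der by blast
  qed (use lip in auto)
qed

lemma trajectory_imp_solution_on:
  fixes B :: "real \<Rightarrow> real^2^2"
  assumes tr: "trajectory (\<lambda>t. B t *v u t) T (\<lambda>t. y t $ 1 - 1) (\<lambda>t. y t $ 2)"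
  shows "solution_on B u (y 0) T y"
proof -
  define b where "b t = B t *v u t" for t
  obtain N where N: "negligible N" "\<And>t. t \<in> {0<..<T} - N \<Longrightarrow>
        ((\<lambda>t. y t $ 1 - 1) has_real_derivative - y t $ 2 / (y t $ 1 - 1) + b t $ 1) (at t) \<and>
        ((\<lambda>t. y t $ 2) has_real_derivative 1 + (y t $ 1 - 1) + y t $ 2 + b t $ 2) (at t)"
    using tr unfolding trajectory_def b_def[symmetric] by blast
  have ne: "y t $ 1 - 1 \<noteq> 0" if "t \<in> {0..<T}" for t
    using tr that unfolding trajectory_def by blast
  have der: "(y has_vector_derivative (f1 (y t) + b t)) (at t)" if t: "t \<in> {0<..<T} - N" for t
  proof -
    have eq: "y = (\<lambda>t. (y t $ 1 - 1 + 1) *\<^sub>R axis 1 1 + (y t $ 2) *\<^sub>R axis 2 1)"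
      by (auto simp: fun_eq_iff vec_eq_iff forall_2 axis_def)
    have n: "y t $ 1 - 1 \<noteq> 0" using ne t by auto
    have "((\<lambda>t. (y t $ 1 - 1 + 1) *\<^sub>R axis 1 (1::real) + (y t $ 2) *\<^sub>R axis (2::2) 1) has_vector_derivative
       (- y t $ 2 / (y t $ 1 - 1) + b t $ 1) *\<^sub>R axis 1 1 + (1 + (y t $ 1 - 1) + y t $ 2 + b t $ 2) *\<^sub>R axis 2 1) (at t)"
    proof -
      have "((\<lambda>t. y t $ 1 - 1 + 1) has_real_derivative - y t $ 2 / (y t $ 1 - 1) + b t $ 1) (at t)"
        using DERIV_add[OF conjunct1[OF N(2)[OF t]] DERIV_const[of 1]] by simp
      with N(2)[OF t] show ?thesis
        by (intro has_vector_derivative_add has_vector_derivative_scaleR[where g="\<lambda>_. axis _ 1" and g'=0, simplified])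
          auto
    qed
    also have "(- y t $ 2 / (y t $ 1 - 1) + b t $ 1) *\<^sub>R axis 1 1 + (1 + (y t $ 1 - 1) + y t $ 2 + b t $ 2) *\<^sub>R axis 2 1
       = f1 (y t) + b t"
      using n by (auto simp: vec_eq_iff forall_2 axis_def f1_def divide_simps) (simp_all add: algebra_simps)
    finally show ?thesis by (subst eq)
  qed
  have ac: "abs_continuous_on {0..c} y" if "c \<in> {0..<T}" for c
  proof -
    have l: "lip_on {0..c} (\<lambda>t. y t $ 1 - 1)" "lip_on {0..c} (\<lambda>t. y t $ 2)"
      using tr that unfolding trajectory_def by auto
    obtain L where L: "L \<ge> 0" "\<And>s t. s \<in> {0..c} \<Longrightarrow> t \<in> {0..c} \<Longrightarrow> \<bar>(y s $ 1 - 1) - (y t $ 1 - 1)\<bar> \<le> L * \<bar>s - t\<bar>"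
      using l(1) unfolding lip_on_def by blast
    obtain M where M: "M \<ge> 0" "\<And>s t. s \<in> {0..c} \<Longrightarrow> t \<in> {0..c} \<Longrightarrow> \<bar>y s $ 2 - y t $ 2\<bar> \<le> M * \<bar>s - t\<bar>"
      using l(2) unfolding lip_on_def by blast
    have LM: "norm (y s - y t) \<le> (L + M) * \<bar>s - t\<bar>" if "s \<in> {0..c}" "t \<in> {0..c}" for s t
      using norm_le_l1_cart[of "y s - y t"] L(2)[OF that] M(2)[OF that] by (simp add: sum_2 algebra_simps)
    have "\<exists>\<delta>>0. \<forall>d. d division_of \<Union> d \<and> \<Union> d \<subseteq> {0..c} \<and> (\<Sum>k\<in>d. Sup k - Inf k) < \<delta> \<longrightarrow>
         (\<Sum>k\<in>d. norm (y (Sup k) - y (Inf k))) < e" if e: "e > 0" for e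
    proof (intro exI[of _ "e / (L + M + 1)"] conjI allI impI)
      show "0 < e / (L + M + 1)" using e L M by simp
      fix d :: "real set set" assume d: "d division_of \<Union> d \<and> \<Union> d \<subseteq> {0..c} \<and> (\<Sum>k\<in>d. Sup k - Inf k) < e / (L + M + 1)"
      have "(\<Sum>k\<in>d. norm (y (Sup k) - y (Inf k))) \<le> (\<Sum>k\<in>d. (L + M) * (Sup k - Inf k))"
      proof (rule sum_mono)
        fix k assume k: "k \<in> d"
        then obtain v w where vw: "k = {v..w}" "v \<le> w"
          using division_ofD(3,4)[of d "\<Union>d" k] d by auto
        have "{v..w} \<subseteq> {0..c}" using vw k d by blast
        then have "v \<in> {0..c}" "w \<in> {0..c}" using vw by auto
        then show "norm (y (Sup k) - y (Inf k)) \<le> (L + M) * (Sup k - Inf k)"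
          using LM[of w v] vw by simp
      qed
      also have "\<dots> = (L + M) * (\<Sum>k\<in>d. Sup k - Inf k)" by (simp add: sum_distrib_left)
      also have "\<dots> \<le> (L + M) * (e / (L + M + 1))" using L M d by (intro mult_left_mono) auto
      also have "\<dots> < e" using L M e by (simp add: field_simps)
      finally show "(\<Sum>k\<in>d. norm (y (Sup k) - y (Inf k))) < e" .
    qed
    then show ?thesis by (simp add: abs_continuous_on_def)
  qed
  have "AE t in lebesgue_on {0..<T}. (y has_vector_derivative (f1 (y t) + b t)) (at t)"
  proof (subst AE_lebesgue_on_iff_negligible)
    have "(y has_vector_derivative (f1 (y t) + b t)) (at t)" if "t \<in> {0..<T} - insert 0 N" for t
    proof -
      have "0 \<le> t" "t \<noteq> 0" "t < T" "t \<notin> N" using that by auto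
      then show ?thesis by (intro der) auto
    qed
    then show "\<exists>N. negligible N \<and> (\<forall>t\<in>{0..<T} - N. (y has_vector_derivative f1 (y t) + b t) (at t))"
      using N(1) by (intro exI[of _ "insert 0 N"]) auto
  qed simp
  then show ?thesis
    using ne ac unfolding solution_on_def b_def by (auto simp: dom1_def)
qed

section \<open>Invariant region, stability and uniqueness\<close>

lemma trajectory_restrict: "trajectory b T w p \<Longrightarrow> S \<le> T \<Longrightarrow> trajectory b S w p"
  unfolding trajectory_def by (fastforce)

text \<open>The left-hand side is the derivative of the squared distance \<open>d\<^sup>2 + e\<^sup>2\<close> of two trajectories in the
coordinates \<open>(w\<^sup>2, p)\<close>. The difference \<open>x' - x\<close> equals \<open>d / (x' + x)\<close>, and since \<open>x\<close> and \<open>x'\<close> have the same sign,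
\<open>\<bar>x' + x\<bar> \<ge> \<bar>x\<bar> \<ge> 1 / R\<close>; all other terms are bounded. So the distance to the singularity enters
only through the factor \<open>R\<close>, to the first power.\<close>

lemma square_difference_growth:
  fixes x x' z z' :: real
  assumes same: "sgn x' = sgn x" "x \<noteq> 0" and R: "1 \<le> R * \<bar>x\<bar>" "0 \<le> R" and W: "x'\<^sup>2 \<le> W"
    and \<beta>: "\<bar>\<beta>1\<bar> \<le> K" "\<bar>\<beta>1' - \<beta>1\<bar> \<le> \<eta>" "\<bar>\<beta>2' - \<beta>2\<bar> \<le> \<eta>"
  defines "d \<equiv> x'\<^sup>2 - x\<^sup>2" and "e \<equiv> z' - z"
  shows "2 * d * (2 * x' * (- z' / x' + \<beta>1') - 2 * x * (- z / x + \<beta>1))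
        + 2 * e * ((1 + x' + z' + \<beta>2') - (1 + x + z + \<beta>2))
      \<le> (7 + (4 * K + 1) * R) * (d\<^sup>2 + e\<^sup>2) + (2 * W + 1) * \<eta>\<^sup>2"
proof -
  have x': "x' \<noteq> 0" using same by (metis sgn_zero_iff)
  have K: "0 \<le> K" "0 \<le> \<eta>" using \<beta> by linarith+
  define c where "c = x' - x"
  have cR: "\<bar>c\<bar> \<le> R * \<bar>d\<bar>"
  proof -
    have "d = c * (x' + x)" by (simp add: c_def d_def power2_eq_square algebra_simps)
    then have 1: "\<bar>d\<bar> = \<bar>c\<bar> * \<bar>x' + x\<bar>" by (simp add: abs_mult)
    have "\<bar>x\<bar> \<le> \<bar>x' + x\<bar>" using same by (auto simp: sgn_if split: if_splits)
    then have "1 \<le> R * \<bar>x' + x\<bar>" using R mult_left_mono[of "\<bar>x\<bar>" "\<bar>x' + x\<bar>" R] by linarith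
    then have "\<bar>c\<bar> * 1 \<le> \<bar>c\<bar> * (R * \<bar>x' + x\<bar>)" by (intro mult_left_mono) auto
    then show ?thesis using 1 by (simp add: mult_ac)
  qed
  have eq: "2 * d * (2 * x' * (- z' / x' + \<beta>1') - 2 * x * (- z / x + \<beta>1))
        + 2 * e * ((1 + x' + z' + \<beta>2') - (1 + x + z + \<beta>2))
     = - 4 * (d * e) + 4 * (d * (c * \<beta>1)) + 4 * (d * (x' * (\<beta>1' - \<beta>1))) + 2 * (e * c) + 2 * e\<^sup>2 + 2 * (e * (\<beta>2' - \<beta>2))"
    using x' same(2) by (simp add: e_def c_def power2_eq_square algebra_simps)
  define q where "q = d\<^sup>2 + e\<^sup>2"
  have dq: "d\<^sup>2 \<le> q" "e\<^sup>2 \<le> q" by (auto simp: q_def)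
  have de: "2 * (\<bar>d\<bar> * \<bar>e\<bar>) \<le> q"
    using sum_squares_bound[of "\<bar>d\<bar>" "\<bar>e\<bar>"] by (simp add: q_def mult.assoc)
  have 1: "- 4 * (d * e) \<le> 2 * q" using de abs_ge_minus_self[of "d * e"] by (simp add: abs_mult)
  have 2: "4 * (d * (c * \<beta>1)) \<le> 4 * K * R * q"
  proof -
    have "d * (c * \<beta>1) \<le> \<bar>d\<bar> * (\<bar>c\<bar> * \<bar>\<beta>1\<bar>)" by (metis abs_ge_self abs_mult)
    also have "\<dots> \<le> \<bar>d\<bar> * ((R * \<bar>d\<bar>) * K)" using cR \<beta> R K by (intro mult_left_mono mult_mono) auto
    also have "\<dots> = K * R * d\<^sup>2" by (simp add: power2_eq_square mult_ac)
    also have "\<dots> \<le> K * R * q" using dq K R by (intro mult_left_mono) auto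
    finally show ?thesis by simp
  qed
  have 3: "4 * (d * (x' * (\<beta>1' - \<beta>1))) \<le> 2 * q + 2 * W * \<eta>\<^sup>2"
  proof -
    have "4 * (d * (x' * (\<beta>1' - \<beta>1))) \<le> 2 * d\<^sup>2 + 2 * (x' * (\<beta>1' - \<beta>1))\<^sup>2"
      using sum_squares_bound[of d "x' * (\<beta>1' - \<beta>1)"] by simp
    also have "(x' * (\<beta>1' - \<beta>1))\<^sup>2 \<le> W * \<eta>\<^sup>2"
      unfolding power_mult_distrib using W \<beta>(2) by (intro mult_mono W) (auto simp: abs_le_square_iff[symmetric] order_trans[OF zero_le_power2 W])
    finally show ?thesis using dq by simp
  qed
  have 4: "2 * (e * c) \<le> R * q"
  proof -
    have "2 * (e * c) \<le> 2 * (\<bar>e\<bar> * \<bar>c\<bar>)" by (metis abs_ge_self abs_mult mult_left_mono zero_le_numeral)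
    also have "\<dots> \<le> 2 * (\<bar>e\<bar> * (R * \<bar>d\<bar>))" using cR by (intro mult_left_mono) auto
    also have "\<dots> = R * (2 * (\<bar>d\<bar> * \<bar>e\<bar>))" by simp
    also have "\<dots> \<le> R * q" using de R by (intro mult_left_mono)
    finally show ?thesis .
  qed
  have 5: "2 * (e * (\<beta>2' - \<beta>2)) \<le> q + \<eta>\<^sup>2"
    using sum_squares_bound[of e "\<beta>2' - \<beta>2"] \<beta>(3) K dq(2) abs_le_square_iff[of "\<beta>2' - \<beta>2" \<eta>] by simp
  show ?thesis unfolding eq q_def[symmetric]
    using 1 2 3 4 5 dq(2) by (simp add: algebra_simps)
qed

text \<open>The condition \<open>(w\<^sub>0 + 1, p\<^sub>0) \<in> S_f1 K\<close>, solved for the quantities that are used.\<close>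

locale quenching_start =
  fixes K w0 p0 :: real
  assumes K_pos: "0 < K" and w0_nonzero: "w0 \<noteq> 0" and w0_small: "2 * K * \<bar>w0\<bar> < 1"
    and p0_large: "(if w0 < 0 then K + 1 / K - 1 else K + 1) < p0"
begin

definition p_min :: real where "p_min = (if w0 < 0 then K + 1 / K - 1 else K + 1)"

lemma p_min_ge_1: "1 \<le> p_min"
proof -
  have "2 * K \<le> K\<^sup>2 + 1" using sum_squares_bound[of K 1] by simp
  then have "2 \<le> K + 1 / K" using K_pos by (simp add: field_simps power2_eq_square)
  then show ?thesis using K_pos by (simp add: p_min_def)
qed

definition traj :: "(real \<Rightarrow> real^2) \<Rightarrow> real \<Rightarrow> (real \<Rightarrow> real) \<Rightarrow> (real \<Rightarrow> real) \<Rightarrow> bool" where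
  "traj b T w p \<longleftrightarrow> trajectory b T w p \<and> bounded_forcing K b \<and> w 0 = w0 \<and> p 0 = p0 \<and> 0 < T"

lemma trajD:
  assumes "traj b T w p"
  shows "w 0 = w0" "p 0 = p0" "0 < T" "bounded_forcing K b"
    and "\<And>t. t \<in> {0..<T} \<Longrightarrow> w t \<noteq> 0"
    and "\<And>c. c < T \<Longrightarrow> lip_on {0..c} w" "\<And>c. c < T \<Longrightarrow> lip_on {0..c} p"
  using assms by (auto simp: traj_def trajectory_def)

lemma traj_ode:
  assumes "traj b T w p"
  obtains N where "negligible N"
    "\<And>t. t \<in> {0<..<T} - N \<Longrightarrow> (w has_real_derivative - p t / w t + b t $ 1) (at t)"
    "\<And>t. t \<in> {0<..<T} - N \<Longrightarrow> (p has_real_derivative 1 + w t + p t + b t $ 2) (at t)"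
    "\<And>t. t \<in> {0<..<T} - N \<Longrightarrow> \<bar>b t $ 1\<bar> \<le> K"
    "\<And>t. t \<in> {0<..<T} - N \<Longrightarrow> \<bar>b t $ 2\<bar> \<le> K"
proof -
  obtain N1 where "negligible N1" "\<forall>t\<in>{0<..<T} - N1.
        (w has_real_derivative - p t / w t + b t $ 1) (at t) \<and>
        (p has_real_derivative 1 + w t + p t + b t $ 2) (at t)"
    using assms unfolding traj_def trajectory_def by blast
  moreover obtain N2 where "negligible N2" "\<forall>t\<in>{0..} - N2. norm (b t) \<le> K"
    using assms unfolding traj_def bounded_forcing_def by blast
  moreover from this have "\<bar>b t $ i\<bar> \<le> K" if "t \<in> {0..} - N2" for t i
    using component_le_norm_cart[of "b t" i] that by force
  ultimately show thesis
    by (intro that[of "N1 \<union> N2"]) auto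
qed

lemma traj_restrict: "traj b T w p \<Longrightarrow> 0 < S \<Longrightarrow> S \<le> T \<Longrightarrow> traj b S w p"
  unfolding traj_def using trajectory_restrict by blast

lemma traj_sign:
  assumes tr: "traj b T w p" and t: "t \<in> {0..<T}"
  shows "sgn (w t) = sgn w0"
proof -
  have c: "continuous_on {0..t} w" using trajD(6)[OF tr] t lip_on_imp_continuous_on by auto
  have ne: "w s \<noteq> 0" if "s \<in> {0..t}" for s using trajD(5)[OF tr, of s] that t by auto
  have "\<not> (w0 < 0 \<and> 0 < w t)"
    using IVT'[of w 0 0 t] c ne t trajD(1)[OF tr] by force
  moreover have "\<not> (0 < w0 \<and> w t < 0)"
    using IVT2'[of w t 0 0] c ne t trajD(1)[OF tr] by force
  ultimately show ?thesis using ne[of t] w0_nonzero t by (auto simp: sgn_if)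
qed

text \<open>The reason for the definition of the set of initial data: in this region the forcing is too weak to stop the
approach to the singular line. Indeed \<open>(w\<^sup>2)' = - 2 p + 2 w b\<^sub>1 \<le> - 2 + 1\<close>, and \<open>p' \<ge> 1 + w + p - K\<close> is nonnegative by
the lower bound on \<open>p\<close>, which for negative \<open>w\<close> has to compensate for \<open>w > - 1 / (2 K)\<close>.\<close>

lemma traj_growth_step:
  assumes tr: "traj b T w p" and st: "0 \<le> s" "s \<le> t" "t < T"
    and good: "\<And>r. r \<in> {s..<t} \<Longrightarrow> 2 * K * \<bar>w r\<bar> < 1 \<and> p_min < p r"
  shows "(w t)\<^sup>2 + (t - s) \<le> (w s)\<^sup>2" "p s \<le> p t"
proof -
  obtain N where N: "negligible N"
    and dw: "\<And>t. t \<in> {0<..<T} - N \<Longrightarrow> (w has_real_derivative - p t / w t + b t $ 1) (at t)"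
    and dp: "\<And>t. t \<in> {0<..<T} - N \<Longrightarrow> (p has_real_derivative 1 + w t + p t + b t $ 2) (at t)"
    and b: "\<And>t. t \<in> {0<..<T} - N \<Longrightarrow> \<bar>b t $ 1\<bar> \<le> K" "\<And>t. t \<in> {0<..<T} - N \<Longrightarrow> \<bar>b t $ 2\<bar> \<le> K"
    using traj_ode[OF tr] by metis
  have lw: "lip_on {s..t} w" and lp: "lip_on {s..t} p"
    using trajD(6,7)[OF tr st(3)] st by (auto elim!: lip_on_subset)
  have ne: "w r \<noteq> 0" if "r \<in> {s..t}" for r using trajD(5)[OF tr, of r] that st by auto
  have "(w t)\<^sup>2 - (w s)\<^sup>2 \<le> - (t - s)"
  proof (rule lip_on_growth_le[OF _ st(2) N])
    show "lip_on {s..t} (\<lambda>r. (w r)\<^sup>2)"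
      unfolding power2_eq_square by (intro lip_on_mult lw) simp
    show "((\<lambda>r. - 1) has_integral - (t - s)) {s..t}"
      using has_integral_const_real[of "-1::real" s t] st by simp
    fix r assume r: "r \<in> {s<..<t} - N"
    have r': "r \<in> {0<..<T} - N" "w r \<noteq> 0" using r st ne by auto
    have g: "2 * K * \<bar>w r\<bar> < 1" "p_min < p r" using good[of r] r by auto
    have "w r * b r $ 1 \<le> \<bar>w r\<bar> * \<bar>b r $ 1\<bar>" by (metis abs_ge_self abs_mult)
    also have "\<dots> \<le> \<bar>w r\<bar> * K" using b[OF r'(1)] by (intro mult_left_mono) auto
    finally have "2 * (w r * b r $ 1) \<le> 1" using g by (simp add: mult_ac)
    then have "2 * w r * (- p r / w r + b r $ 1) \<le> - 1"
      using p_min_ge_1 g r' by (simp add: algebra_simps)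
    then show "((\<lambda>r. (w r)\<^sup>2) has_real_derivative 2 * w r * (- p r / w r + b r $ 1)) (at r) \<and>
          2 * w r * (- p r / w r + b r $ 1) \<le> - 1"
      by (auto intro!: derivative_eq_intros dw[OF r'(1)])
  qed
  then show "(w t)\<^sup>2 + (t - s) \<le> (w s)\<^sup>2" by simp
  have "- p t - (- p s) \<le> 0"
  proof (rule lip_on_growth_le[OF _ st(2) N])
    show "lip_on {s..t} (\<lambda>r. - p r)" using lip_on_cmult[OF lp, of "-1"] by simp
    show "((\<lambda>r. 0) has_integral (0::real)) {s..t}" by simp
    fix r assume r: "r \<in> {s<..<t} - N"
    have r': "r \<in> {0<..<T} - N" using r st ne by auto
    have g: "2 * K * \<bar>w r\<bar> < 1" "p_min < p r" using good[of r] r by auto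
    have s: "sgn (w r) = sgn w0" using traj_sign[OF tr, of r] r' by auto
    have "0 \<le> 1 + w r + p r + b r $ 2"
    proof (cases "w0 < 0")
      case True
      then have "w r < 0" using s by (auto simp: sgn_if split: if_splits)
      moreover have "\<bar>w r\<bar> < 1 / (2 * K)" using g(1) K_pos by (simp add: pos_less_divide_eq mult_ac)
      moreover have "K + 1 / K - 1 < p r" using g True by (simp add: p_min_def)
      moreover have "1 / (2 * K) \<le> 1 / K" using K_pos by (simp add: field_simps)
      ultimately show ?thesis using b(2)[OF r'] by linarith
    next
      case False
      then have "w r \<ge> 0" using s w0_nonzero by (auto simp: sgn_if split: if_splits)
      then show ?thesis using g False b(2)[OF r'] by (simp add: p_min_def)
    qed
    then show "((\<lambda>r. - p r) has_real_derivative - (1 + w r + p r + b r $ 2)) (at r) \<and> - (1 + w r + p r + b r $ 2) \<le> 0"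
      by (auto intro!: derivative_eq_intros dp[OF r'])
  qed
  then show "p s \<le> p t" by simp
qed

lemma traj_invariant:
  assumes tr: "traj b T w p" and t: "t \<in> {0..<T}"
  shows "2 * K * \<bar>w t\<bar> < 1" "p_min < p t"
proof -
  have start: "2 * K * \<bar>w 0\<bar> < 1" "p_min < p 0"
    using w0_small p0_large trajD(1,2)[OF tr] by (auto simp: p_min_def)
  have "2 * K * \<bar>w t\<bar> < 1 \<and> p_min < p t"
  proof (rule ccontr)
    assume bad: "\<not> (2 * K * \<bar>w t\<bar> < 1 \<and> p_min < p t)"
    have c: "continuous_on {0..t} w" "continuous_on {0..t} p"
      using trajD(6,7)[OF tr] t lip_on_imp_continuous_on by auto
    \<comment> \<open>The first time \<open>t1\<close> at which the region is left leads to a contradiction: up to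
      \<open>t1\<close> the growth estimates hold, so \<open>\<bar>w\<bar>\<close> has not increased and
      \<open>p\<close> has not decreased.\<close>
    define X where "X = {s\<in>{0..t}. 1 \<le> 2 * K * \<bar>w s\<bar>} \<union> {s\<in>{0..t}. p s \<le> p_min}"
    have "compact X"
      unfolding X_def compact_eq_bounded_closed
      by (intro conjI bounded_Un[THEN iffD2] closed_Un continuous_closed_preimage_constant
          continuous_on_closed_Collect_le continuous_intros c) (auto intro: bounded_subset[of "{0..t}"])
    moreover have "t \<in> X" using bad t by (auto simp: X_def)
    ultimately obtain t1 where t1: "t1 \<in> X" "\<And>s. s \<in> X \<Longrightarrow> t1 \<le> s"
      using compact_attains_inf[of X] by blast
    have t1t: "0 \<le> t1" "t1 \<le> t" "t1 < T" using t1(1) t by (auto simp: X_def)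
    have good: "2 * K * \<bar>w r\<bar> < 1 \<and> p_min < p r" if "r \<in> {0..<t1}" for r
      using t1(2)[of r] that t1t by (force simp: X_def)
    note step = traj_growth_step[OF tr order_refl t1t(1,3) good]
    have "(w t1)\<^sup>2 \<le> (w 0)\<^sup>2" using step(1) t1t by simp
    then have "\<bar>w t1\<bar> \<le> \<bar>w 0\<bar>" by (simp add: abs_le_square_iff)
    then have "2 * K * \<bar>w t1\<bar> \<le> 2 * K * \<bar>w 0\<bar>" using K_pos by simp
    then show False using step(2) start t1(1) by (auto simp: X_def)
  qed
  then show "2 * K * \<bar>w t\<bar> < 1" "p_min < p t" by auto
qed

lemma traj_growth:
  assumes "traj b T w p" "0 \<le> s" "s \<le> t" "t < T"
  shows "(w t)\<^sup>2 + (t - s) \<le> (w s)\<^sup>2" "p s \<le> p t"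
  using traj_growth_step[OF assms] traj_invariant[OF assms(1)] assms by auto

lemma traj_square_le: "traj b T w p \<Longrightarrow> t \<in> {0..<T} \<Longrightarrow> (w t)\<^sup>2 \<le> w0\<^sup>2"
  using traj_growth(1)[of b T w p 0 t] trajD(1)[of b T w p] by auto

lemma traj_p_ge_1: "traj b T w p \<Longrightarrow> t \<in> {0..<T} \<Longrightarrow> 1 \<le> p t"
  using traj_invariant(2)[of b T w p t] p_min_ge_1 by auto

text \<open>The central estimate: it makes \<open>1 / \<bar>w\<bar>\<close> integrable up to time \<open>T\<close>.\<close>

lemma traj_square_ge:
  assumes "traj b T w p" "t \<in> {0..<T}"
  shows "T - t \<le> (w t)\<^sup>2"
proof (rule ccontr)
  assume "\<not> T - t \<le> (w t)\<^sup>2"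
  then have "max t (t + (w t)\<^sup>2) < T" using assms by auto
  then obtain s where s: "t \<le> s" "t + (w t)\<^sup>2 < s" "s < T" using dense by (metis max_less_iff_conj less_imp_le)
  then show False using traj_growth(1)[OF assms(1), of t s] assms(2) zero_le_power2[of "w s"] by auto
qed

lemma traj_time_le: "traj b T w p \<Longrightarrow> T \<le> w0\<^sup>2"
  using traj_square_ge[of b T w p 0] trajD(1,3)[of b T w p] by auto

lemma traj_p_le:
  assumes tr: "traj b T w p" and t: "t \<in> {0..<T}"
  shows "p t \<le> (p0 + (1 + \<bar>w0\<bar> + K)) * exp t"
proof -
  define C where "C = 1 + \<bar>w0\<bar> + K"
  obtain N where N: "negligible N"
    and dp: "\<And>t. t \<in> {0<..<T} - N \<Longrightarrow> (p has_real_derivative 1 + w t + p t + b t $ 2) (at t)"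
    and b: "\<And>t. t \<in> {0<..<T} - N \<Longrightarrow> \<bar>b t $ 2\<bar> \<le> K"
    using traj_ode[OF tr] by metis
  have "(p t + C) * exp (- t) - (p 0 + C) * exp (- 0) \<le> 0"
  proof (rule lip_on_growth_le[OF _ _ N, where g="\<lambda>s. (p s + C) * exp (- s)"])
    show "lip_on {0..t} (\<lambda>s. (p s + C) * exp (- s))"
      using trajD(7)[OF tr, of t] t
      by (intro lip_on_mult lip_on_add lip_on_const lip_on_C1[of _ _ "\<lambda>s. exp (- s)" "\<lambda>s. - exp (- s)"])
        (auto intro!: derivative_eq_intros continuous_intros)
    show "((\<lambda>r. 0) has_integral (0::real)) {0..t}" by simp
    fix r assume r: "r \<in> {0<..<t} - N"
    then have r': "r \<in> {0<..<T} - N" using t by auto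
    have "\<bar>w r\<bar> \<le> \<bar>w0\<bar>" using traj_square_le[OF tr, of r] r' by (simp add: abs_le_square_iff)
    then have "(1 + w r + p r + b r $ 2) - (p r + C) \<le> 0" using b[OF r'] by (auto simp: C_def)
    then have "((1 + w r + p r + b r $ 2) - (p r + C)) * exp (- r) \<le> 0"
      by (simp add: mult_nonpos_nonneg)
    then show "((\<lambda>s. (p s + C) * exp (- s)) has_real_derivative
        ((1 + w r + p r + b r $ 2) - (p r + C)) * exp (- r)) (at r) \<and>
        ((1 + w r + p r + b r $ 2) - (p r + C)) * exp (- r) \<le> 0"
      by (auto intro!: derivative_eq_intros dp[OF r'] simp: algebra_simps)
  qed (use t in auto)
  then have "(p t + C) * exp (- t) * exp t \<le> (p0 + C) * exp t"
    using trajD(2)[OF tr] by (intro mult_right_mono) auto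
  then have "p t + C \<le> (p0 + C) * exp t" by (simp add: mult.assoc exp_add[symmetric])
  then show ?thesis using K_pos by (simp add: C_def)
qed

text \<open>The Gronwall constant: the exponent is the integral over \<open>[0, T]\<close> of the coefficient in
\<open>square_difference_growth\<close> with \<open>R = 1 / sqrt (T - t)\<close>.\<close>

definition stability_const :: "real \<Rightarrow> real" where
  "stability_const T = T * (2 * w0\<^sup>2 + 1) * exp (7 * T + 2 * (4 * K + 1) * sqrt T)"

text \<open>Gronwall's argument with the singular coefficient \<open>a\<close> of \<open>square_difference_growth\<close>. It gives a bound that does
not deteriorate as \<open>t\<close> tends to \<open>T\<close>, although the field is singular there.\<close>

lemma traj_comparison:
  assumes tr: "traj b T w p" and tr': "traj b' T w' p'"
    and M: "negligible M" and \<eta>: "\<And>t. t \<in> {0..<T} - M \<Longrightarrow> norm (b' t - b t) \<le> \<eta>"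
    and t: "t \<in> {0..<T}"
  shows "((w' t)\<^sup>2 - (w t)\<^sup>2)\<^sup>2 + (p' t - p t)\<^sup>2 \<le> stability_const T * \<eta>\<^sup>2"
proof -
  obtain N1 where N1: "negligible N1"
    and dw: "\<And>t. t \<in> {0<..<T} - N1 \<Longrightarrow> (w has_real_derivative - p t / w t + b t $ 1) (at t)"
    and dp: "\<And>t. t \<in> {0<..<T} - N1 \<Longrightarrow> (p has_real_derivative 1 + w t + p t + b t $ 2) (at t)"
    and b1: "\<And>t. t \<in> {0<..<T} - N1 \<Longrightarrow> \<bar>b t $ 1\<bar> \<le> K"
    using traj_ode[OF tr] by metis
  obtain N2 where N2: "negligible N2"
    and dw': "\<And>t. t \<in> {0<..<T} - N2 \<Longrightarrow> (w' has_real_derivative - p' t / w' t + b' t $ 1) (at t)"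
    and dp': "\<And>t. t \<in> {0<..<T} - N2 \<Longrightarrow> (p' has_real_derivative 1 + w' t + p' t + b' t $ 2) (at t)"
    using traj_ode[OF tr'] by metis
  define N where "N = N1 \<union> N2 \<union> M"
  have N: "negligible N" using N1 N2 M by (simp add: N_def)
  \<comment> \<open>\<open>A\<close> is a primitive of the coefficient \<open>a\<close>; it stays bounded as its
    argument tends to \<open>T\<close>.\<close>
  define d e A where "d s = (w' s)\<^sup>2 - (w s)\<^sup>2" and "e s = p' s - p s"
    and "A s = 7 * s + 2 * (4 * K + 1) * (sqrt T - sqrt (T - s))" for s
  define d' e' a where "d' s = 2 * w' s * (- p' s / w' s + b' s $ 1) - 2 * w s * (- p s / w s + b s $ 1)"
    and "e' s = (1 + w' s + p' s + b' s $ 2) - (1 + w s + p s + b s $ 2)"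
    and "a s = 7 + (4 * K + 1) * (1 / sqrt (T - s))" for s
  have dA: "(A has_real_derivative a s) (at s)" if "s < T" for s
    unfolding A_def a_def using that
    by (auto intro!: derivative_eq_intros simp: field_simps)
  have A0: "0 \<le> A s" if "0 \<le> s" "s \<le> T" for s
    using that K_pos unfolding A_def by (intro add_nonneg_nonneg mult_nonneg_nonneg) auto
  have tT: "0 \<le> t" "t < T" using t by auto
  have lips: "lip_on {0..t} w" "lip_on {0..t} p" "lip_on {0..t} w'" "lip_on {0..t} p'"
    using trajD(6,7)[OF tr tT(2)] trajD(6,7)[OF tr' tT(2)] by auto
  let ?c = "(2 * w0\<^sup>2 + 1) * \<eta>\<^sup>2"
  have "((d t)\<^sup>2 + (e t)\<^sup>2) * exp (- A t) - ((d 0)\<^sup>2 + (e 0)\<^sup>2) * exp (- A 0) \<le> t * ?c"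
  proof (rule lip_on_growth_le[OF _ tT(1) N, where g="\<lambda>s. ((d s)\<^sup>2 + (e s)\<^sup>2) * exp (- A s)"])
    have "lip_on {0..t} (\<lambda>s. exp (- A s))"
    proof (rule lip_on_C1)
      show "((\<lambda>s. exp (- A s)) has_real_derivative - a s * exp (- A s)) (at s within {0..t})" if "s \<in> {0..t}" for s
      proof -
        have "((\<lambda>s. exp (- A s)) has_real_derivative - a s * exp (- A s)) (at s)"
          using that tT by (auto intro!: derivative_eq_intros dA)
        then show ?thesis by (rule has_field_derivative_at_within)
      qed
      show "continuous_on {0..t} (\<lambda>s. - a s * exp (- A s))"
        unfolding a_def A_def using tT by (intro continuous_intros) auto
    qed
    then show "lip_on {0..t} (\<lambda>s. ((d s)\<^sup>2 + (e s)\<^sup>2) * exp (- A s))"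
      unfolding d_def e_def power2_eq_square
      by (intro lip_on_mult lip_on_add lip_on_diff lips) auto
    show "((\<lambda>s. ?c) has_integral t * ?c) {0..t}"
      using has_integral_const_real[of ?c 0 t] tT by simp
    fix s assume s: "s \<in> {0<..<t} - N"
    then have sT: "s \<in> {0<..<T} - N1" "s \<in> {0<..<T} - N2" "s \<in> {0..<T} - M" "s \<in> {0..<T}"
      using tT by (auto simp: N_def)
    have dd: "(d has_real_derivative d' s) (at s)"
      unfolding d_def d'_def by (auto intro!: derivative_eq_intros dw[OF sT(1)] dw'[OF sT(2)])
    have de: "(e has_real_derivative e' s) (at s)"
      unfolding e_def e'_def by (auto intro!: derivative_eq_intros dp[OF sT(1)] dp'[OF sT(2)])
    have der: "((\<lambda>s. ((d s)\<^sup>2 + (e s)\<^sup>2) * exp (- A s)) has_real_derivative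
        (2 * d s * d' s + 2 * e s * e' s - a s * ((d s)\<^sup>2 + (e s)\<^sup>2)) * exp (- A s)) (at s)"
      using sT by (auto intro!: derivative_eq_intros dd de dA simp: algebra_simps)
    have "2 * d s * d' s + 2 * e s * e' s \<le> a s * ((d s)\<^sup>2 + (e s)\<^sup>2) + ?c"
      unfolding d_def e_def d'_def e'_def a_def
    proof (rule square_difference_growth)
      show "sgn (w' s) = sgn (w s)" using traj_sign[OF tr] traj_sign[OF tr'] sT by auto
      show "w s \<noteq> 0" using trajD(5)[OF tr] sT by auto
      have "sqrt (T - s) \<le> sqrt ((w s)\<^sup>2)" using traj_square_ge[OF tr sT(4)] by (intro real_sqrt_le_mono)
      then show "1 \<le> 1 / sqrt (T - s) * \<bar>w s\<bar>" using sT by (simp add: field_simps)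
      show "0 \<le> 1 / sqrt (T - s)" using sT by simp
      show "(w' s)\<^sup>2 \<le> w0\<^sup>2" using traj_square_le[OF tr' sT(4)] .
      show "\<bar>b s $ 1\<bar> \<le> K" using b1[OF sT(1)] .
      show "\<bar>b' s $ 1 - b s $ 1\<bar> \<le> \<eta>" "\<bar>b' s $ 2 - b s $ 2\<bar> \<le> \<eta>"
        using component_le_norm_cart[of "b' s - b s"] \<eta>[OF sT(3)] by (auto intro: order_trans)
    qed
    then have "(2 * d s * d' s + 2 * e s * e' s - a s * ((d s)\<^sup>2 + (e s)\<^sup>2)) * exp (- A s) \<le> ?c * 1"
      using A0[of s] sT by (intro mult_mono) auto
    with der show "((\<lambda>s. ((d s)\<^sup>2 + (e s)\<^sup>2) * exp (- A s)) has_real_derivative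
        (2 * d s * d' s + 2 * e s * e' s - a s * ((d s)\<^sup>2 + (e s)\<^sup>2)) * exp (- A s)) (at s) \<and>
        (2 * d s * d' s + 2 * e s * e' s - a s * ((d s)\<^sup>2 + (e s)\<^sup>2)) * exp (- A s) \<le> ?c" by simp
  qed
  moreover have "d 0 = 0" "e 0 = 0" using trajD(1,2)[OF tr] trajD(1,2)[OF tr'] by (auto simp: d_def e_def)
  ultimately have "((d t)\<^sup>2 + (e t)\<^sup>2) * exp (- A t) * exp (A t) \<le> (t * ?c) * exp (A t)"
    by (intro mult_right_mono) auto
  then have "(d t)\<^sup>2 + (e t)\<^sup>2 \<le> (t * ?c) * exp (A t)"
    by (simp add: mult.assoc exp_add[symmetric])
  also have "\<dots> \<le> (T * ?c) * exp (7 * T + 2 * (4 * K + 1) * sqrt T)"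
  proof (intro mult_mono)
    have "2 * (4 * K + 1) * (sqrt T - sqrt (T - t)) \<le> 2 * (4 * K + 1) * sqrt T"
      using tT K_pos by (intro mult_left_mono) auto
    then show "exp (A t) \<le> exp (7 * T + 2 * (4 * K + 1) * sqrt T)"
      using tT by (simp add: A_def)
  qed (use tT in auto)
  also have "\<dots> = stability_const T * \<eta>\<^sup>2" by (simp add: stability_const_def mult_ac)
  finally show ?thesis by (simp add: d_def e_def)
qed

lemma traj_unique:
  assumes tr: "traj b T w p" and tr': "traj b T w' p'" and t: "t \<in> {0..<T}"
  shows "w' t = w t" "p' t = p t"
proof -
  have "((w' t)\<^sup>2 - (w t)\<^sup>2)\<^sup>2 + (p' t - p t)\<^sup>2 \<le> 0"
    using traj_comparison[OF tr tr', of "{}" 0 t] t by simp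
  then have "(w' t)\<^sup>2 = (w t)\<^sup>2" and *: "p' t = p t"
    by (auto simp: sum_power2_le_zero_iff)
  moreover have "sgn (w' t) = sgn (w t)" using traj_sign[OF tr t] traj_sign[OF tr' t] by simp
  ultimately show "w' t = w t" "p' t = p t"
    by (auto simp: power2_eq_iff sgn_minus sgn_zero_iff)
qed

end

section \<open>Existence up to the quenching time\<close>

lemma indefinite_integral_lipschitz:
  fixes f :: "real \<Rightarrow> 'a::euclidean_space"
  assumes "f integrable_on {a..b}" "\<And>r. r \<in> {a..b} \<Longrightarrow> norm (f r) \<le> C" "0 \<le> C"
    and "s \<in> {a..b}" "t \<in> {a..b}"
  shows "norm (integral {a..s} f - integral {a..t} f) \<le> C * \<bar>s - t\<bar>"
proof -
  have *: "norm (integral {a..t} f - integral {a..s} f) \<le> C * (t - s)"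
    if "a \<le> s" "s \<le> t" "t \<le> b" for s t
  proof -
    have "integral {a..s} f + integral {s..t} f = integral {a..t} f"
      using that by (intro Henstock_Kurzweil_Integration.integral_combine integrable_subinterval_real[OF assms(1)]) auto
    then have "integral {a..t} f - integral {a..s} f = integral {s..t} f" by (simp add: algebra_simps)
    moreover have "f integrable_on {s..t}" using that by (intro integrable_subinterval_real[OF assms(1)]) auto
    then have "norm (integral {s..t} f) \<le> C * measure lborel (cbox s t)"
      using assms(2,3) that by (intro has_integral_bound[of C f "integral {s..t} f" s t]) (auto simp: integrable_integral)
    ultimately show ?thesis using that by simp
  qed
  show ?thesis
    using *[of s t] *[of t s] assms(4,5) by (cases "s \<le> t") (auto simp: norm_minus_commute abs_if)
qed

context quenching_start
begin

text \<open>In the coordinates \<open>(v, q)\<close> with \<open>v = w\<^sup>2\<close> and \<open>q = p\<close> the system becomes globally Lipschitz once \<open>sqrt v\<close> is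
replaced by \<open>sqrt (max v \<delta>)\<close>. Its solution is a trajectory as long as \<open>v > \<delta>\<close>, and it must reach \<open>v = \<delta>\<close>
because a trajectory lives no longer than \<open>w0\<^sup>2\<close>.\<close>

lemma traj_exists_until:
  assumes b: "bounded_forcing K b" and \<delta>: "0 < \<delta>" "\<delta> < w0\<^sup>2"
  obtains T w p t where "traj b T w p" "t \<in> {0..<T}" "(w t)\<^sup>2 < 2 * \<delta>"
proof -
  \<comment> \<open>Any horizon beyond the maximal lifetime \<open>w0\<^sup>2\<close> serves.\<close>
  define S where "S = w0\<^sup>2 + 1"
  have S: "0 < S" by (simp add: S_def add_nonneg_pos)
  define \<sigma> where "\<sigma> = sgn w0"
  have \<sigma>: "\<bar>\<sigma>\<bar> = 1" "\<sigma> * \<sigma> = 1" using w0_nonzero by (auto simp: \<sigma>_def sgn_if)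
  obtain N0 where N0: "negligible N0" "\<And>t. t \<in> {0..} - N0 \<Longrightarrow> norm (b t) \<le> K"
    and bmeas: "b \<in> borel_measurable (lebesgue_on {0..})"
    using b unfolding bounded_forcing_def by blast
  \<comment> \<open>The forcing is truncated on a null set so that it is bounded everywhere.\<close>
  define c1 c2 where "c1 t = max (- K) (min K (b t $ 1))" and "c2 t = max (- K) (min K (b t $ 2))" for t
  have cb: "\<bar>c1 t\<bar> \<le> K" "\<bar>c2 t\<bar> \<le> K" for t using K_pos by (auto simp: c1_def c2_def)
  have ceq: "c1 t = b t $ 1" "c2 t = b t $ 2" if "t \<in> {0..} - N0" for t
    using N0(2)[OF that] component_le_norm_cart[of "b t" 1] component_le_norm_cart[of "b t" 2]
    by (auto simp: c1_def c2_def)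
  have "b \<in> borel_measurable (lebesgue_on {0..S})"
    by (rule measurable_restrict_mono[OF bmeas]) auto
  then have bm: "(\<lambda>t. b t $ i) \<in> borel_measurable (lebesgue_on {0..S})" for i
    by (rule measurable_compose) (intro borel_measurable_continuous_onI linear_continuous_on bounded_linear_vec_nth)
  have cm [measurable]: "c1 \<in> borel_measurable (lebesgue_on {0..S})" "c2 \<in> borel_measurable (lebesgue_on {0..S})"
    unfolding c1_def c2_def by (intro borel_measurable_max borel_measurable_min bm borel_measurable_const)+
  define r where "r v = sqrt (max v \<delta>)" for v
  have r_lip: "\<bar>r v - r v'\<bar> \<le> \<bar>v - v'\<bar> / sqrt \<delta>" for v v'
  proof -
    have "(r v)\<^sup>2 = max v \<delta>" "(r v')\<^sup>2 = max v' \<delta>" using \<delta> by (auto simp: r_def)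
    moreover have "(r v - r v') * (r v + r v') = (r v)\<^sup>2 - (r v')\<^sup>2" by (simp add: power2_eq_square algebra_simps)
    ultimately have "\<bar>r v - r v'\<bar> * \<bar>r v + r v'\<bar> = \<bar>max v \<delta> - max v' \<delta>\<bar>" by (simp add: abs_mult[symmetric])
    also have "\<dots> \<le> \<bar>v - v'\<bar>" by auto
    finally have 1: "\<bar>r v - r v'\<bar> * \<bar>r v + r v'\<bar> \<le> \<bar>v - v'\<bar>" .
    have "sqrt \<delta> \<le> r v" "sqrt \<delta> \<le> r v'" by (auto simp: r_def)
    moreover have "0 < sqrt \<delta>" using \<delta> by simp
    ultimately have "\<bar>r v - r v'\<bar> * sqrt \<delta> \<le> \<bar>r v - r v'\<bar> * \<bar>r v + r v'\<bar>" by (intro mult_left_mono) auto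
    then show ?thesis using 1 \<open>0 < sqrt \<delta>\<close> by (simp add: pos_le_divide_eq)
  qed
  define G :: "real \<Rightarrow> real \<times> real \<Rightarrow> real \<times> real" where
    "G s x = (- 2 * snd x + 2 * \<sigma> * r (fst x) * c1 s, 1 + \<sigma> * r (fst x) + snd x + c2 s)" for s x
  have Gbound: "\<exists>C\<ge>0. \<forall>s\<in>{0..S}. norm (G s (x s)) \<le> C" if x: "continuous_on {0..S} x" for x
  proof -
    have "continuous_on {0..S} (\<lambda>s. 2 * \<bar>snd (x s)\<bar> + 2 * r (fst (x s)) * K + (1 + r (fst (x s)) + \<bar>snd (x s)\<bar> + K))"
      unfolding r_def by (intro continuous_intros x)
    then have "bounded ((\<lambda>s. 2 * \<bar>snd (x s)\<bar> + 2 * r (fst (x s)) * K + (1 + r (fst (x s)) + \<bar>snd (x s)\<bar> + K)) ` {0..S})"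
      by (intro compact_imp_bounded compact_continuous_image) auto
    then obtain C where C: "C > 0" "\<And>s. s \<in> {0..S} \<Longrightarrow>
        \<bar>2 * \<bar>snd (x s)\<bar> + 2 * r (fst (x s)) * K + (1 + r (fst (x s)) + \<bar>snd (x s)\<bar> + K)\<bar> \<le> C"
      unfolding bounded_pos by auto
    have "norm (G s (x s)) \<le> C" if s: "s \<in> {0..S}" for s
    proof -
      have r0: "0 \<le> r (fst (x s))" using \<delta> by (simp add: r_def)
      have "\<bar>2 * \<sigma> * r (fst (x s)) * c1 s\<bar> \<le> 2 * r (fst (x s)) * K"
        using \<sigma>(1) r0 cb(1)[of s] by (simp add: abs_mult mult_left_mono)
      moreover have "\<bar>\<sigma> * r (fst (x s))\<bar> = r (fst (x s))" using \<sigma>(1) r0 by (simp add: abs_mult)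
      moreover have "norm (G s (x s)) \<le> \<bar>- 2 * snd (x s) + 2 * \<sigma> * r (fst (x s)) * c1 s\<bar>
          + \<bar>1 + \<sigma> * r (fst (x s)) + snd (x s) + c2 s\<bar>"
        unfolding G_def using norm_Pair_le by (metis real_norm_def)
      ultimately show ?thesis using C(2)[OF s] cb(2)[of s] by linarith
    qed
    then show ?thesis using C(1) by (intro exI[of _ C]) auto
  qed
  have Gint: "(\<lambda>s. G s (x s)) integrable_on {0..S}" if x: "continuous_on {0..S} x" for x
  proof -
    obtain C where C: "\<forall>s\<in>{0..S}. norm (G s (x s)) \<le> C" using Gbound[OF x] by blast
    have "continuous_on {0..S} (\<lambda>s. r (fst (x s)))" "continuous_on {0..S} (\<lambda>s. snd (x s))"
      unfolding r_def by (intro continuous_intros x)+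
    then have [measurable]: "(\<lambda>s. r (fst (x s))) \<in> borel_measurable (lebesgue_on {0..S})"
       "(\<lambda>s. snd (x s)) \<in> borel_measurable (lebesgue_on {0..S})"
      by (auto intro: continuous_imp_measurable_on_sets_lebesgue)
    have "(\<lambda>s. G s (x s)) \<in> borel_measurable (lebesgue_on {0..S})"
      unfolding G_def by measurable
    then show ?thesis
      by (rule measurable_bounded_by_integrable_imp_integrable[of _ _ "\<lambda>_. C"]) (use C in auto)
  qed
  have nf: "\<bar>fst z\<bar> \<le> norm z" "\<bar>snd z\<bar> \<le> norm z" for z :: "real \<times> real"
    using norm_fst_le[of "fst z" "snd z"] norm_snd_le[of "snd z" "fst z"] by auto
  define \<Lambda> where "\<Lambda> = 3 + (2 * K + 1) / sqrt \<delta>"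
  have Glip: "norm (G s x - G s x') \<le> \<Lambda> * norm (x - x')" for s x x'
  proof -
    have f: "\<bar>fst x - fst x'\<bar> \<le> norm (x - x')" "\<bar>snd x - snd x'\<bar> \<le> norm (x - x')"
      using nf[of "x - x'"] by auto
    define \<rho> where "\<rho> = r (fst x) - r (fst x')"
    have \<rho>: "\<bar>\<rho>\<bar> \<le> norm (x - x') / sqrt \<delta>"
      unfolding \<rho>_def using r_lip[of "fst x" "fst x'"] divide_right_mono[OF f(1), of "sqrt \<delta>"] \<delta> by simp
    have "G s x - G s x' = (- 2 * (snd x - snd x') + 2 * \<sigma> * \<rho> * c1 s, \<sigma> * \<rho> + (snd x - snd x'))"
      by (simp add: G_def \<rho>_def algebra_simps)
    then have "norm (G s x - G s x') \<le> \<bar>- 2 * (snd x - snd x') + 2 * \<sigma> * \<rho> * c1 s\<bar> + \<bar>\<sigma> * \<rho> + (snd x - snd x')\<bar>"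
      using norm_Pair_le by (metis real_norm_def)
    also have "\<dots> \<le> 3 * \<bar>snd x - snd x'\<bar> + \<bar>2 * \<sigma> * \<rho> * c1 s\<bar> + \<bar>\<sigma> * \<rho>\<bar>"
    proof -
      have "\<bar>- 2 * u + z\<bar> + \<bar>y + u\<bar> \<le> 3 * \<bar>u\<bar> + \<bar>z\<bar> + \<bar>y\<bar>" for u z y :: real by linarith
      then show ?thesis .
    qed
    also have "\<dots> \<le> 3 * norm (x - x') + 2 * (norm (x - x') / sqrt \<delta>) * K + norm (x - x') / sqrt \<delta>"
    proof (intro add_mono)
      show "\<bar>2 * \<sigma> * \<rho> * c1 s\<bar> \<le> 2 * (norm (x - x') / sqrt \<delta>) * K"
        using \<sigma>(1) \<rho> cb(1)[of s] K_pos by (simp only: abs_mult) (intro mult_mono; simp)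
    qed (use f \<rho> \<sigma>(1) in \<open>auto simp: abs_mult\<close>)
    also have "\<dots> = \<Lambda> * norm (x - x')" by (simp add: \<Lambda>_def add_divide_distrib algebra_simps)
    finally show ?thesis .
  qed
  have L\<Lambda>: "((\<lambda>t. \<Lambda> * t) has_real_derivative \<Lambda>) (at t)" for t
    by (auto intro!: derivative_eq_intros)
  obtain x where x: "continuous_on {0..S} x"
      "\<And>t. t \<in> {0..S} \<Longrightarrow> x t = (w0\<^sup>2, p0) + integral {0..t} (\<lambda>s. G s (x s))"
  proof (rule integral_equation_has_solution[of S "\<lambda>t. \<Lambda> * t" "\<lambda>_. \<Lambda>" G "(w0\<^sup>2, p0)"])
    show "continuous_on {0..S} ((*) \<Lambda>)" by (intro continuous_intros)
  qed (use S L\<Lambda> Gint Glip in auto)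
  define v q where "v t = fst (x t)" and "q t = snd (x t)" for t
  obtain N1 where N1: "negligible N1" "\<And>t. t \<in> {0<..<S} - N1 \<Longrightarrow>
      ((\<lambda>u. integral {0..u} (\<lambda>s. G s (x s))) has_vector_derivative G t (x t)) (at t)"
    using indefinite_integral_has_vector_derivative_ae[OF Gint[OF x(1)]] by blast
  define N where "N = N0 \<union> N1"
  have N: "negligible N" using N0 N1 by (simp add: N_def)
  have dvq: "(v has_real_derivative - 2 * q t + 2 * \<sigma> * r (v t) * b t $ 1) (at t)"
    "(q has_real_derivative 1 + \<sigma> * r (v t) + q t + b t $ 2) (at t)" if t: "t \<in> {0<..<S} - N" for t
  proof -
    have "((\<lambda>u. (w0\<^sup>2, p0) + integral {0..u} (\<lambda>s. G s (x s))) has_vector_derivative 0 + G t (x t)) (at t)"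
      using t N1(2) by (intro has_vector_derivative_add has_vector_derivative_const) (auto simp: N_def)
    then have dx: "(x has_vector_derivative G t (x t)) (at t)"
      using t x(2)
      by (intro has_vector_derivative_transform_within_open[of "\<lambda>u. (w0\<^sup>2, p0) + integral {0..u} (\<lambda>s. G s (x s))" _ t "{0<..<S}" x]) auto
    have c: "c1 t = b t $ 1" "c2 t = b t $ 2" using ceq[of t] t by (auto simp: N_def)
    show "(v has_real_derivative - 2 * q t + 2 * \<sigma> * r (v t) * b t $ 1) (at t)"
      using bounded_linear.has_vector_derivative[OF bounded_linear_fst dx]
      by (simp add: has_real_derivative_iff_has_vector_derivative v_def[abs_def] q_def G_def c)
    show "(q has_real_derivative 1 + \<sigma> * r (v t) + q t + b t $ 2) (at t)"
      using bounded_linear.has_vector_derivative[OF bounded_linear_snd dx]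
      by (simp add: has_real_derivative_iff_has_vector_derivative v_def q_def[abs_def] G_def c)
  qed
  obtain C where C: "C \<ge> 0" "\<And>s. s \<in> {0..S} \<Longrightarrow> norm (G s (x s)) \<le> C" using Gbound[OF x(1)] by blast
  have xl: "norm (x s - x t) \<le> C * \<bar>s - t\<bar>" if "s \<in> {0..S}" "t \<in> {0..S}" for s t
    using indefinite_integral_lipschitz[OF Gint[OF x(1)] C(2,1) that] x(2)[OF that(1)] x(2)[OF that(2)] by simp
  have lv: "lip_on {0..S} v" and lq: "lip_on {0..S} q"
    using order_trans[OF nf(1) xl] order_trans[OF nf(2) xl] C(1)
    by (auto intro!: lip_onI[of _ _ C] simp: v_def q_def)
  have init: "v 0 = w0\<^sup>2" "q 0 = p0" using x(2)[of 0] S by (auto simp: v_def q_def)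
  define w where "w t = \<sigma> * sqrt (v t)" for t
  have tr: "traj b T w q" if T: "0 < T" "T \<le> S" and big: "\<And>t. t \<in> {0..<T} \<Longrightarrow> \<delta> < v t" for T
    unfolding traj_def trajectory_def
  proof (intro conjI ballI allI impI b T(1))
    fix t assume "t \<in> {0..<T}"
    then show "w t \<noteq> 0" using big[of t] \<delta> \<sigma>(1) by (auto simp: w_def)
  next
    fix c assume c: "c < T"
    have "\<delta> \<le> v t" if "t \<in> {0..c}" for t using big[of t] that c by auto
    then show "lip_on {0..c} w" unfolding w_def
      by (intro lip_on_cmult lip_on_sqrt[OF _ \<delta>(1)] lip_on_subset[OF lv]) (use c T in auto)
    show "lip_on {0..c} q" by (rule lip_on_subset[OF lq]) (use c T in auto)
  next
    have "(w has_real_derivative - q t / w t + b t $ 1) (at t) \<and>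
        (q has_real_derivative 1 + w t + q t + b t $ 2) (at t)" if t: "t \<in> {0<..<T} - N" for t
    proof -
      have t': "t \<in> {0<..<S} - N" "\<delta> < v t" using t T big by auto
      have rv: "r (v t) = sqrt (v t)" "0 < v t" using t'(2) \<delta> by (auto simp: r_def max_def)
      have s: "sqrt (v t) > 0" using rv by simp
      have "(w has_real_derivative \<sigma> * ((- 2 * q t + 2 * \<sigma> * r (v t) * b t $ 1) * (inverse (sqrt (v t)) / 2))) (at t)"
        unfolding w_def[abs_def] using rv(2)
        by (auto intro!: derivative_eq_intros dvq(1)[OF t'(1)] simp: field_simps)
      also have "\<sigma> * ((- 2 * q t + 2 * \<sigma> * r (v t) * b t $ 1) * (inverse (sqrt (v t)) / 2))
          = - (\<sigma> * q t) / sqrt (v t) + (\<sigma> * \<sigma>) * b t $ 1"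
        using s unfolding rv(1) by (simp add: field_simps)
      also have "\<dots> = - q t / w t + b t $ 1"
        using \<sigma> s w0_nonzero by (cases "\<sigma> = 1") (auto simp: w_def abs_if split: if_splits)
      finally show ?thesis using dvq(2)[OF t'(1)] by (simp add: rv w_def[abs_def])
    qed
    then show "\<exists>N. negligible N \<and> (\<forall>t\<in>{0<..<T} - N. (w has_real_derivative - q t / w t + b t $ 1) (at t) \<and>
        (q has_real_derivative 1 + w t + q t + b t $ 2) (at t))" using N by blast
  next
    show "w 0 = w0" by (simp add: w_def init \<sigma>_def) (simp add: sgn_mult_abs)
    show "q 0 = p0" by (rule init)
  qed
  define Z where "Z = {t\<in>{0..S}. v t \<le> \<delta>}"
  have cv: "continuous_on {0..S} v" by (rule lip_on_imp_continuous_on[OF lv])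
  have "Z \<noteq> {}"
  proof
    assume Z: "Z = {}"
    have "\<delta> < v t" if "t \<in> {0..<S}" for t
    proof -
      have "t \<notin> Z" by (simp add: Z)
      then show ?thesis using that by (auto simp: Z_def)
    qed
    with tr have "traj b S w q" using S by (intro tr) auto
    then show False using traj_time_le by (force simp: S_def)
  qed
  moreover have "compact Z"
    unfolding Z_def compact_eq_bounded_closed
    by (intro conjI continuous_on_closed_Collect_le cv continuous_intros) (auto intro: bounded_subset[of "{0..S}"])
  ultimately obtain t1 where t1: "t1 \<in> Z" "\<And>s. s \<in> Z \<Longrightarrow> t1 \<le> s"
    using compact_attains_inf[of Z] by blast
  have t1p: "0 < t1" "t1 \<le> S" "v t1 \<le> \<delta>" using t1(1) init \<delta>(2) by (cases "t1 = 0"; auto simp: Z_def)+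
  have "traj b t1 w q" using t1(2) t1p by (intro tr) (force simp: Z_def)+
  moreover obtain t where "t \<in> {0..<t1}" "(w t)\<^sup>2 < 2 * \<delta>"
  proof -
    obtain d where d: "d > 0" "\<And>s. s \<in> {0..S} \<Longrightarrow> dist s t1 < d \<Longrightarrow> dist (v s) (v t1) < \<delta>"
      using cv[unfolded continuous_on_iff, rule_format, of t1 \<delta>] t1p \<delta> by auto
    define s where "s = max 0 (t1 - d / 2)"
    have s: "s \<in> {0..<t1}" "dist s t1 < d" using t1p d(1) by (auto simp: s_def dist_real_def)
    then have "v s < 2 * \<delta>" using d(2)[of s] t1p by (auto simp: dist_real_def)
    moreover have "\<delta> < v s" using t1(2)[of s] s t1p by (force simp: Z_def)
    then have "(w s)\<^sup>2 = v s" using \<delta> \<sigma>(2) by (simp add: w_def power_mult_distrib power2_eq_square[of \<sigma>])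
    ultimately show thesis using that s by auto
  qed
  ultimately show thesis using that by blast
qed

text \<open>The union of all trajectories with the given forcing is a trajectory on \<open>[0, T)\<close>, where \<open>T\<close> is the supremum of the
existence times; it gets arbitrarily close to the singular line because some of these trajectories do.\<close>

lemma quenching_traj_exists:
  assumes b: "bounded_forcing K b"
  obtains T w p where "traj b T w p" "vanishing T w"
proof -
  define X where "X = {T. \<exists>w p. traj b T w p}"
  have w02: "0 < w0\<^sup>2" using w0_nonzero by simp
  obtain T0 where T0: "T0 \<in> X"
    using traj_exists_until[OF b, of "w0\<^sup>2 / 2"] w02 unfolding X_def by (metis field_sum_of_halves half_gt_zero less_add_same_cancel1 mem_Collect_eq)
  have bdd: "bdd_above X" by (rule bdd_aboveI[of _ "w0\<^sup>2"]) (use traj_time_le X_def in blast)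
  define T where "T = Sup X"
  have le: "S \<le> T" if "S \<in> X" for S unfolding T_def using that bdd by (rule cSup_upper)
  have Tpos: "0 < T" using le[OF T0] T0 trajD(3) unfolding X_def by fastforce
  have reach: "\<exists>S w p. t < S \<and> traj b S w p" if "t < T" for t
    using less_cSup_iff[of X t] T0 bdd that unfolding T_def X_def by blast
  \<comment> \<open>A choice of one trajectory beyond each time \<open>t < T\<close>; by uniqueness the choice does
    not affect the values.\<close>
  then obtain S W P where SWP: "\<And>t. t < T \<Longrightarrow> t < S t \<and> traj b (S t) (W t) (P t)" by metis
  define w p where "w t = W t t" and "p t = P t t" for t
  have wp: "w t = w1 t" "p t = p1 t" if tr1: "traj b S1 w1 p1" and t: "t \<in> {0..<S1}" for S1 w1 p1 t
  proof -
    have "t < T" using le[of S1] tr1 t unfolding X_def by fastforce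
    then have s: "t < S t" "traj b (S t) (W t) (P t)" using SWP by auto
    define m where "m = min (S t) S1"
    have "0 < m" "m \<le> S t" "m \<le> S1" "t \<in> {0..<m}" using s(1) t by (auto simp: m_def)
    then show "w t = w1 t" "p t = p1 t"
      using traj_unique[OF traj_restrict[OF tr1] traj_restrict[OF s(2)], of m t] by (auto simp: w_def p_def)
  qed
  have "\<exists>N. negligible N \<and> (\<forall>t\<in>{0<..<S t0} - N.
        (w has_real_derivative - p t / w t + b t $ 1) (at t) \<and>
        (p has_real_derivative 1 + w t + p t + b t $ 2) (at t))" if t0: "t0 < T" for t0
  proof -
    have tr0: "traj b (S t0) (W t0) (P t0)" using SWP[OF t0] by simp
    obtain N where N: "negligible N"
      "\<And>t. t \<in> {0<..<S t0} - N \<Longrightarrow> (W t0 has_real_derivative - P t0 t / W t0 t + b t $ 1) (at t)"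
      "\<And>t. t \<in> {0<..<S t0} - N \<Longrightarrow> (P t0 has_real_derivative 1 + W t0 t + P t0 t + b t $ 2) (at t)"
      using traj_ode[OF tr0] by metis
    have "(w has_real_derivative - p t / w t + b t $ 1) (at t) \<and>
        (p has_real_derivative 1 + w t + p t + b t $ 2) (at t)" if t: "t \<in> {0<..<S t0} - N" for t
    proof -
      have o: "open {0<..<S t0}" "t \<in> {0<..<S t0}" using t by auto
      have eq: "\<And>s. s \<in> {0<..<S t0} \<Longrightarrow> W t0 s = w s" "\<And>s. s \<in> {0<..<S t0} \<Longrightarrow> P t0 s = p s"
        using wp[OF tr0] by auto
      show ?thesis
        using has_field_derivative_transform_within_open[OF N(2)[OF t] o eq(1)]
          has_field_derivative_transform_within_open[OF N(3)[OF t] o eq(2)] eq[OF o(2)] by simp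
    qed
    then show ?thesis using N(1) by blast
  qed
  then obtain N where N: "\<And>t0. t0 < T \<Longrightarrow> negligible (N t0)" "\<And>t0 t. t0 < T \<Longrightarrow> t \<in> {0<..<S t0} - N t0 \<Longrightarrow>
        (w has_real_derivative - p t / w t + b t $ 1) (at t) \<and>
        (p has_real_derivative 1 + w t + p t + b t $ 2) (at t)"
    by metis
  \<comment> \<open>Countably many of the chosen trajectories cover \<open>[0, T)\<close>, so the union of their
    exceptional sets is negligible.\<close>
  define t0 where "t0 n = T - 1 / real (Suc n)" for n
  have t0: "t0 n < T" for n by (simp add: t0_def)
  define M where "M = (\<Union>n. N (t0 n))"
  have M: "negligible M" unfolding M_def using N(1)[OF t0] by (intro negligible_Union_nat)
  have der: "(w has_real_derivative - p t / w t + b t $ 1) (at t) \<and>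
        (p has_real_derivative 1 + w t + p t + b t $ 2) (at t)" if t: "t \<in> {0<..<T} - M" for t
  proof -
    obtain n where "1 / real (Suc n) < T - t" using t nat_approx_posE[of "T - t"] by auto
    then have "t < S (t0 n)" using SWP[OF t0, of n] by (auto simp: t0_def)
    then show ?thesis using N(2)[OF t0, of t n] t by (auto simp: M_def)
  qed
  have lip: "lip_on {0..c} w \<and> lip_on {0..c} p" if c: "c < T" for c
  proof -
    have s: "c < S c" "traj b (S c) (W c) (P c)" using SWP[OF c] by auto
    have eq: "W c t = w t" "P c t = p t" if "t \<in> {0..c}" for t
      using wp[OF s(2), of t] s(1) that by auto
    show ?thesis
      using lip_on_cong[OF trajD(6)[OF s(2,1)] eq(1)] lip_on_cong[OF trajD(7)[OF s(2,1)] eq(2)] by blast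
  qed
  have start: "w 0 = w0" "p 0 = p0"
    using SWP[OF Tpos] wp[of "S 0" "W 0" "P 0" 0] trajD(1,2) by auto
  have ne: "w t \<noteq> 0" if "t \<in> {0..<T}" for t
    using SWP[of t] trajD(5)[of b "S t" "W t" "P t" t] that by (auto simp: w_def)
  have "traj b T w p"
    unfolding traj_def trajectory_def using der M lip start ne Tpos b by blast
  moreover have "vanishing T w"
    unfolding vanishing_def
  proof (intro allI impI)
    fix \<epsilon> :: real assume \<epsilon>: "\<epsilon> > 0"
    define \<delta> where "\<delta> = min (\<epsilon> / 2) (w0\<^sup>2 / 2)"
    have "0 < \<delta>" "\<delta> \<le> \<epsilon> / 2" "\<delta> \<le> w0\<^sup>2 / 2" using \<epsilon> w02 by (auto simp: \<delta>_def)
    then have "0 < \<delta>" "\<delta> < w0\<^sup>2" "2 * \<delta> \<le> \<epsilon>" using w02 by linarith+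
    then obtain S1 w1 p1 t where 1: "traj b S1 w1 p1" "t \<in> {0..<S1}" "(w1 t)\<^sup>2 < \<epsilon>"
      using traj_exists_until[OF b] by (metis less_le_trans)
    moreover have "S1 \<le> T" using le[of S1] 1(1) X_def by blast
    ultimately show "\<exists>t\<in>{0..<T}. (w t)\<^sup>2 < \<epsilon>" using wp(1)[OF 1(1,2)] by (intro bexI[of _ t]) auto
  qed
  ultimately show thesis by (rule that)
qed

lemma vanishing_eventually:
  assumes tr: "traj b T w p" and van: "vanishing T w" and "\<epsilon> > 0"
  shows "\<exists>t0\<in>{0..<T}. \<forall>t\<in>{t0..<T}. (w t)\<^sup>2 < \<epsilon>"
proof -
  obtain t0 where t0: "t0 \<in> {0..<T}" "(w t0)\<^sup>2 < \<epsilon>" using van assms(3) unfolding vanishing_def by blast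
  have "(w t)\<^sup>2 < \<epsilon>" if "t \<in> {t0..<T}" for t
    using traj_growth(1)[OF tr, of t0 t] t0 that by auto
  then show ?thesis using t0 by blast
qed

lemma quenching_traj_unique:
  assumes "traj b T w p" "vanishing T w" "traj b T' w' p'" "vanishing T' w'"
  shows "T = T'"
proof -
  have *: "\<not> T < T'" if tr: "traj b T w p" "vanishing T w" "traj b T' w' p'" for T w p T' w' p'
  proof
    assume less: "T < T'"
    obtain t where t: "t \<in> {0..<T}" "(w t)\<^sup>2 < T' - T" using tr(2) less unfolding vanishing_def by (metis diff_gt_0_iff_gt)
    have "w' t = w t"
      using traj_unique(1)[OF tr(1) traj_restrict[OF tr(3)] t(1)] trajD(3)[OF tr(1)] less by simp
    then show False using traj_square_ge[OF tr(3), of t] t less by auto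
  qed
  show ?thesis using *[OF assms(1,2,3)] *[OF assms(3,4,1)] by linarith
qed

end

section \<open>The costate\<close>

lemma continuous_on_vanishing_at_end:
  fixes f :: "real \<Rightarrow> real"
  assumes c: "\<And>c. c < T \<Longrightarrow> continuous_on {0..c} f" and "f T = 0"
    and van: "\<And>e. 0 < e \<Longrightarrow> \<exists>t0<T. \<forall>t\<in>{t0..<T}. \<bar>f t\<bar> < e"
  shows "continuous_on {0..T} f"
  unfolding continuous_on_iff
proof (intro ballI allI impI)
  fix x e :: real assume x: "x \<in> {0..T}" and e: "0 < e"
  show "\<exists>d>0. \<forall>x'\<in>{0..T}. dist x' x < d \<longrightarrow> dist (f x') (f x) < e"
  proof (cases "x = T")
    case True
    obtain t0 where t0: "t0 < T" "\<forall>t\<in>{t0..<T}. \<bar>f t\<bar> < e" using van[OF e] by blast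
    have "dist (f x') (f x) < e" if "x' \<in> {0..T}" "dist x' x < T - t0" for x'
      using t0 that True e assms(2) by (cases "x' = T") (auto simp: dist_real_def)
    then show ?thesis using t0(1) by (intro exI[of _ "T - t0"]) auto
  next
    case False
    define m where "m = (x + T) / 2"
    have m: "x < m" "m < T" using x False by (auto simp: m_def)
    obtain d where d: "d > 0" "\<forall>x'\<in>{0..m}. dist x' x < d \<longrightarrow> dist (f x') (f x) < e"
      using c[OF m(2), unfolded continuous_on_iff] x m e by (meson atLeastAtMost_iff less_imp_le)
    have "dist (f x') (f x) < e" if "x' \<in> {0..T}" "dist x' x < min d (m - x)" for x'
      using d(2) that by (auto simp: dist_real_def)
    then show ?thesis using d(1) m by (intro exI[of _ "min d (m - x)"]) auto
  qed
qed

lemma lip_on_C1_interior: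
  assumes "continuous_on {a..b} f" "\<And>t. t \<in> {a<..<b} \<Longrightarrow> (f has_real_derivative f' t) (at t)"
    and "continuous_on {a..b} f'"
  shows "lip_on {a..b} f"
proof -
  have "bounded (f' ` {a..b})" using assms(3) by (intro compact_imp_bounded compact_continuous_image) auto
  then obtain L where L: "L > 0" "\<And>t. t \<in> {a..b} \<Longrightarrow> \<bar>f' t\<bar> \<le> L"
    unfolding bounded_pos by (auto simp: real_norm_def)
  have *: "\<bar>f t - f s\<bar> \<le> L * (t - s)" if st: "a \<le> s" "s < t" "t \<le> b" for s t
  proof -
    have "\<exists>l z. s < z \<and> z < t \<and> DERIV f z :> l \<and> f t - f s = (t - s) * l"
    proof (rule MVT[OF st(2)])
      show "continuous_on {s..t} f" using assms(1) by (rule continuous_on_subset) (use st in auto)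
      show "f differentiable (at z)" if "s < z" "z < t" for z
        using assms(2)[of z] that st by (auto simp: real_differentiable_def)
    qed
    then obtain l z where z: "s < z" "z < t" "DERIV f z :> l" "f t - f s = (t - s) * l" by blast
    have "z \<in> {a<..<b}" "z \<in> {a..b}" using z st by auto
    then have "\<bar>l\<bar> \<le> L" using L(2) DERIV_unique[OF z(3) assms(2)] by auto
    then show ?thesis using st by (simp add: z(4) abs_mult)
  qed
  show ?thesis
  proof (rule lip_onI)
    fix s t assume "s \<in> {a..b}" "t \<in> {a..b}"
    then show "\<bar>f s - f t\<bar> \<le> L * \<bar>s - t\<bar>"
      using *[of s t] *[of t s] by (cases s t rule: linorder_cases) (auto simp: abs_minus_commute)
  qed (use L in auto)
qed

text \<open>In the coordinates \<open>(w\<^sup>2, p)\<close> the costate is \<open>(\<psi>\<^sub>1 / (2 w), \<psi>\<^sub>2)\<close>. The left-hand side is the derivative of its pairing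
with the difference \<open>(d, e)\<close> of two trajectories with forcings \<open>\<beta>\<close> and \<open>\<beta> + \<delta>\<close>. By the adjoint equation all terms
that are linear in \<open>(d, e)\<close> cancel. What remains is \<open>\<langle>\<psi>, \<delta>\<rangle>\<close> and two terms of second order.\<close>

lemma pairing_derivative_identity:
  fixes x x' z z' \<beta>1 \<beta>2 \<delta>1 \<delta>2 \<psi>1 \<psi>2 :: real
  assumes x: "x \<noteq> 0" "x' \<noteq> 0"
  defines "d \<equiv> x'\<^sup>2 - x\<^sup>2" and "e \<equiv> z' - z"
  defines "d' \<equiv> 2 * x' * (- z' / x' + (\<beta>1 + \<delta>1)) - 2 * x * (- z / x + \<beta>1)"
    and "e' \<equiv> (1 + x' + z' + (\<beta>2 + \<delta>2)) - (1 + x + z + \<beta>2)"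
    and "\<psi>1' \<equiv> - (z / x\<^sup>2) * \<psi>1 - \<psi>2" and "\<psi>2' \<equiv> \<psi>1 / x - \<psi>2"
  shows "((\<psi>1' * d + \<psi>1 * d') * (2 * x) - \<psi>1 * d * (2 * (- z / x + \<beta>1))) / (2 * x)\<^sup>2 + (\<psi>2' * e + \<psi>2 * e')
     = (\<psi>1 * \<delta>1 + \<psi>2 * \<delta>2) + \<psi>1 / x * (x' - x) * \<delta>1 - (\<beta>1 * (\<psi>1 / x) + \<psi>2) * (x' - x)\<^sup>2 / (2 * x)"
proof -
  define P c where "P = \<psi>1 / (2 * x)" and "c = x' - x"
  have \<psi>1: "\<psi>1 = 2 * x * P" using x by (simp add: P_def)
  have x': "x' = x + c" by (simp add: c_def)
  have d: "d = c * (2 * x + c)" by (simp add: d_def x' power2_eq_square algebra_simps)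
  have d': "d' = - 2 * e + 2 * c * \<beta>1 + 2 * (x + c) * \<delta>1"
  proof -
    have "d' = (- 2 * z' + 2 * x' * (\<beta>1 + \<delta>1)) - (- 2 * z + 2 * x * \<beta>1)"
      using x by (simp add: d'_def algebra_simps)
    then show ?thesis by (simp add: e_def x' algebra_simps)
  qed
  have e': "e' = c + e + \<delta>2" by (simp add: e'_def e_def x')
  have "((\<psi>1' * d + \<psi>1 * d') * (2 * x) - \<psi>1 * d * (2 * (- z / x + \<beta>1))) / (2 * x)\<^sup>2
      = P * d' - (\<psi>2 / (2 * x) + P * \<beta>1 / x) * d"
    using x(1) unfolding \<psi>1'_def \<psi>1 by (simp add: field_simps power2_eq_square)
  also have "\<dots> = P * d' - \<psi>2 * c - 2 * P * \<beta>1 * c - (\<psi>2 / (2 * x) + P * \<beta>1 / x) * c\<^sup>2"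
    using x(1) unfolding d by (simp add: field_simps power2_eq_square)
  finally have 1: "((\<psi>1' * d + \<psi>1 * d') * (2 * x) - \<psi>1 * d * (2 * (- z / x + \<beta>1))) / (2 * x)\<^sup>2
      = P * d' - \<psi>2 * c - 2 * P * \<beta>1 * c - (\<psi>2 / (2 * x) + P * \<beta>1 / x) * c\<^sup>2" .
  have 2: "\<psi>1 / x = 2 * P" using x(1) by (simp add: P_def)
  have 3: "(\<beta>1 * (2 * P) + \<psi>2) * c\<^sup>2 / (2 * x) = (\<psi>2 / (2 * x) + P * \<beta>1 / x) * c\<^sup>2"
    using x(1) by (simp add: field_simps)
  show ?thesis unfolding 1 unfolding \<psi>2'_def 2 c_def[symmetric] 3 d' e'
    by (simp add: \<psi>1 algebra_simps)
qed

context quenching_start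
begin

text \<open>The function \<open>\<theta>\<close> solves \<open>\<theta>' = - (p / w\<^sup>2) \<theta>\<close>, and \<open>\<bar>w\<bar>\<close> solves this equation up to the integrable relative
error \<open>b\<^sub>1 / w\<close>; hence \<open>\<theta> / \<bar>w\<bar>\<close> stays between two positive constants. With \<open>\<psi>\<^sub>1 = \<theta> \<phi>\<close> the adjoint equation becomes
\<open>\<phi>' = - \<psi>\<^sub>2 / \<theta>\<close>, \<open>\<psi>\<^sub>2' = (\<theta> / w) \<phi> - \<psi>\<^sub>2\<close>, whose coefficients are integrable up to \<open>T\<close>. The terminal value
\<open>\<phi> T = - sgn w\<^sub>0\<close> makes \<open>\<psi>\<close> nontrivial and fixes its sign: increasing \<open>w\<^sup>2\<close> is to be penalized.\<close>

lemma adjoint_exists: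
  assumes tr: "traj b T w p" and van: "vanishing T w"
  obtains \<psi>1 \<psi>2 C t0 where "continuous_on {0..T} \<psi>1" "continuous_on {0..T} \<psi>2" "\<psi>1 T = 0" "\<psi>2 T = 0"
    "\<And>t. t \<in> {0<..<T} \<Longrightarrow> (\<psi>1 has_real_derivative - (p t / (w t)\<^sup>2) * \<psi>1 t - \<psi>2 t) (at t)"
    "\<And>t. t \<in> {0<..<T} \<Longrightarrow> (\<psi>2 has_real_derivative \<psi>1 t / w t - \<psi>2 t) (at t)"
    "0 \<le> C" "\<And>t. t \<in> {0..<T} \<Longrightarrow> \<bar>\<psi>1 t\<bar> \<le> C * \<bar>w t\<bar>"
    "t0 \<in> {0..<T}" "\<And>t. t \<in> {t0..<T} \<Longrightarrow> \<psi>1 t * w t < 0"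
proof -
  have T: "0 < T" by (rule trajD(3)[OF tr])
  have ne: "w t \<noteq> 0" if "t \<in> {0..<T}" for t using trajD(5)[OF tr that] .
  define \<sigma> where "\<sigma> = sgn w0"
  have \<sigma>: "\<bar>\<sigma>\<bar> = 1" "\<sigma> * \<sigma> = 1" using w0_nonzero by (auto simp: \<sigma>_def sgn_if)
  have absw: "\<bar>w t\<bar> = \<sigma> * w t" if "t \<in> {0..<T}" for t
    using traj_sign[OF tr that] ne[OF that] by (auto simp: \<sigma>_def sgn_if abs_if split: if_splits)
  have lips: "lip_on {0..c} w" "lip_on {0..c} p" if "c < T" for c using trajD(6,7)[OF tr that] .
  have cont: "continuous_on {0..c} w" "continuous_on {0..c} p" if "c < T" for c
    using lips[OF that] lip_on_imp_continuous_on by auto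
  define \<kappa> where "\<kappa> t = p t / (w t)\<^sup>2" for t
  have c\<kappa>: "continuous_on {0..c} \<kappa>" if "c < T" for c
    unfolding \<kappa>_def by (intro continuous_intros cont that) (use ne that in auto)
  define \<theta> where "\<theta> t = exp (- integral {0..t} \<kappa>)" for t
  have \<theta>pos: "0 < \<theta> t" for t by (simp add: \<theta>_def)
  have c\<theta>: "continuous_on {0..c} \<theta>" if "c < T" for c
    unfolding \<theta>_def by (intro continuous_intros indefinite_integral_continuous_1 integrable_continuous_real c\<kappa> that)
  have d\<theta>: "(\<theta> has_real_derivative - \<kappa> t * \<theta> t) (at t)" if t: "t \<in> {0<..<T}" for t
  proof -
    define m where "m = (t + T) / 2"
    have m: "t < m" "m < T" using t by (auto simp: m_def)
    have "((\<lambda>u. integral {0..u} \<kappa>) has_vector_derivative \<kappa> t) (at t within {0..m})"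
      using t m by (intro integral_has_vector_derivative c\<kappa>) auto
    then have "((\<lambda>u. integral {0..u} \<kappa>) has_vector_derivative \<kappa> t) (at t)"
      using at_within_interior[of t "{0..m}"] t m by (auto simp: interior_atLeastAtMost_real)
    then have "((\<lambda>u. integral {0..u} \<kappa>) has_real_derivative \<kappa> t) (at t)"
      by (simp add: has_real_derivative_iff_has_vector_derivative)
    then show ?thesis unfolding \<theta>_def[abs_def] by (auto intro!: derivative_eq_intros)
  qed
  have l\<theta>: "lip_on {0..c} \<theta>" if "c < T" for c
  proof (rule lip_on_C1_interior)
    show "(\<theta> has_real_derivative - \<kappa> t * \<theta> t) (at t)" if "t \<in> {0<..<c}" for t
      using that \<open>c < T\<close> by (intro d\<theta>) auto
  qed (intro continuous_intros c\<theta> c\<kappa> that)+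
  obtain N where N: "negligible N"
    and dw: "\<And>t. t \<in> {0<..<T} - N \<Longrightarrow> (w has_real_derivative - p t / w t + b t $ 1) (at t)"
    and b1: "\<And>t. t \<in> {0<..<T} - N \<Longrightarrow> \<bar>b t $ 1\<bar> \<le> K"
    using traj_ode[OF tr] by metis
  \<comment> \<open>\<open>m\<close> is \<open>\<theta> / \<bar>w\<bar>\<close>. Its logarithmic derivative is at
    most \<open>K / sqrt (T - t)\<close> in absolute value, so the products of \<open>m\<close> with
    \<open>exp E\<close> and with \<open>exp (- E)\<close> are monotone.\<close>
  define m where "m t = \<theta> t / (\<sigma> * w t)" for t
  define E where "E t = 2 * K * sqrt (T - t)" for t
  have \<sigma>w: "0 < \<sigma> * w t" if "t \<in> {0..<T}" for t using absw[OF that] ne[OF that] by (metis zero_less_abs_iff)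
  have mpos: "0 < m t" if "t \<in> {0..<T}" for t using \<sigma>w[OF that] \<theta>pos by (simp add: m_def)
  have dE: "(E has_real_derivative - (K / sqrt (T - t))) (at t)" if "t < T" for t
    unfolding E_def using that by (auto intro!: derivative_eq_intros simp: field_simps)
  have lm: "lip_on {0..c} m" if "c < T" for c
    unfolding m_def by (intro lip_on_divide lip_on_cmult lips l\<theta> that) (use \<sigma>w that in force)+
  have lE: "lip_on {0..c} (\<lambda>t. exp (k * E t))" if "c < T" for c k
  proof (rule lip_on_C1)
    show "((\<lambda>t. exp (k * E t)) has_real_derivative exp (k * E t) * (k * - (K / sqrt (T - t)))) (at t within {0..c})"
      if "t \<in> {0..c}" for t
    proof -
      have "((\<lambda>t. exp (k * E t)) has_real_derivative exp (k * E t) * (k * - (K / sqrt (T - t)))) (at t)"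
        using that \<open>c < T\<close> by (auto intro!: derivative_eq_intros dE)
      then show ?thesis by (rule has_field_derivative_at_within)
    qed
    show "continuous_on {0..c} (\<lambda>t. exp (k * E t) * (k * - (K / sqrt (T - t))))"
      unfolding E_def using that by (intro continuous_intros) auto
  qed
  have dm: "(m has_real_derivative m t * (- (b t $ 1) / w t)) (at t)" if t: "t \<in> {0<..<T} - N" for t
  proof -
    have t': "t \<in> {0<..<T}" "t \<in> {0..<T}" using t by auto
    have nz: "\<sigma> \<noteq> 0" "w t \<noteq> 0" using \<sigma> ne t' by auto
    have "(m has_real_derivative ((- \<kappa> t * \<theta> t) * (\<sigma> * w t) - \<theta> t * (\<sigma> * (- p t / w t + b t $ 1))) / ((\<sigma> * w t) * (\<sigma> * w t))) (at t)"
      unfolding m_def[abs_def] using nz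
      by (intro DERIV_divide d\<theta> t' DERIV_cmult dw t) auto
    also have "((- \<kappa> t * \<theta> t) * (\<sigma> * w t) - \<theta> t * (\<sigma> * (- p t / w t + b t $ 1))) / ((\<sigma> * w t) * (\<sigma> * w t))
        = m t * (- (b t $ 1) / w t)"
      using nz unfolding m_def \<kappa>_def by (simp add: field_simps power2_eq_square)
    finally show ?thesis .
  qed
  have b1w: "\<bar>b t $ 1 / w t\<bar> \<le> K / sqrt (T - t)" if t: "t \<in> {0<..<T} - N" for t
  proof -
    have t': "t \<in> {0..<T}" using t by auto
    have "sqrt (T - t) \<le> \<bar>w t\<bar>" using real_sqrt_le_mono[OF traj_square_ge[OF tr t']] by simp
    moreover have "0 < sqrt (T - t)" using t by simp
    ultimately show ?thesis using b1[OF t] by (simp add: abs_divide) (intro frac_le; simp)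
  qed
  have deriv: "((\<lambda>t. m t * exp (k * E t)) has_real_derivative
      m t * exp (k * E t) * (- (b t $ 1) / w t - k * (K / sqrt (T - t)))) (at t)" if t: "t \<in> {0<..<T} - N" for t k
    using t by (auto intro!: derivative_eq_intros dm dE simp: algebra_simps)
  have m_up: "m t \<le> m 0 * exp (E 0)" and m_low: "m 0 * exp (- E 0) \<le> m t" if t: "t \<in> {0..<T}" for t
  proof -
    have tt: "0 \<le> t" "t < T" using t by auto
    let ?e1 = "\<lambda>r. - (b r $ 1) / w r - 1 * (K / sqrt (T - r))"
    let ?e2 = "\<lambda>r. - (b r $ 1) / w r - (-1) * (K / sqrt (T - r))"
    have "m t * exp (1 * E t) - m 0 * exp (1 * E 0) \<le> 0"
    proof (rule lip_on_growth_le[OF _ tt(1) N, where g="\<lambda>t. m t * exp (1 * E t)"])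
      show "lip_on {0..t} (\<lambda>t. m t * exp (1 * E t))" by (intro lip_on_mult lm lE tt) auto
      show "((\<lambda>r. 0) has_integral (0::real)) {0..t}" by simp
      fix r assume r: "r \<in> {0<..<t} - N"
      then have r': "r \<in> {0<..<T} - N" using t by auto
      have "?e1 r \<le> 0" using abs_le_D2[OF b1w[OF r']] by simp
      then have "m r * exp (1 * E r) * ?e1 r \<le> 0"
        using mpos[of r] r' by (intro mult_nonneg_nonpos) auto
      with deriv[OF r', of 1] show "((\<lambda>t. m t * exp (1 * E t)) has_real_derivative
          m r * exp (1 * E r) * ?e1 r) (at r) \<and>
          m r * exp (1 * E r) * ?e1 r \<le> 0" by blast
    qed
    moreover have "0 \<le> E t" using K_pos tt by (simp add: E_def)
    then have "m t * 1 \<le> m t * exp (1 * E t)" using mpos[OF t] by (intro mult_left_mono) auto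
    ultimately show "m t \<le> m 0 * exp (E 0)" by simp
    have "- (m t * exp (-1 * E t)) - (- (m 0 * exp (-1 * E 0))) \<le> 0"
    proof (rule lip_on_growth_le[OF _ tt(1) N, where g="\<lambda>t. - (m t * exp (-1 * E t))"])
      have "lip_on {0..t} (\<lambda>t. - 1 * (m t * exp (-1 * E t)))" by (intro lip_on_cmult lip_on_mult lm lE tt) auto
      then show "lip_on {0..t} (\<lambda>t. - (m t * exp (-1 * E t)))" by simp
      show "((\<lambda>r. 0) has_integral (0::real)) {0..t}" by simp
      fix r assume r: "r \<in> {0<..<t} - N"
      then have r': "r \<in> {0<..<T} - N" using t by auto
      have "0 \<le> ?e2 r" using abs_le_D1[OF b1w[OF r']] by simp
      then have "0 \<le> m r * exp (-1 * E r) * ?e2 r"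
        using mpos[of r] r' by (intro mult_nonneg_nonneg) auto
      with DERIV_minus[OF deriv[OF r', of "-1"]] show "((\<lambda>t. - (m t * exp (-1 * E t))) has_real_derivative
          - (m r * exp (-1 * E r) * ?e2 r)) (at r) \<and>
          - (m r * exp (-1 * E r) * ?e2 r) \<le> 0" by simp
    qed
    moreover have "m t * exp (-1 * E t) \<le> m t * 1"
      using mpos[OF t] \<open>0 \<le> E t\<close> by (intro mult_left_mono) auto
    ultimately show "m 0 * exp (- E 0) \<le> m t" by simp
  qed
  define lo hi where "lo = m 0 * exp (- E 0)" and "hi = m 0 * exp (E 0)"
  have lohi: "0 < lo" "0 < hi" using mpos[of 0] T by (auto simp: lo_def hi_def)
  have \<theta>w: "\<theta> t \<le> hi * \<bar>w t\<bar>" "lo * \<bar>w t\<bar> \<le> \<theta> t" if "t \<in> {0..<T}" for t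
    using m_up[OF that] m_low[OF that] \<sigma>w[OF that] absw[OF that]
    by (auto simp: m_def lo_def hi_def pos_divide_le_eq pos_le_divide_eq)
  \<comment> \<open>The system for \<open>(\<phi>, \<psi>2)\<close> in reversed time
    \<open>s = T - t\<close>.\<close>
  define g1 g2 where "g1 s = 1 / \<theta> (T - s)" and "g2 s = \<theta> (T - s) / w (T - s)" for s
  define G :: "real \<Rightarrow> real \<times> real \<Rightarrow> real \<times> real" where
    "G s x = (g1 s * snd x, - g2 s * fst x + snd x)" for s x
  define a where "a s = 1 / lo * (1 / sqrt s) + (hi + 1)" for s
  define A where "A s = 2 / lo * sqrt s + (hi + 1) * s" for s
  have g: "\<bar>g1 s\<bar> \<le> 1 / lo * (1 / sqrt s)" "\<bar>g2 s\<bar> \<le> hi" if s: "s \<in> {0<..<T}" for s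
  proof -
    have t: "T - s \<in> {0..<T}" using s by auto
    have "sqrt s \<le> \<bar>w (T - s)\<bar>" using real_sqrt_le_mono[OF traj_square_ge[OF tr t]] by simp
    then have "lo * sqrt s \<le> \<theta> (T - s)"
      using \<theta>w(2)[OF t] mult_left_mono[of "sqrt s" "\<bar>w (T - s)\<bar>" lo] lohi by linarith
    moreover have "0 < lo * sqrt s" using lohi s by simp
    ultimately have "1 / \<theta> (T - s) \<le> 1 / (lo * sqrt s)" by (intro divide_left_mono) (auto simp: \<theta>pos)
    then show "\<bar>g1 s\<bar> \<le> 1 / lo * (1 / sqrt s)" using \<theta>pos[of "T - s"] by (simp add: g1_def)
    show "\<bar>g2 s\<bar> \<le> hi" using \<theta>w(1)[OF t] ne[OF t] \<theta>pos[of "T - s"]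
      by (simp add: g2_def abs_divide pos_divide_le_eq)
  qed
  have nf: "\<bar>fst z\<bar> \<le> norm z" "\<bar>snd z\<bar> \<le> norm z" for z :: "real \<times> real"
    using norm_fst_le[of "fst z" "snd z"] norm_snd_le[of "snd z" "fst z"] by auto
  have Gnorm: "norm (G s z) \<le> a s * norm z" if s: "s \<in> {0<..<T}" for s z
  proof -
    have "norm (G s z) \<le> \<bar>g1 s * snd z\<bar> + \<bar>- g2 s * fst z + snd z\<bar>"
      unfolding G_def using norm_Pair_le by (metis real_norm_def)
    also have "\<dots> \<le> \<bar>g1 s\<bar> * \<bar>snd z\<bar> + (\<bar>g2 s\<bar> * \<bar>fst z\<bar> + \<bar>snd z\<bar>)"
      using abs_triangle_ineq[of "- g2 s * fst z" "snd z"] by (simp add: abs_mult)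
    also have "\<dots> \<le> 1 / lo * (1 / sqrt s) * norm z + (hi * norm z + norm z)"
      using g[OF s] nf[of z] lohi s by (intro add_mono mult_mono) auto
    also have "\<dots> = a s * norm z" by (simp add: a_def algebra_simps)
    finally show ?thesis .
  qed
  have Glip: "norm (G s x - G s y) \<le> a s * norm (x - y)" if s: "s \<in> {0<..<T}" for s x y
  proof -
    have "G s x - G s y = G s (x - y)" by (simp add: G_def algebra_simps)
    then show ?thesis using Gnorm[OF s] by simp
  qed
  have dA: "(A has_real_derivative a s) (at s)" if "s \<in> {0<..<T}" for s
    unfolding A_def a_def using that lohi by (auto intro!: derivative_eq_intros simp: field_simps)
  have cA: "continuous_on {0..T} A" unfolding A_def by (intro continuous_intros)
  have aint: "(\<lambda>s. a s * D) integrable_on {0..T}" for D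
  proof -
    have "((\<lambda>s. a s * D) has_integral (A T * D - A 0 * D)) {0..T}"
    proof (rule fundamental_theorem_of_calculus_interior)
      show "continuous_on {0..T} (\<lambda>s. A s * D)" by (intro continuous_intros cA)
      show "((\<lambda>s. A s * D) has_vector_derivative a s * D) (at s)" if "s \<in> {0<..<T}" for s
        using DERIV_cmult_right[OF dA[OF that]] by (simp add: has_real_derivative_iff_has_vector_derivative)
    qed (use T in auto)
    then show ?thesis by blast
  qed
  have cmir: "continuous_on {0<..<T} (\<lambda>s. f (T - s))" if "\<And>c. c < T \<Longrightarrow> continuous_on {0..c} f" for f :: "real \<Rightarrow> real"
  proof -
    have "isCont f t" if t: "t \<in> {0<..<T}" for t
    proof -
      define m where "m = (t + T) / 2"
      have "t < m" "m < T" using t by (auto simp: m_def)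
      then show ?thesis using continuous_on_interior[OF \<open>\<And>c. c < T \<Longrightarrow> continuous_on {0..c} f\<close>, of m t] t
        by (auto simp: interior_atLeastAtMost_real)
    qed
    then have "continuous_on {0<..<T} f" by (simp add: continuous_on_eq_continuous_at)
    moreover have "continuous_on {0<..<T} (\<lambda>s. T - s)" by (intro continuous_intros)
    moreover have "(\<lambda>s. T - s) ` {0<..<T} \<subseteq> {0<..<T}" by auto
    ultimately show ?thesis by (rule continuous_on_compose2)
  qed
  have Gcont: "continuous_on {0<..<T} (\<lambda>s. G s (x s))" if x: "continuous_on {0..T} x" for x
  proof -
    have "continuous_on {0<..<T} x" using x by (rule continuous_on_subset) auto
    then show ?thesis unfolding G_def g1_def g2_def
      using \<theta>pos ne by (intro continuous_intros cmir c\<theta> cont) (auto simp: less_imp_neq[symmetric])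
  qed
  have Gint: "(\<lambda>s. G s (x s)) integrable_on {0..T}" if x: "continuous_on {0..T} x" for x
  proof -
    have "bounded (x ` {0..T})" using x by (intro compact_imp_bounded compact_continuous_image) auto
    then obtain D where D: "D > 0" "\<And>s. s \<in> {0..T} \<Longrightarrow> norm (x s) \<le> D" unfolding bounded_pos by auto
    have "(\<lambda>s. G s (x s)) integrable_on {0<..<T}"
    proof (rule measurable_bounded_by_integrable_imp_integrable)
      show "(\<lambda>s. G s (x s)) \<in> borel_measurable (lebesgue_on {0<..<T})"
        using Gcont[OF x] by (intro continuous_imp_measurable_on_sets_lebesgue) auto
      show "(\<lambda>s. a s * D) integrable_on {0<..<T}" using aint by (simp only: integrable_on_Icc_iff_Ioo)
      fix s assume s: "s \<in> {0<..<T}"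
      have "0 \<le> a s" using lohi s by (simp add: a_def)
      then show "norm (G s (x s)) \<le> a s * D"
        using Gnorm[OF s, of "x s"] D(2)[of s] s mult_left_mono[of "norm (x s)" D "a s"] by simp
    qed simp
    then show ?thesis by (simp only: integrable_on_Icc_iff_Ioo)
  qed
  obtain X where X: "continuous_on {0..T} X"
      "\<And>s. s \<in> {0..T} \<Longrightarrow> X s = (- \<sigma>, 0) + integral {0..s} (\<lambda>s. G s (X s))"
    by (rule integral_equation_has_solution[of T A a G "(- \<sigma>, 0)"]) (use T cA dA Gint Glip in auto)
  have dX: "(X has_vector_derivative G s (X s)) (at s)" if s: "s \<in> {0<..<T}" for s
  proof -
    have "isCont (\<lambda>s. G s (X s)) s"
      using Gcont[OF X(1)] s by (simp add: continuous_on_eq_continuous_at)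
    then have "((\<lambda>u. integral {0..u} (\<lambda>s. G s (X s))) has_vector_derivative G s (X s)) (at s within {0..T} - {})"
      using s by (intro integral_has_vector_derivative_continuous_at Gint X) (auto intro: continuous_at_imp_continuous_at_within)
    then have "((\<lambda>u. integral {0..u} (\<lambda>s. G s (X s))) has_vector_derivative G s (X s)) (at s)"
      using at_within_interior[of s "{0..T}"] s by (auto simp: interior_atLeastAtMost_real)
    then have "((\<lambda>u. (- \<sigma>, 0) + integral {0..u} (\<lambda>s. G s (X s))) has_vector_derivative 0 + G s (X s)) (at s)"
      by (intro has_vector_derivative_add has_vector_derivative_const)
    then show ?thesis using s X(2)
      by (intro has_vector_derivative_transform_within_open[of "\<lambda>u. (- \<sigma>, 0) + integral {0..u} (\<lambda>s. G s (X s))" _ s "{0<..<T}" X]) auto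
  qed
  define \<phi> \<psi>2 where "\<phi> t = fst (X (T - t))" and "\<psi>2 t = snd (X (T - t))" for t
  have cX: "continuous_on {0..T} (\<lambda>t. X (T - t))"
  proof -
    have "continuous_on {0..T} (\<lambda>t. T - t)" by (intro continuous_intros)
    moreover have "(\<lambda>t. T - t) ` {0..T} \<subseteq> {0..T}" by auto
    ultimately show ?thesis by (rule continuous_on_compose2[OF X(1)])
  qed
  have c\<phi>: "continuous_on {0..T} \<phi>" "continuous_on {0..T} \<psi>2"
    unfolding \<phi>_def \<psi>2_def by (intro continuous_intros cX)+
  have d\<phi>: "(\<phi> has_real_derivative - (\<psi>2 t / \<theta> t)) (at t)"
    and d\<psi>2: "(\<psi>2 has_real_derivative \<theta> t / w t * \<phi> t - \<psi>2 t) (at t)" if t: "t \<in> {0<..<T}" for t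
  proof -
    have s: "T - t \<in> {0<..<T}" using t by auto
    have dT: "((\<lambda>t. T - t) has_real_derivative -1) (at t)" by (auto intro!: derivative_eq_intros)
    have "((\<lambda>s. fst (X s)) has_real_derivative fst (G (T - t) (X (T - t)))) (at (T - t))"
      using bounded_linear.has_vector_derivative[OF bounded_linear_fst dX[OF s]]
      by (simp add: has_real_derivative_iff_has_vector_derivative)
    from DERIV_chain2[where f="\<lambda>s. fst (X s)" and g="\<lambda>t. T - t" and x=t and Db="-1" and s=UNIV, OF this dT]
    have "((\<lambda>t. fst (X (T - t))) has_real_derivative fst (G (T - t) (X (T - t))) * -1) (at t)" .
    then
    show "(\<phi> has_real_derivative - (\<psi>2 t / \<theta> t)) (at t)"
      unfolding \<phi>_def[abs_def] \<psi>2_def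
      by (simp add: G_def g1_def)
    have "((\<lambda>s. snd (X s)) has_real_derivative snd (G (T - t) (X (T - t)))) (at (T - t))"
      using bounded_linear.has_vector_derivative[OF bounded_linear_snd dX[OF s]]
      by (simp add: has_real_derivative_iff_has_vector_derivative)
    from DERIV_chain2[where f="\<lambda>s. snd (X s)" and g="\<lambda>t. T - t" and x=t and Db="-1" and s=UNIV, OF this dT]
    have "((\<lambda>t. snd (X (T - t))) has_real_derivative snd (G (T - t) (X (T - t))) * -1) (at t)" .
    then
    show "(\<psi>2 has_real_derivative \<theta> t / w t * \<phi> t - \<psi>2 t) (at t)"
      unfolding \<phi>_def \<psi>2_def[abs_def]
      by (simp add: G_def g2_def)
  qed
  have "bounded (\<phi> ` {0..T})" using c\<phi> by (intro compact_imp_bounded compact_continuous_image) auto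
  then obtain D where D: "D > 0" "\<And>t. t \<in> {0..T} \<Longrightarrow> \<bar>\<phi> t\<bar> \<le> D" unfolding bounded_pos by auto
  define \<psi>1 where "\<psi>1 t = (if t < T then \<theta> t * \<phi> t else 0)" for t
  have bd\<psi>1: "\<bar>\<psi>1 t\<bar> \<le> (hi * D) * \<bar>w t\<bar>" if t: "t \<in> {0..<T}" for t
  proof -
    have "\<bar>\<psi>1 t\<bar> = \<theta> t * \<bar>\<phi> t\<bar>" using t \<theta>pos[of t] by (simp add: \<psi>1_def abs_mult)
    also have "\<dots> \<le> (hi * \<bar>w t\<bar>) * D"
      using \<theta>w(1)[OF t] D(2)[of t] t lohi by (intro mult_mono) auto
    finally show ?thesis by (simp add: mult_ac)
  qed
  have c\<psi>1: "continuous_on {0..T} \<psi>1"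
  proof (rule continuous_on_vanishing_at_end)
    fix c assume c: "c < T"
    have "continuous_on {0..c} (\<lambda>t. \<theta> t * \<phi> t)"
      by (intro continuous_intros c\<theta> c continuous_on_subset[OF c\<phi>(1)]) (use c in auto)
    then show "continuous_on {0..c} \<psi>1"
      by (rule continuous_on_eq) (use c in \<open>auto simp: \<psi>1_def\<close>)
  next
    show "\<psi>1 T = 0" by (simp add: \<psi>1_def)
    fix e :: real assume e: "e > 0"
    define \<epsilon> where "\<epsilon> = e / (hi * D)"
    have \<epsilon>: "\<epsilon> > 0" using e D lohi by (simp add: \<epsilon>_def)
    then obtain t0 where t0: "t0 \<in> {0..<T}" "\<forall>t\<in>{t0..<T}. (w t)\<^sup>2 < \<epsilon>\<^sup>2"
      using vanishing_eventually[OF tr van, of "\<epsilon>\<^sup>2"] by auto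
    have "\<bar>\<psi>1 t\<bar> < e" if t: "t \<in> {t0..<T}" for t
    proof -
      have "\<bar>w t\<bar> < \<epsilon>" using t0(2) t \<epsilon> by (metis abs_of_pos power2_abs power2_less_imp_less less_imp_le)
      then have "(hi * D) * \<bar>w t\<bar> < (hi * D) * \<epsilon>" using D lohi by simp
      also have "\<dots> = e" using D lohi by (simp add: \<epsilon>_def)
      finally show ?thesis using bd\<psi>1[of t] t t0(1) by simp
    qed
    then show "\<exists>t0<T. \<forall>t\<in>{t0..<T}. \<bar>\<psi>1 t\<bar> < e" using t0(1) by (intro exI[of _ t0]) auto
  qed
  have d\<psi>1: "(\<psi>1 has_real_derivative - (p t / (w t)\<^sup>2) * \<psi>1 t - \<psi>2 t) (at t)" if t: "t \<in> {0<..<T}" for t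
  proof -
    have "((\<lambda>t. \<theta> t * \<phi> t) has_real_derivative (- \<kappa> t * \<theta> t) * \<phi> t + (- (\<psi>2 t / \<theta> t)) * \<theta> t) (at t)"
      by (rule DERIV_mult[OF d\<theta>[OF t] d\<phi>[OF t]])
    also have "(- \<kappa> t * \<theta> t) * \<phi> t + (- (\<psi>2 t / \<theta> t)) * \<theta> t = - (p t / (w t)\<^sup>2) * \<psi>1 t - \<psi>2 t"
      using t \<theta>pos[of t] by (simp add: \<psi>1_def \<kappa>_def)
    finally show ?thesis
      by (rule has_field_derivative_transform_within_open[of _ _ _ "{0<..<T}"]) (use t in \<open>auto simp: \<psi>1_def\<close>)
  qed
  have X0: "X 0 = (- \<sigma>, 0)" using X(2)[of 0] T by simp
  obtain \<eta> where \<eta>: "\<eta> > 0" "\<And>t. t \<in> {0..T} \<Longrightarrow> dist t T < \<eta> \<Longrightarrow> dist (\<phi> t) (\<phi> T) < 1"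
    using c\<phi>(1)[unfolded continuous_on_iff, rule_format, of T 1] T by auto
  define t0 where "t0 = max 0 (T - \<eta> / 2)"
  have t0: "t0 \<in> {0..<T}" using T \<eta> by (auto simp: t0_def)
  have neg: "\<psi>1 t * w t < 0" if t: "t \<in> {t0..<T}" for t
  proof -
    have t': "t \<in> {0..<T}" "dist t T < \<eta>" using t t0 \<eta>(1) by (auto simp: t0_def dist_real_def)
    then have "\<bar>\<phi> t + \<sigma>\<bar> < 1" using \<eta>(2)[of t] X0 by (simp add: \<phi>_def dist_real_def)
    then have "\<phi> t * \<sigma> < 0" using \<sigma> by (cases "\<sigma> = 1") (auto simp: abs_if split: if_splits)
    moreover have "w t = \<sigma> * \<bar>w t\<bar>" using absw[OF t'(1)] \<sigma>(2) by (metis mult.assoc mult_1)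
    ultimately have "\<phi> t * w t < 0" using ne[OF t'(1)] by (metis mult.assoc mult_neg_pos zero_less_abs_iff)
    then show ?thesis using t' \<theta>pos[of t] by (simp add: \<psi>1_def mult.assoc mult_pos_neg)
  qed
  show thesis
  proof (rule that[of \<psi>1 \<psi>2 "hi * D" t0, OF c\<psi>1 c\<phi>(2) _ _ d\<psi>1 _ _ bd\<psi>1 t0 neg])
    show "\<psi>1 T = 0" by (simp add: \<psi>1_def)
    show "\<psi>2 T = 0" using X0 by (simp add: \<psi>2_def)
    show "0 \<le> hi * D" using lohi D by simp
    show "(\<psi>2 has_real_derivative \<psi>1 t / w t - \<psi>2 t) (at t)" if "t \<in> {0<..<T}" for t
      using d\<psi>2[OF that] that by (simp add: \<psi>1_def)
  qed
qed

end

section \<open>First variation\<close>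

context quenching_start
begin

text \<open>The function \<open>h\<close> is a direction of variation of the forcing. The last hypothesis is where optimality enters: the
perturbed trajectories exist at least until \<open>T\<close>, so their \<open>w\<^sup>2\<close> is nonnegative up to \<open>T\<close>, and the first variation of
\<open>w\<^sup>2\<close> at \<open>T\<close> cannot be negative. The signs of \<open>\<psi>\<^sub>1\<close> and \<open>w\<close> near \<open>T\<close> turn this into an upper bound for the pairing
\<open>J\<close>, which up to higher order in \<open>\<epsilon>\<close> is \<open>\<epsilon>\<close> times the integral.\<close>

lemma variation_inequality:
  assumes tr: "traj b T w p" and van: "vanishing T w"
    and \<psi>: "continuous_on {0..T} \<psi>1" "continuous_on {0..T} \<psi>2" "\<psi>2 T = 0"
    and d\<psi>1: "\<And>t. t \<in> {0<..<T} \<Longrightarrow> (\<psi>1 has_real_derivative - (p t / (w t)\<^sup>2) * \<psi>1 t - \<psi>2 t) (at t)"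
    and d\<psi>2: "\<And>t. t \<in> {0<..<T} \<Longrightarrow> (\<psi>2 has_real_derivative \<psi>1 t / w t - \<psi>2 t) (at t)"
    and C: "0 \<le> C" "\<And>t. t \<in> {0..<T} \<Longrightarrow> \<bar>\<psi>1 t\<bar> \<le> C * \<bar>w t\<bar>"
    and t0: "t0 \<in> {0..<T}" "\<And>t. t \<in> {t0..<T} \<Longrightarrow> \<psi>1 t * w t < 0"
    and Mh: "negligible Mh" "\<And>t. t \<in> {0..<T} - Mh \<Longrightarrow> norm (h t) \<le> 2 * K"
    and hint: "(\<lambda>t. \<psi>1 t * h t $ 1 + \<psi>2 t * h t $ 2) integrable_on {0..T}"
    and pert: "\<And>\<epsilon>. 0 < \<epsilon> \<Longrightarrow> \<epsilon> < 1 \<Longrightarrow> \<exists>w' p'. traj (\<lambda>t. b t + \<epsilon> *\<^sub>R h t) T w' p'"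
  shows "integral {0..T} (\<lambda>t. \<psi>1 t * h t $ 1 + \<psi>2 t * h t $ 2) \<le> 0"
proof -
  define F where "F t = \<psi>1 t * h t $ 1 + \<psi>2 t * h t $ 2" for t
  have T: "0 < T" by (rule trajD(3)[OF tr])
  have Fint: "F integrable_on {0..T}" using hint by (simp add: F_def[abs_def])
  have "bounded (\<psi>2 ` {0..T})" using \<psi>(2) by (intro compact_imp_bounded compact_continuous_image) auto
  then obtain D where D: "D > 0" "\<And>t. t \<in> {0..T} \<Longrightarrow> \<bar>\<psi>2 t\<bar> \<le> D" unfolding bounded_pos by auto
  define H where "H = sqrt (stability_const T) * (2 * K)"
  have stab: "0 \<le> stability_const T" using T by (simp add: stability_const_def)
  have H0: "0 \<le> H" using stab K_pos by (simp add: H_def)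
  define c2 c3 where "c2 = C * (2 * K) * H" and "c3 = (K * C + D) * H"
  have c23: "0 \<le> c2" "0 \<le> c3" using C(1) K_pos H0 D(1) by (auto simp: c2_def c3_def)
  \<comment> \<open>\<open>Err \<epsilon>\<close> bounds the integral of the remainder over \<open>[0, T]\<close>,
    divided by \<open>\<epsilon>\<close>; it tends to \<open>0\<close> with \<open>\<epsilon>\<close>.\<close>
  define Err where "Err \<epsilon> = 2 * c2 * \<epsilon> * sqrt T + 4 * c3 * sqrt (sqrt (H * \<epsilon>)) * sqrt (sqrt T)" for \<epsilon>
  have main: "integral {0..T} F \<le> Err \<epsilon>" if \<epsilon>: "0 < \<epsilon>" "\<epsilon> < 1" for \<epsilon>
  proof -
    obtain w' p' where tr': "traj (\<lambda>t. b t + \<epsilon> *\<^sub>R h t) T w' p'" using pert[OF \<epsilon>] by blast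
    obtain N1 where N1: "negligible N1"
      and dw: "\<And>t. t \<in> {0<..<T} - N1 \<Longrightarrow> (w has_real_derivative - p t / w t + b t $ 1) (at t)"
      and dp: "\<And>t. t \<in> {0<..<T} - N1 \<Longrightarrow> (p has_real_derivative 1 + w t + p t + b t $ 2) (at t)"
      and b1: "\<And>t. t \<in> {0<..<T} - N1 \<Longrightarrow> \<bar>b t $ 1\<bar> \<le> K"
      using traj_ode[OF tr] by metis
    obtain N2 where N2: "negligible N2"
      and dw': "\<And>t. t \<in> {0<..<T} - N2 \<Longrightarrow> (w' has_real_derivative - p' t / w' t + (b t + \<epsilon> *\<^sub>R h t) $ 1) (at t)"
      and dp': "\<And>t. t \<in> {0<..<T} - N2 \<Longrightarrow> (p' has_real_derivative 1 + w' t + p' t + (b t + \<epsilon> *\<^sub>R h t) $ 2) (at t)"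
      using traj_ode[OF tr'] by metis
    define N where "N = N1 \<union> N2 \<union> Mh"
    have N: "negligible N" using N1 N2 Mh by (simp add: N_def)
    define d e where "d t = (w' t)\<^sup>2 - (w t)\<^sup>2" and "e t = p' t - p t" for t
    have de: "\<bar>d t\<bar> \<le> H * \<epsilon>" "\<bar>e t\<bar> \<le> H * \<epsilon>" if t: "t \<in> {0..<T}" for t
    proof -
      have "(d t)\<^sup>2 + (e t)\<^sup>2 \<le> stability_const T * (2 * K * \<epsilon>)\<^sup>2"
        unfolding d_def e_def
      proof (rule traj_comparison[OF tr tr' Mh(1) _ t])
        fix s assume s: "s \<in> {0..<T} - Mh"
        show "norm (b s + \<epsilon> *\<^sub>R h s - b s) \<le> 2 * K * \<epsilon>"
          using Mh(2)[OF s] \<epsilon> by (simp add: mult.commute mult_left_mono)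
      qed
      also have "\<dots> = (H * \<epsilon>)\<^sup>2" using stab by (simp add: H_def power_mult_distrib)
      finally have *: "(d t)\<^sup>2 + (e t)\<^sup>2 \<le> (H * \<epsilon>)\<^sup>2" .
      have "(d t)\<^sup>2 \<le> (H * \<epsilon>)\<^sup>2" using * zero_le_power2[of "e t"] by linarith
      then show "\<bar>d t\<bar> \<le> H * \<epsilon>" using H0 \<epsilon> by (metis abs_le_square_iff abs_of_nonneg less_imp_le mult_nonneg_nonneg)
      have "(e t)\<^sup>2 \<le> (H * \<epsilon>)\<^sup>2" using * zero_le_power2[of "d t"] by linarith
      then show "\<bar>e t\<bar> \<le> H * \<epsilon>" using H0 \<epsilon> by (metis abs_le_square_iff abs_of_nonneg less_imp_le mult_nonneg_nonneg)
    qed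
    define J where "J t = \<psi>1 t * d t / (2 * w t) + \<psi>2 t * e t" for t
    \<comment> \<open>\<open>bd\<close> bounds the remainder in the derivative of \<open>J\<close>, and
      \<open>Bd\<close> is its primitive.\<close>
    define bd where "bd t = \<epsilon> * (c2 * \<epsilon> * (1 / sqrt (T - t)) + c3 * sqrt (sqrt (H * \<epsilon>)) * (1 / (sqrt (T - t) * sqrt (sqrt (T - t)))))" for t
    define Bd where "Bd t = - \<epsilon> * (2 * c2 * \<epsilon> * sqrt (T - t) + 4 * c3 * sqrt (sqrt (H * \<epsilon>)) * sqrt (sqrt (T - t)))" for t
    have J_le: "- J t \<le> - \<epsilon> * integral {0..t} F + \<epsilon> * Err \<epsilon>" if t: "t \<in> {0..<T}" for t
    proof -
      have tT: "0 \<le> t" "t < T" using t by auto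
      have lips: "lip_on {0..t} w" "lip_on {0..t} p" "lip_on {0..t} w'" "lip_on {0..t} p'"
        using trajD(6,7)[OF tr tT(2)] trajD(6,7)[OF tr' tT(2)] by auto
      have ne: "w s \<noteq> 0" if "s \<in> {0..t}" for s using trajD(5)[OF tr, of s] that tT by auto
      have c: "continuous_on {0..t} \<psi>1" "continuous_on {0..t} \<psi>2"
        using \<psi>(1,2) tT by (auto elim!: continuous_on_subset)
      have l\<psi>1: "lip_on {0..t} \<psi>1"
      proof (rule lip_on_C1_interior[OF c(1)])
        show "(\<psi>1 has_real_derivative - (p s / (w s)\<^sup>2) * \<psi>1 s - \<psi>2 s) (at s)" if "s \<in> {0<..<t}" for s
          using that tT by (intro d\<psi>1) auto
        show "continuous_on {0..t} (\<lambda>s. - (p s / (w s)\<^sup>2) * \<psi>1 s - \<psi>2 s)"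
          using ne by (intro continuous_intros c lip_on_imp_continuous_on lips) auto
      qed
      have l\<psi>2: "lip_on {0..t} \<psi>2"
      proof (rule lip_on_C1_interior[OF c(2)])
        show "(\<psi>2 has_real_derivative \<psi>1 s / w s - \<psi>2 s) (at s)" if "s \<in> {0<..<t}" for s
          using that tT by (intro d\<psi>2) auto
        show "continuous_on {0..t} (\<lambda>s. \<psi>1 s / w s - \<psi>2 s)"
          using ne by (intro continuous_intros c lip_on_imp_continuous_on lips) auto
      qed
      have lJ: "lip_on {0..t} (\<lambda>s. - J s)"
      proof -
        have "lip_on {0..t} (\<lambda>s. -1 * J s)"
          unfolding J_def d_def e_def power2_eq_square
          by (intro lip_on_cmult lip_on_add lip_on_mult lip_on_divide lip_on_diff lips l\<psi>1 l\<psi>2) (use ne in auto)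
        then show ?thesis by simp
      qed
      have bdint: "(bd has_integral Bd t - Bd 0) {0..t}"
      proof (rule fundamental_theorem_of_calculus_interior)
        show "continuous_on {0..t} Bd" unfolding Bd_def by (intro continuous_intros)
        fix s assume s: "s \<in> {0<..<t}"
        then have "0 < sqrt (T - s)" using tT by simp
        then have 1: "((\<lambda>s. sqrt (sqrt (T - s))) has_real_derivative - (1 / (4 * (sqrt (T - s) * sqrt (sqrt (T - s)))))) (at s)"
          using s tT by (auto intro!: derivative_eq_intros simp: field_simps)
        have 2: "((\<lambda>s. sqrt (T - s)) has_real_derivative - (1 / (2 * sqrt (T - s)))) (at s)"
          using s tT by (auto intro!: derivative_eq_intros simp: field_simps)
        have "(Bd has_real_derivative - \<epsilon> * (2 * c2 * \<epsilon> * - (1 / (2 * sqrt (T - s)))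
            + 4 * c3 * sqrt (sqrt (H * \<epsilon>)) * - (1 / (4 * (sqrt (T - s) * sqrt (sqrt (T - s))))))) (at s)"
          unfolding Bd_def[abs_def] by (intro DERIV_cmult DERIV_add 1 2)
        then have "(Bd has_real_derivative bd s) (at s)" by (simp add: bd_def algebra_simps)
        then show "(Bd has_vector_derivative bd s) (at s)" by (simp add: has_real_derivative_iff_has_vector_derivative)
      qed (rule tT)
      have Fi: "(F has_integral integral {0..t} F) {0..t}"
        using integrable_subinterval_real[OF Fint, of 0 t] tT by (auto simp: integrable_integral)
      have "- J t - (- J 0) \<le> - \<epsilon> * integral {0..t} F + (Bd t - Bd 0)"
      proof (rule lip_on_growth_le[OF lJ tT(1) N])
        show "((\<lambda>s. - \<epsilon> * F s + bd s) has_integral - \<epsilon> * integral {0..t} F + (Bd t - Bd 0)) {0..t}"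
          by (intro has_integral_add has_integral_mult_right Fi bdint)
        fix s assume s: "s \<in> {0<..<t} - N"
        have sT: "s \<in> {0<..<T} - N1" "s \<in> {0<..<T} - N2" "s \<in> {0..<T} - Mh" "s \<in> {0<..<T}" "s \<in> {0..<T}" "s \<in> {0..T}"
          using s tT by (auto simp: N_def)
        have nz: "w s \<noteq> 0" "w' s \<noteq> 0" using trajD(5)[OF tr sT(5)] trajD(5)[OF tr' sT(5)] .
        define \<delta>1 \<delta>2 where "\<delta>1 = \<epsilon> * h s $ 1" and "\<delta>2 = \<epsilon> * h s $ 2"
        define \<psi>1' \<psi>2' d' e' w1 where "\<psi>1' = - (p s / (w s)\<^sup>2) * \<psi>1 s - \<psi>2 s" and "\<psi>2' = \<psi>1 s / w s - \<psi>2 s"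
          and "d' = 2 * w' s * (- p' s / w' s + (b s $ 1 + \<delta>1)) - 2 * w s * (- p s / w s + b s $ 1)"
          and "e' = (1 + w' s + p' s + (b s $ 2 + \<delta>2)) - (1 + w s + p s + b s $ 2)"
          and "w1 = - p s / w s + b s $ 1"
        have 1: "(\<psi>1 has_real_derivative \<psi>1') (at s)" unfolding \<psi>1'_def by (rule d\<psi>1[OF sT(4)])
        have 2: "(\<psi>2 has_real_derivative \<psi>2') (at s)" unfolding \<psi>2'_def by (rule d\<psi>2[OF sT(4)])
        have 3: "(d has_real_derivative d') (at s)"
          using dw[OF sT(1)] dw'[OF sT(2)] unfolding d_def[abs_def] d'_def \<delta>1_def
          by (auto intro!: derivative_eq_intros)
        have 4: "(e has_real_derivative e') (at s)"
          using dp[OF sT(1)] dp'[OF sT(2)] unfolding e_def[abs_def] e'_def \<delta>2_def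
          by (auto intro!: derivative_eq_intros)
        have 5: "(w has_real_derivative w1) (at s)" unfolding w1_def by (rule dw[OF sT(1)])
        have "(J has_real_derivative
            ((\<psi>1' * d s + d' * \<psi>1 s) * (2 * w s) - \<psi>1 s * d s * (2 * w1)) / ((2 * w s) * (2 * w s))
              + (\<psi>2' * e s + e' * \<psi>2 s)) (at s)"
          unfolding J_def[abs_def]
          by (intro DERIV_add DERIV_divide DERIV_mult DERIV_cmult 1 2 3 4 5) (use nz in auto)
        also have "((\<psi>1' * d s + d' * \<psi>1 s) * (2 * w s) - \<psi>1 s * d s * (2 * w1)) / ((2 * w s) * (2 * w s))
              + (\<psi>2' * e s + e' * \<psi>2 s)
            = ((\<psi>1' * d s + \<psi>1 s * d') * (2 * w s) - \<psi>1 s * d s * (2 * w1)) / (2 * w s)\<^sup>2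
              + (\<psi>2' * e s + \<psi>2 s * e')" by (simp add: power2_eq_square mult.commute)
        also have "\<dots> = (\<psi>1 s * \<delta>1 + \<psi>2 s * \<delta>2) + \<psi>1 s / w s * (w' s - w s) * \<delta>1
             - (b s $ 1 * (\<psi>1 s / w s) + \<psi>2 s) * (w' s - w s)\<^sup>2 / (2 * w s)"
          unfolding \<psi>1'_def \<psi>2'_def d'_def e'_def w1_def d_def e_def
          by (rule pairing_derivative_identity[OF nz])
        also have "\<psi>1 s * \<delta>1 + \<psi>2 s * \<delta>2 = \<epsilon> * F s" by (simp add: F_def \<delta>1_def \<delta>2_def algebra_simps)
        finally have dJ: "(J has_real_derivative \<epsilon> * F s + \<psi>1 s / w s * (w' s - w s) * \<delta>1
             - (b s $ 1 * (\<psi>1 s / w s) + \<psi>2 s) * (w' s - w s)\<^sup>2 / (2 * w s)) (at s)" .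
        let ?dJ = "\<epsilon> * F s + \<psi>1 s / w s * (w' s - w s) * \<delta>1
             - (b s $ 1 * (\<psi>1 s / w s) + \<psi>2 s) * (w' s - w s)\<^sup>2 / (2 * w s)"
        define \<tau> a u where "\<tau> = T - s" and "a = H * \<epsilon>" and "u = (w' s - w s)\<^sup>2"
        have \<tau>: "0 < \<tau>" using sT by (simp add: \<tau>_def)
        have a0: "0 \<le> a" using H0 \<epsilon> by (simp add: a_def)
        have w\<tau>: "sqrt \<tau> \<le> \<bar>w s\<bar>"
          using real_sqrt_le_mono[OF traj_square_ge[OF tr sT(5)]] by (simp add: \<tau>_def)
        have s\<tau>: "0 < sqrt \<tau>" using \<tau> by simp
        have dprod: "\<bar>d s\<bar> = \<bar>w' s - w s\<bar> * \<bar>w' s + w s\<bar>"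
          by (simp add: d_def abs_mult[symmetric] power2_eq_square algebra_simps)
        have sg: "sgn (w' s) = sgn (w s)" using traj_sign[OF tr sT(5)] traj_sign[OF tr' sT(5)] by simp
        have sums: "\<bar>w s\<bar> \<le> \<bar>w' s + w s\<bar>" "\<bar>w' s - w s\<bar> \<le> \<bar>w' s + w s\<bar>"
          using sg by (auto simp: sgn_if split: if_splits)
        have cle: "\<bar>w' s - w s\<bar> \<le> a / sqrt \<tau>"
        proof -
          have "\<bar>w' s - w s\<bar> * sqrt \<tau> \<le> \<bar>w' s - w s\<bar> * \<bar>w' s + w s\<bar>"
            using w\<tau> sums(1) by (intro mult_left_mono) auto
          also have "\<dots> \<le> a" using de(1)[OF sT(5)] dprod by (simp add: a_def)
          finally show ?thesis using s\<tau> by (simp add: pos_le_divide_eq)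
        qed
        have ua: "u \<le> a"
        proof -
          have "u = \<bar>w' s - w s\<bar> * \<bar>w' s - w s\<bar>" by (simp add: u_def power2_eq_square abs_mult_self_eq)
          also have "\<dots> \<le> \<bar>w' s - w s\<bar> * \<bar>w' s + w s\<bar>" using sums(2) by (intro mult_left_mono) auto
          finally show ?thesis using de(1)[OF sT(5)] dprod by (simp add: a_def)
        qed
        have ua2: "u \<le> a * (a / \<tau>)"
        proof -
          have "u = \<bar>w' s - w s\<bar>\<^sup>2" by (simp add: u_def)
          also have "\<dots> \<le> (a / sqrt \<tau>)\<^sup>2" using cle by (intro power_mono) auto
          also have "\<dots> = a * (a / \<tau>)" using \<tau> by (simp add: power_divide power2_eq_square)
          finally show ?thesis .
        qed
        \<comment> \<open>Interpolation between \<open>u \<le> a\<close> and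
          \<open>u \<le> a\<^sup>2 / \<tau>\<close>: the second bound alone is not integrable after division by
          \<open>sqrt \<tau>\<close>, and the first one alone is not of higher order in
          \<open>\<epsilon>\<close>.\<close>
        have interp: "u \<le> a * (sqrt (sqrt a) / sqrt (sqrt \<tau>))"
        proof (cases "a \<le> \<tau>")
          case True
          define y where "y = a / \<tau>"
          have y: "0 \<le> y" "y \<le> 1" using True a0 \<tau> by (auto simp: y_def)
          have "y \<le> sqrt y" using y real_le_rsqrt[of y y] power_le_one[of y] by (simp add: power2_eq_square mult_left_le)
          also have "\<dots> \<le> sqrt (sqrt y)"
            using y real_le_rsqrt[of "sqrt y" "sqrt y"] by (simp add: real_le_rsqrt mult_left_le power2_eq_square[of "sqrt y", symmetric])
              (metis \<open>y \<le> sqrt y\<close> real_sqrt_le_mono)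
          finally have "a * y \<le> a * sqrt (sqrt y)" using a0 by (intro mult_left_mono)
          then show ?thesis using ua2 by (simp add: y_def real_sqrt_divide)
        next
          case False
          then have "sqrt (sqrt \<tau>) \<le> sqrt (sqrt a)" by simp
          then have "1 \<le> sqrt (sqrt a) / sqrt (sqrt \<tau>)" using \<tau> by simp
          then have "a * 1 \<le> a * (sqrt (sqrt a) / sqrt (sqrt \<tau>))" using a0 by (intro mult_left_mono)
          then show ?thesis using ua by simp
        qed
        have \<psi>1w: "\<bar>\<psi>1 s / w s\<bar> \<le> C"
          using C(2)[OF sT(5)] nz(1) by (simp add: abs_divide pos_divide_le_eq)
        have h1: "\<bar>\<delta>1\<bar> \<le> \<epsilon> * (2 * K)"
          using component_le_norm_cart[of "h s" 1] Mh(2)[OF sT(3)] \<epsilon> by (simp add: \<delta>1_def abs_mult)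
        have r2: "\<bar>\<psi>1 s / w s * (w' s - w s) * \<delta>1\<bar> \<le> C * (a / sqrt \<tau>) * (\<epsilon> * (2 * K))"
          unfolding abs_mult using \<psi>1w cle h1 C(1) a0 \<tau> by (intro mult_mono) auto
        have r3: "\<bar>(b s $ 1 * (\<psi>1 s / w s) + \<psi>2 s) * u / (2 * w s)\<bar>
            \<le> (K * C + D) * (a * (sqrt (sqrt a) / sqrt (sqrt \<tau>))) / sqrt \<tau>"
        proof -
          have "\<bar>b s $ 1 * (\<psi>1 s / w s)\<bar> \<le> K * C"
            unfolding abs_mult using b1[OF sT(1)] \<psi>1w K_pos by (intro mult_mono) auto
          then have "\<bar>b s $ 1 * (\<psi>1 s / w s) + \<psi>2 s\<bar> \<le> K * C + D" using D(2)[OF sT(6)] by linarith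
          moreover have "0 \<le> u" by (simp add: u_def)
          ultimately have "\<bar>(b s $ 1 * (\<psi>1 s / w s) + \<psi>2 s) * u\<bar> \<le> (K * C + D) * (a * (sqrt (sqrt a) / sqrt (sqrt \<tau>)))"
            unfolding abs_mult using interp by (intro mult_mono) auto
          moreover have "sqrt \<tau> \<le> \<bar>2 * w s\<bar>" using w\<tau> by (simp add: abs_mult)
          ultimately show ?thesis unfolding abs_divide using s\<tau> by (intro frac_le) auto
        qed
        have "bd s = C * (a / sqrt \<tau>) * (\<epsilon> * (2 * K)) + (K * C + D) * (a * (sqrt (sqrt a) / sqrt (sqrt \<tau>))) / sqrt \<tau>"
          unfolding bd_def c2_def c3_def a_def[symmetric] \<tau>_def[symmetric]
          using s\<tau> \<tau> by (simp add: a_def field_simps)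
        then have "- (?dJ) \<le> - \<epsilon> * F s + bd s"
          using abs_le_D2[OF r2] abs_le_D1[OF r3] by (simp add: u_def)
        then show "((\<lambda>s. - J s) has_real_derivative - (?dJ)) (at s) \<and>
             - (?dJ) \<le> - \<epsilon> * F s + bd s"
          using DERIV_minus[OF dJ] by blast
      qed
      moreover have "J 0 = 0" using trajD(1,2)[OF tr] trajD(1,2)[OF tr'] by (simp add: J_def d_def e_def)
      moreover have "Bd t \<le> 0" unfolding Bd_def using c23 \<epsilon> H0 tT by (intro mult_nonpos_nonneg) auto
      moreover have "- Bd 0 = \<epsilon> * Err \<epsilon>" by (simp add: Bd_def Err_def algebra_simps)
      ultimately show ?thesis by linarith
    qed
    have J_up: "J t \<le> C / 2 * (w t)\<^sup>2 + \<bar>\<psi>2 t\<bar> * (H * \<epsilon>)" if t: "t \<in> {t0..<T}" for t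
    proof -
      have t': "t \<in> {0..<T}" using t t0(1) by auto
      define P where "P = \<psi>1 t / (2 * w t)"
      have nz: "w t \<noteq> 0" using trajD(5)[OF tr t'] .
      have "P = \<psi>1 t * w t / (2 * (w t)\<^sup>2)" using nz by (simp add: P_def power2_eq_square)
      then have P0: "P \<le> 0" using t0(2)[OF t] by (simp add: divide_nonpos_nonneg less_imp_le)
      have "\<bar>\<psi>1 t / w t\<bar> \<le> C" using C(2)[OF t'] nz by (simp add: abs_divide pos_divide_le_eq)
      from divide_right_mono[OF abs_le_D2[OF this], of 2] have PC: "- P \<le> C / 2"
        by (simp add: P_def mult.commute)
      \<comment> \<open>Optimality enters here: the perturbed square is still nonnegative while
        \<open>(w t)\<^sup>2\<close> is about to vanish.\<close>
      have "- d t \<le> (w t)\<^sup>2" by (simp add: d_def)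
      then have "(- P) * (- d t) \<le> (- P) * (w t)\<^sup>2" using P0 by (intro mult_left_mono) auto
      also have "\<dots> \<le> C / 2 * (w t)\<^sup>2" using PC by (intro mult_right_mono) auto
      finally have "P * d t \<le> C / 2 * (w t)\<^sup>2" by simp
      moreover have "\<psi>2 t * e t \<le> \<bar>\<psi>2 t\<bar> * \<bar>e t\<bar>" by (metis abs_ge_self abs_mult)
      then have "\<psi>2 t * e t \<le> \<bar>\<psi>2 t\<bar> * (H * \<epsilon>)" using de(2)[OF t'] by (meson abs_ge_zero mult_left_mono order_trans)
      ultimately show ?thesis by (simp add: J_def P_def)
    qed
    have key: "\<epsilon> * integral {0..t} F \<le> \<epsilon> * Err \<epsilon> + C / 2 * (w t)\<^sup>2 + \<bar>\<psi>2 t\<bar> * (H * \<epsilon>)" if t: "t \<in> {t0..<T}" for t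
      using J_up[OF t] J_le[of t] t t0(1) by simp
    have lim_w: "((\<lambda>t. (w t)\<^sup>2) \<longlongrightarrow> 0) (at_left T)"
    proof (rule tendstoI)
      fix r :: real assume "r > 0"
      then obtain t1 where "t1 \<in> {0..<T}" "\<forall>t\<in>{t1..<T}. (w t)\<^sup>2 < r" using vanishing_eventually[OF tr van] by blast
      then show "\<forall>\<^sub>F t in at_left T. dist ((w t)\<^sup>2) 0 < r"
        by (auto simp: eventually_at_left_field intro!: exI[of _ t1])
    qed
    have left: "at_left T = at T within {0..<T}"
      using T by (intro at_within_nhd[of _ "{0<..}"]) auto
    have lim_cont: "(f \<longlongrightarrow> f T) (at_left T)" if "continuous_on {0..T} f" for f :: "real \<Rightarrow> real"
    proof -
      have "(f \<longlongrightarrow> f T) (at T within {0..T})" using that T by (auto simp: continuous_on_def)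
      then show ?thesis unfolding left by (rule tendsto_within_subset) auto
    qed
    have lim_F: "((\<lambda>t. integral {0..t} F) \<longlongrightarrow> integral {0..T} F) (at_left T)"
      by (rule lim_cont) (rule indefinite_integral_continuous_1[OF Fint])
    have lim_\<psi>2: "(\<psi>2 \<longlongrightarrow> 0) (at_left T)" using lim_cont[OF \<psi>(2)] \<psi>(3) by simp
    have "\<epsilon> * integral {0..T} F \<le> \<epsilon> * Err \<epsilon> + C / 2 * 0 + \<bar>0\<bar> * (H * \<epsilon>)"
    proof (rule tendsto_le)
      show "((\<lambda>t. \<epsilon> * integral {0..t} F) \<longlongrightarrow> \<epsilon> * integral {0..T} F) (at_left T)"
        by (intro tendsto_intros lim_F)
      show "((\<lambda>t. \<epsilon> * Err \<epsilon> + C / 2 * (w t)\<^sup>2 + \<bar>\<psi>2 t\<bar> * (H * \<epsilon>)) \<longlongrightarrow> \<epsilon> * Err \<epsilon> + C / 2 * 0 + \<bar>0\<bar> * (H * \<epsilon>)) (at_left T)"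
        by (intro tendsto_intros lim_w lim_\<psi>2)
      show "\<forall>\<^sub>F t in at_left T. \<epsilon> * integral {0..t} F \<le> \<epsilon> * Err \<epsilon> + C / 2 * (w t)\<^sup>2 + \<bar>\<psi>2 t\<bar> * (H * \<epsilon>)"
        using key t0(1) by (auto simp: eventually_at_left_field intro!: exI[of _ t0])
    qed simp
    then show ?thesis using \<epsilon> by simp
  qed
  have "(Err \<longlongrightarrow> Err 0) (at_right 0)"
    unfolding Err_def by (intro tendsto_intros)
  then have "(Err \<longlongrightarrow> 0) (at_right 0)" by (simp add: Err_def)
  moreover have "\<forall>\<^sub>F \<epsilon> in at_right 0. integral {0..T} F \<le> Err \<epsilon>"
    using main by (auto simp: eventually_at_right_field intro!: exI[of _ 1])
  ultimately have "integral {0..T} F \<le> 0"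
    by (intro tendsto_lowerbound[of Err 0 "at_right 0"]) auto
  then show ?thesis by (simp add: F_def[abs_def])
qed

end

section \<open>Quenching times, admissible controls and the adjoint equation\<close>

context quenching_start
begin

text \<open>The component \<open>p\<close> stays between \<open>1\<close> and a constant, so \<open>\<bar>f1 y\<bar>\<close> tends to infinity exactly when \<open>p / w\<close> does,
that is, when \<open>w\<close> tends to \<open>0\<close>.\<close>

lemma is_quenching_time_iff:
  fixes B :: "real \<Rightarrow> real^2^2"
  assumes y0: "y0 $ 1 - 1 = w0" "y0 $ 2 = p0" and bd: "bounded_forcing K (\<lambda>t. B t *v u t)"
  shows "is_quenching_time B u y0 T \<longleftrightarrow> (\<exists>w p. traj (\<lambda>t. B t *v u t) T w p \<and> vanishing T w)"
proof
  assume "is_quenching_time B u y0 T"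
  then obtain y where T: "0 < T" and sol: "solution_on B u y0 T y"
    and lim: "filterlim (\<lambda>t. norm (f1 (y t))) at_top (at_left T)"
    unfolding is_quenching_time_def by blast
  define w p where "w t = y t $ 1 - 1" and "p t = y t $ 2" for t
  have tr: "traj (\<lambda>t. B t *v u t) T w p"
    unfolding traj_def w_def[abs_def] p_def[abs_def]
    using solution_on_imp_trajectory[OF sol bd] bd T y0 sol by (auto simp: solution_on_def)
  have "vanishing T w"
  proof (rule ccontr)
    assume "\<not> vanishing T w"
    then obtain \<epsilon> where \<epsilon>: "\<epsilon> > 0" "\<And>t. t \<in> {0..<T} \<Longrightarrow> \<epsilon> \<le> (w t)\<^sup>2"
      unfolding vanishing_def by (auto simp: not_less)
    define M where "M = (p0 + (1 + \<bar>w0\<bar> + K)) * exp T"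
    have f1: "norm (f1 (y t)) \<le> M / sqrt \<epsilon> + (1 + \<bar>w0\<bar> + M)" if t: "t \<in> {0..<T}" for t
    proof -
      have p1: "1 \<le> p t" by (rule traj_p_ge_1[OF tr t])
      have "1 \<le> p0" using traj_p_ge_1[OF tr, of 0] T trajD(2)[OF tr] by simp
      then have "p t \<le> M"
        using traj_p_le[OF tr t] t K_pos unfolding M_def by (smt (verit) exp_le_cancel_iff mult_left_mono atLeastLessThan_iff)
      moreover have "\<bar>w t\<bar> \<le> \<bar>w0\<bar>" using traj_square_le[OF tr t] by (simp add: abs_le_square_iff)
      moreover have "sqrt \<epsilon> \<le> \<bar>w t\<bar>" using real_sqrt_le_mono[OF \<epsilon>(2)[OF t]] by simp
      moreover have "norm (f1 (y t)) \<le> \<bar>p t\<bar> / \<bar>w t\<bar> + \<bar>1 + w t + p t\<bar>"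
      proof -
        have "norm (f1 (y t)) \<le> \<bar>y t $ 2 / (1 - y t $ 1)\<bar> + \<bar>y t $ 1 + y t $ 2\<bar>"
          using norm_le_l1_cart[of "f1 (y t)"] by (simp add: f1_def sum_2)
        then show ?thesis by (simp add: w_def p_def abs_divide abs_minus_commute)
      qed
      moreover have "\<bar>p t\<bar> / \<bar>w t\<bar> \<le> M / sqrt \<epsilon>"
        using calculation \<epsilon>(1) p1 by (intro frac_le) auto
      ultimately show ?thesis using p1 by linarith
    qed
    have "\<forall>\<^sub>F t in at_left T. M / sqrt \<epsilon> + (1 + \<bar>w0\<bar> + M) + 1 \<le> norm (f1 (y t))"
      using lim unfolding filterlim_at_top by blast
    moreover have "\<forall>\<^sub>F t in at_left T. t \<in> {0..<T}"
      using T by (auto simp: eventually_at_left_field intro!: exI[of _ 0])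
    ultimately have "\<forall>\<^sub>F t in at_left T. False"
    proof eventually_elim
      case (elim t)
      then show False using f1[of t] by simp
    qed
    then show False by simp
  qed
  with tr show "\<exists>w p. traj (\<lambda>t. B t *v u t) T w p \<and> vanishing T w" by blast
next
  assume "\<exists>w p. traj (\<lambda>t. B t *v u t) T w p \<and> vanishing T w"
  then obtain w p where tr: "traj (\<lambda>t. B t *v u t) T w p" and van: "vanishing T w" by blast
  define y :: "real \<Rightarrow> real^2" where "y t = vector [1 + w t, p t]" for t
  have yc: "y t $ 1 = 1 + w t" "y t $ 2 = p t" for t by (simp_all add: y_def)
  have "solution_on B u (y 0) T y"
    using tr by (intro trajectory_imp_solution_on) (simp add: traj_def yc)
  moreover have "y 0 = y0" using y0 trajD(1,2)[OF tr] by (simp add: vec_eq_iff forall_2 yc)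
  moreover have "filterlim (\<lambda>t. norm (f1 (y t))) at_top (at_left T)"
    unfolding filterlim_at_top
  proof
    fix Z :: real
    define R where "R = max 1 Z"
    have R: "0 < R" "Z \<le> R" by (auto simp: R_def)
    obtain t0 where t0: "t0 \<in> {0..<T}" "\<forall>t\<in>{t0..<T}. (w t)\<^sup>2 < (1 / R)\<^sup>2"
      using vanishing_eventually[OF tr van, of "(1 / R)\<^sup>2"] R by auto
    have "Z \<le> norm (f1 (y t))" if t: "t \<in> {t0..<T}" for t
    proof -
      have t': "t \<in> {0..<T}" using t t0 by auto
      have "\<bar>w t\<bar> < 1 / R" using t0(2) t R by (metis abs_of_pos power2_abs power2_less_imp_less less_imp_le zero_less_divide_1_iff)
      then have "R * \<bar>w t\<bar> < 1" using R by (simp add: field_simps)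
      moreover have "0 < \<bar>w t\<bar>" using trajD(5)[OF tr t'] by simp
      ultimately have "R \<le> \<bar>p t\<bar> / \<bar>w t\<bar>" using traj_p_ge_1[OF tr t'] by (simp add: pos_le_divide_eq)
      also have "\<dots> = \<bar>f1 (y t) $ 1\<bar>" by (simp add: f1_def yc abs_divide)
      also have "\<dots> \<le> norm (f1 (y t))" by (rule component_le_norm_cart)
      finally show ?thesis using R by simp
    qed
    then show "\<forall>\<^sub>F t in at_left T. Z \<le> norm (f1 (y t))"
      using t0(1) by (auto simp: eventually_at_left_field intro!: exI[of _ t0])
  qed
  ultimately show "is_quenching_time B u y0 T"
    using trajD(3)[OF tr] unfolding is_quenching_time_def by auto
qed

lemma quenching_time_eq:
  fixes B :: "real \<Rightarrow> real^2^2"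
  assumes y0: "y0 $ 1 - 1 = w0" "y0 $ 2 = p0"
    and tr: "traj (\<lambda>t. B t *v u t) T w p" and van: "vanishing T w"
  shows "quenching_time B u y0 = T"
  unfolding quenching_time_def
proof (rule the_equality)
  note iff = is_quenching_time_iff[OF y0 trajD(4)[OF tr]]
  show "is_quenching_time B u y0 T" using tr van iff by blast
  show "S = T" if "is_quenching_time B u y0 S" for S
    using that iff quenching_traj_unique[OF _ _ tr van] by blast
qed

end

lemma quenching_start_S_f1:
  assumes "z \<in> S_f1 K"
  shows "quenching_start K (z $ 1 - 1) (z $ 2)"
proof -
  define r where "r = 1 / (2 * K)"
  have "0 < r" using assms unfolding S_f1_def r_def[symmetric] by auto
  then have K: "0 < K" by (simp add: r_def)
  have a: "\<bar>z $ 1 - 1\<bar> < 1 / (2 * K)" "z $ 1 \<noteq> 1" using assms by (auto simp: S_f1_def)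
  have "2 * K * \<bar>z $ 1 - 1\<bar> < 1" using a(1) K by (simp add: pos_less_divide_eq mult_ac)
  then show ?thesis using a(2) K assms by unfold_locales (auto simp: S_f1_def)
qed

lemma borel_measurable_matrix_vector_mult:
  fixes A :: "'a \<Rightarrow> real^'n^'m" and x :: "'a \<Rightarrow> real^'n"
  assumes "A \<in> borel_measurable M" "x \<in> borel_measurable M"
  shows "(\<lambda>t. A t *v x t) \<in> borel_measurable M"
proof (rule borel_measurable_continuous_Pair[OF assms])
  have "continuous_on UNIV (\<lambda>z::(real^'n^'m) \<times> (real^'n). \<chi> i. \<Sum>j\<in>UNIV. fst z $ i $ j * snd z $ j)"
    by (intro continuous_on_vec_lambda continuous_on_sum continuous_on_mult
        bounded_linear.continuous_on[OF bounded_linear_vec_nth] continuous_intros)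
  then show "continuous_on UNIV (\<lambda>z::(real^'n^'m) \<times> (real^'n). fst z *v snd z)"
    by (simp add: matrix_vector_mult_def)
qed

text \<open>Positivity of \<open>K0 B \<rho>\<close> excludes the infinite values of the essential supremum that \<open>real_of_ereal\<close> sends to \<open>0\<close>.\<close>

lemma U_ad_bounded_forcing:
  fixes B :: "real \<Rightarrow> real^2^2"
  assumes B: "B \<in> L_infinity" and \<rho>: "0 < \<rho>" and K: "0 < K0 B \<rho>" and u: "u \<in> U_ad \<rho>"
  shows "bounded_forcing (K0 B \<rho>) (\<lambda>t. B t *v u t)"
proof -
  define r where "r = real_of_ereal (ess_bound B)"
  have "0 < r" using K \<rho> by (simp add: K0_def r_def zero_less_mult_iff)
  then have r: "ess_bound B = ereal r" by (cases "ess_bound B") (auto simp: r_def)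
  have "AE t in lebesgue_on {0..}. ereal (onorm (\<lambda>x. B t *v x)) \<le> ess_bound B"
    unfolding ess_bound_def by (rule esssup_AE)
  then obtain N1 where N1: "negligible N1" "\<And>t. t \<in> {0..} - N1 \<Longrightarrow> onorm (\<lambda>x. B t *v x) \<le> r"
    unfolding r by (subst (asm) AE_lebesgue_on_iff_negligible) auto
  obtain N2 where N2: "negligible N2" "\<And>t. t \<in> {0..} - N2 \<Longrightarrow> norm (u t) \<le> \<rho>"
    using u unfolding U_ad_def by (auto simp: AE_lebesgue_on_iff_negligible)
  have "norm (B t *v u t) \<le> K0 B \<rho>" if t: "t \<in> {0..} - (N1 \<union> N2)" for t
  proof -
    have "norm (B t *v u t) \<le> onorm (\<lambda>x. B t *v x) * norm (u t)"
      by (rule onorm) simp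
    also have "\<dots> \<le> r * \<rho>" using N1(2)[of t] N2(2)[of t] t \<open>0 < r\<close> by (intro mult_mono) auto
    finally show ?thesis by (simp add: K0_def r_def)
  qed
  moreover have "(\<lambda>t. B t *v u t) \<in> borel_measurable (lebesgue_on {0..})"
    using B u by (intro borel_measurable_matrix_vector_mult) (auto simp: L_infinity_def U_ad_def)
  ultimately show ?thesis
    using N1(1) N2(1) unfolding bounded_forcing_def by (auto intro!: exI[of _ "N1 \<union> N2"])
qed

lemma U_ad_convex:
  assumes "u \<in> U_ad \<rho>" "v \<in> U_ad \<rho>" "0 \<le> \<epsilon>" "\<epsilon> \<le> 1"
  shows "(\<lambda>t. u t + \<epsilon> *\<^sub>R (v t - u t)) \<in> U_ad \<rho>"
proof -
  have "(\<lambda>t. u t + \<epsilon> *\<^sub>R (v t - u t)) \<in> borel_measurable (lebesgue_on {0..})"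
    using assms by (intro borel_measurable_add borel_measurable_scaleR borel_measurable_diff) (auto simp: U_ad_def)
  moreover have "AE t in lebesgue_on {0..}. norm (u t) \<le> \<rho>" "AE t in lebesgue_on {0..}. norm (v t) \<le> \<rho>"
    using assms by (auto simp: U_ad_def)
  then have "AE t in lebesgue_on {0..}. norm (u t + \<epsilon> *\<^sub>R (v t - u t)) \<le> \<rho>"
  proof eventually_elim
    case (elim t)
    have "u t + \<epsilon> *\<^sub>R (v t - u t) = (1 - \<epsilon>) *\<^sub>R u t + \<epsilon> *\<^sub>R v t" by (simp add: algebra_simps)
    also have "norm \<dots> \<le> (1 - \<epsilon>) * norm (u t) + \<epsilon> * norm (v t)"
      using norm_triangle_ineq[of "(1 - \<epsilon>) *\<^sub>R u t" "\<epsilon> *\<^sub>R v t"] assms by simp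
    also have "\<dots> \<le> (1 - \<epsilon>) * \<rho> + \<epsilon> * \<rho>" using elim assms by (intro add_mono mult_left_mono) auto
    finally show ?case by (simp add: algebra_simps)
  qed
  ultimately show ?thesis by (simp add: U_ad_def)
qed

lemma inverse_sqrt_integrable:
  assumes "t \<le> T"
  shows "(\<lambda>s. a * (1 / sqrt (T - s)) + c) integrable_on {t..T}"
proof -
  have "((\<lambda>s. a * (1 / sqrt (T - s)) + c) has_integral
      (- 2 * a * sqrt (T - T) + c * T) - (- 2 * a * sqrt (T - t) + c * t)) {t..T}"
  proof (rule fundamental_theorem_of_calculus_interior[OF assms])
    show "continuous_on {t..T} (\<lambda>s. - 2 * a * sqrt (T - s) + c * s)" by (intro continuous_intros)
    fix s assume "s \<in> {t<..<T}"
    then have "((\<lambda>s. - 2 * a * sqrt (T - s) + c * s) has_real_derivative a * (1 / sqrt (T - s)) + c) (at s)"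
      by (auto intro!: derivative_eq_intros simp: field_simps)
    then show "((\<lambda>s. - 2 * a * sqrt (T - s) + c * s) has_vector_derivative a * (1 / sqrt (T - s)) + c) (at s)"
      by (simp add: has_real_derivative_iff_has_vector_derivative)
  qed
  then show ?thesis by blast
qed

context quenching_start
begin

text \<open>The first component of the integrand contains \<open>(p / w\<^sup>2) \<psi>\<^sub>1\<close>. It is integrable up to \<open>T\<close> because \<open>\<bar>\<psi>\<^sub>1\<bar> \<le> C \<bar>w\<bar>\<close>
leaves only one factor \<open>1 / \<bar>w\<bar> \<le> 1 / sqrt (T - s)\<close>.\<close>

lemma adjoint_integral_equation:
  fixes y :: "real \<Rightarrow> real^2" and \<psi> :: "real \<Rightarrow> real^2"
  assumes tr: "traj b T w p" and y: "\<And>t. t \<in> {0..<T} \<Longrightarrow> y t $ 1 = 1 + w t \<and> y t $ 2 = p t"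
    and \<psi>: "continuous_on {0..T} \<psi>" "\<psi> T = 0"
    and d\<psi>1: "\<And>t. t \<in> {0<..<T} \<Longrightarrow> ((\<lambda>t. \<psi> t $ 1) has_real_derivative - (p t / (w t)\<^sup>2) * \<psi> t $ 1 - \<psi> t $ 2) (at t)"
    and d\<psi>2: "\<And>t. t \<in> {0<..<T} \<Longrightarrow> ((\<lambda>t. \<psi> t $ 2) has_real_derivative \<psi> t $ 1 / w t - \<psi> t $ 2) (at t)"
    and C: "0 \<le> C" "\<And>t. t \<in> {0..<T} \<Longrightarrow> \<bar>\<psi> t $ 1\<bar> \<le> C * \<bar>w t\<bar>"
    and t: "t \<in> {0..<T}"
  shows "(\<lambda>s. grad_matrix f1 (y s) *v \<psi> s) absolutely_integrable_on {t..<T}"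
    "\<psi> t = integral {t..<T} (\<lambda>s. grad_matrix f1 (y s) *v \<psi> s)"
proof -
  define G where "G s = grad_matrix f1 (y s) *v \<psi> s" for s
  have ne: "w s \<noteq> 0" if "s \<in> {0..<T}" for s using trajD(5)[OF tr that] .
  have Gc: "G s $ 1 = p s / (w s)\<^sup>2 * \<psi> s $ 1 + \<psi> s $ 2" "G s $ 2 = - (\<psi> s $ 1 / w s) + \<psi> s $ 2"
    if s: "s \<in> {0..<T}" for s
  proof -
    have "y s \<in> dom1" "1 - y s $ 1 = - w s" using y[OF s] ne[OF s] by (auto simp: dom1_def)
    then have "grad_matrix f1 (y s) = vector [vector [p s / (w s)\<^sup>2, 1], vector [- (1 / w s), 1]]"
      using grad_matrix_f1[of "y s"] y[OF s] by simp
    then show "G s $ 1 = p s / (w s)\<^sup>2 * \<psi> s $ 1 + \<psi> s $ 2" "G s $ 2 = - (\<psi> s $ 1 / w s) + \<psi> s $ 2"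
      by (simp_all add: G_def matrix_vector_mult_def sum_2)
  qed
  have vec: "v = (v $ 1) *\<^sub>R axis 1 1 + (v $ 2) *\<^sub>R axis 2 1" for v :: "real^2"
    by (auto simp: vec_eq_iff forall_2 axis_def)
  have d\<psi>: "((\<lambda>s. - \<psi> s) has_vector_derivative G s) (at s)" if s: "s \<in> {0<..<T}" for s
  proof -
    have "((\<lambda>s. (\<psi> s $ 1) *\<^sub>R axis 1 (1::real) + (\<psi> s $ 2) *\<^sub>R axis (2::2) 1) has_vector_derivative
        (- (G s $ 1)) *\<^sub>R axis 1 1 + (- (G s $ 2)) *\<^sub>R axis 2 1) (at s)"
      using d\<psi>1[OF s] d\<psi>2[OF s] Gc[of s] s
      by (intro has_vector_derivative_add has_vector_derivative_scaleR[where g="\<lambda>_. axis _ 1" and g'=0, simplified])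
        auto
    then have "((\<lambda>s. \<psi> s) has_vector_derivative - G s) (at s)"
      by (simp add: vec[symmetric] scaleR_minus_left[symmetric] del: scaleR_minus_left)
        (metis (no_types, lifting) vec vector_uminus_component)
    then show ?thesis using has_vector_derivative_minus by fastforce
  qed
  have tT: "t \<le> T" "0 \<le> t" using t by auto
  have "(G has_integral (- \<psi> T - - \<psi> t)) {t..T}"
  proof (rule fundamental_theorem_of_calculus_interior[OF tT(1)])
    show "continuous_on {t..T} (\<lambda>s. - \<psi> s)"
      by (intro continuous_intros continuous_on_subset[OF \<psi>(1)]) (use tT in auto)
    show "((\<lambda>s. - \<psi> s) has_vector_derivative G s) (at s)" if "s \<in> {t<..<T}" for s
      using that tT by (intro d\<psi>) auto
  qed
  then have "(G has_integral \<psi> t) {t..T}" using \<psi>(2) by simp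
  then have int: "(G has_integral \<psi> t) {t..<T}"
    by (rule has_integral_spike_set_eq[THEN iffD1, rotated 2])
      (auto intro: negligible_subset[of "{T}"])
  show "\<psi> t = integral {t..<T} (\<lambda>s. grad_matrix f1 (y s) *v \<psi> s)"
    using integral_unique[OF int] by (simp add: G_def[abs_def])
  have "bounded (\<psi> ` {0..T})" using \<psi> by (intro compact_imp_bounded compact_continuous_image) auto
  then obtain D where D: "D > 0" "\<And>s. s \<in> {0..T} \<Longrightarrow> norm (\<psi> s) \<le> D" unfolding bounded_pos by auto
  define M where "M = (p0 + (1 + \<bar>w0\<bar> + K)) * exp T"
  have p0: "1 \<le> p0" using traj_p_ge_1[OF tr, of 0] trajD(2,3)[OF tr] by simp
  have M0: "0 \<le> M" using p0 K_pos by (simp add: M_def)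
  have Gbound: "norm (G s) \<le> M * C * (1 / sqrt (T - s)) + (C + 2 * D)" if s: "s \<in> {t..<T}" for s
  proof -
    have s': "s \<in> {0..<T}" "s \<in> {0..T}" using s tT by auto
    have p: "0 \<le> p s" "p s \<le> M"
    proof -
      show "0 \<le> p s" using traj_p_ge_1[OF tr s'(1)] by simp
      have "p s \<le> (p0 + (1 + \<bar>w0\<bar> + K)) * exp s" by (rule traj_p_le[OF tr s'(1)])
      also have "\<dots> \<le> M" unfolding M_def using p0 K_pos s by (intro mult_left_mono) auto
      finally show "p s \<le> M" .
    qed
    have nz: "0 < \<bar>w s\<bar>" using ne[OF s'(1)] by simp
    have ws: "sqrt (T - s) \<le> \<bar>w s\<bar>" using real_sqrt_le_mono[OF traj_square_ge[OF tr s'(1)]] by simp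
    have q: "\<bar>\<psi> s $ 1 / w s\<bar> \<le> C" using C(2)[OF s'(1)] nz by (simp add: abs_divide pos_divide_le_eq)
    have "\<bar>p s / (w s)\<^sup>2 * \<psi> s $ 1\<bar> = p s * \<bar>\<psi> s $ 1 / w s\<bar> * (1 / \<bar>w s\<bar>)"
      using p(1) by (simp add: abs_mult abs_divide power2_eq_square)
    also have "\<dots> \<le> M * C * (1 / sqrt (T - s))"
      using p q M0 C(1) ws s nz by (intro mult_mono divide_left_mono) auto
    finally have 1: "\<bar>p s / (w s)\<^sup>2 * \<psi> s $ 1\<bar> \<le> M * C * (1 / sqrt (T - s))" .
    have 2: "\<bar>\<psi> s $ 2\<bar> \<le> D" using component_le_norm_cart[of "\<psi> s" 2] D(2)[OF s'(2)] by simp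
    have "norm (G s) \<le> \<bar>G s $ 1\<bar> + \<bar>G s $ 2\<bar>" using norm_le_l1_cart[of "G s"] by (simp add: sum_2)
    also have "\<dots> \<le> (M * C * (1 / sqrt (T - s)) + D) + (C + D)"
      using 1 2 q unfolding Gc[OF s'(1)] by (intro add_mono; linarith)
    finally show ?thesis by simp
  qed
  have "G absolutely_integrable_on {t..<T}"
  proof (rule absolutely_integrable_integrable_bound[OF Gbound])
    show "G integrable_on {t..<T}" using int by blast
    show "(\<lambda>s. M * C * (1 / sqrt (T - s)) + (C + 2 * D)) integrable_on {t..<T}"
      using inverse_sqrt_integrable[OF tT(1), of "M * C" "C + 2 * D"]
      by (rule integrable_spike_set) (auto intro: negligible_subset[of "{T}"])
  qed
  then show "(\<lambda>s. grad_matrix f1 (y s) *v \<psi> s) absolutely_integrable_on {t..<T}"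
    by (simp add: G_def[abs_def])
qed

end

section \<open>The maximum principle\<close>

lemma quenching_control:
  fixes B :: "real \<Rightarrow> real^2^2" and y0 :: "real^2"
  assumes B: "B \<in> L_infinity" and \<rho>: "0 < \<rho>" and y0: "y0 \<in> S_f1 (K0 B \<rho>)" and u: "u \<in> U_ad \<rho>"
  obtains T w p where
    "quenching_start.traj (K0 B \<rho>) (y0 $ 1 - 1) (y0 $ 2) (\<lambda>t. B t *v u t) T w p"
    "vanishing T w" "quenching_time B u y0 = T" "T \<le> (y0 $ 1 - 1)\<^sup>2"
proof -
  interpret quenching_start "K0 B \<rho>" "y0 $ 1 - 1" "y0 $ 2" by (rule quenching_start_S_f1[OF y0])
  have b: "bounded_forcing (K0 B \<rho>) (\<lambda>t. B t *v u t)" by (rule U_ad_bounded_forcing[OF B \<rho> K_pos u])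
  obtain T w p where tr: "traj (\<lambda>t. B t *v u t) T w p" "vanishing T w"
    using quenching_traj_exists[OF b] .
  then show thesis using quenching_time_eq[OF refl refl tr] traj_time_le[OF tr(1)] by (intro that)
qed

lemma optimal_time_le:
  fixes B :: "real \<Rightarrow> real^2^2" and y0 :: "real^2"
  assumes B: "B \<in> L_infinity" and \<rho>: "0 < \<rho>" and y0: "y0 \<in> S_f1 (K0 B \<rho>)" and u: "u \<in> U_ad \<rho>"
  shows "optimal_time B \<rho> y0 \<le> quenching_time B u y0"
  unfolding optimal_time_def
proof (rule cINF_lower[OF _ u])
  interpret quenching_start "K0 B \<rho>" "y0 $ 1 - 1" "y0 $ 2" by (rule quenching_start_S_f1[OF y0])
  show "bdd_below ((\<lambda>u. quenching_time B u y0) ` U_ad \<rho>)"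
  proof (rule bdd_belowI[of _ 0])
    fix x assume "x \<in> (\<lambda>u. quenching_time B u y0) ` U_ad \<rho>"
    then obtain u where u: "u \<in> U_ad \<rho>" "x = quenching_time B u y0" by blast
    obtain T w p where "traj (\<lambda>t. B t *v u t) T w p" "quenching_time B u y0 = T"
      using quenching_control[OF B \<rho> y0 u(1)] by metis
    then show "0 \<le> x" using trajD(3) u(2) by fastforce
  qed
qed

text \<open>The maximizer of the linear form \<open>v \<mapsto> \<langle>c, v\<rangle>\<close> on the ball is \<open>(\<rho> / \<bar>c\<bar>) c\<close>, where \<open>c\<close> is the transpose of \<open>B\<close>
applied to \<open>\<psi>\<close>. This explicit formula shows measurability in \<open>t\<close>. Where \<open>c = 0\<close> the formula
yields \<open>0\<close>, and every \<open>v\<close> is a maximizer.\<close>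

lemma maximizing_control:
  fixes B :: "real \<Rightarrow> real^2^2" and \<psi> :: "real \<Rightarrow> real^2"
  assumes B: "B \<in> L_infinity" and \<rho>: "0 < \<rho>" and \<psi>: "continuous_on {0..T} \<psi>"
  obtains u where "u \<in> U_ad \<rho>" "\<And>t v. t \<in> {0..T} \<Longrightarrow> norm v \<le> \<rho> \<Longrightarrow> \<psi> t \<bullet> (B t *v v) \<le> \<psi> t \<bullet> (B t *v u t)"
proof -
  define \<phi> where "\<phi> t = (if t \<in> {0..T} then \<psi> t else 0)" for t
  have "\<psi> \<in> borel_measurable (lebesgue_on {0..T})"
    using \<psi> by (rule continuous_imp_measurable_on_sets_lebesgue) simp
  then have "\<phi> \<in> borel_measurable lebesgue"
    unfolding \<phi>_def by (subst borel_measurable_if) auto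
  then have \<phi>: "\<phi> \<in> borel_measurable (lebesgue_on {0..})" by (rule measurable_restrict_space1)
  define c where "c t = transpose (B t) *v \<phi> t" for t
  have Bm: "B \<in> borel_measurable (lebesgue_on {0..})" using B by (simp add: L_infinity_def)
  have "(\<lambda>t. transpose (B t)) \<in> borel_measurable (lebesgue_on {0..})"
  proof (rule measurable_compose[OF Bm borel_measurable_continuous_onI])
    show "continuous_on UNIV (\<lambda>A::real^2^2. transpose A)"
      unfolding transpose_def
      by (intro continuous_on_vec_lambda bounded_linear.continuous_on[OF bounded_linear_vec_nth] continuous_intros)
  qed
  then have cm: "c \<in> borel_measurable (lebesgue_on {0..})"
    unfolding c_def using \<phi> by (rule borel_measurable_matrix_vector_mult)
  have cB: "\<phi> t \<bullet> (B t *v v) = c t \<bullet> v" for t v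
    by (simp add: c_def transpose_matrix_vector dot_lmul_matrix)
  define u where "u t = (\<rho> / norm (c t)) *\<^sub>R c t" for t
  have "u \<in> borel_measurable (lebesgue_on {0..})"
    unfolding u_def using cm by measurable
  moreover have "norm (u t) \<le> \<rho>" for t using \<rho> by (simp add: u_def)
  ultimately have "u \<in> U_ad \<rho>" by (simp add: U_ad_def)
  moreover have "\<psi> t \<bullet> (B t *v v) \<le> \<psi> t \<bullet> (B t *v u t)" if t: "t \<in> {0..T}" and v: "norm v \<le> \<rho>" for t v
  proof -
    have "\<psi> t \<bullet> (B t *v v) = c t \<bullet> v" using cB[of t v] t by (simp add: \<phi>_def)
    also have "\<dots> \<le> norm (c t) * norm v" by (rule norm_cauchy_schwarz)
    also have "\<dots> \<le> norm (c t) * \<rho>" using v by (intro mult_left_mono) auto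
    also have "\<dots> = c t \<bullet> u t" by (simp add: u_def power2_norm_eq_inner[symmetric] power2_eq_square)
    also have "\<dots> = \<psi> t \<bullet> (B t *v u t)" using cB[of t "u t"] t by (simp add: \<phi>_def)
    finally show ?thesis .
  qed
  ultimately show thesis by (rule that)
qed

text \<open>The costate depends on the optimal trajectory alone, so the competing control may be chosen afterwards, as a
pointwise maximizer. The variation inequality then bounds the integral of a nonnegative function by \<open>0\<close>. The bound
on the optimal time is the quenching time of the control \<open>0\<close>.\<close>

theorem theorem1p2:
  fixes B :: "real \<Rightarrow> real^2^2" and \<rho>0 :: real and y0 :: "real^2"
  assumes "B \<in> L_infinity"
    and "\<not> (AE t in lebesgue_on {0..}. B t = 0)"
    and "\<rho>0 > 0"
    and "y0 \<in> S_f1 (K0 B \<rho>0)"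
  shows "(\<forall>tstar ustar ystar.
            tstar = optimal_time B \<rho>0 y0 \<and>
            optimal_control B \<rho>0 y0 ustar \<and>
            solution_on B ustar y0 tstar ystar \<longrightarrow>
            (\<exists>\<psi> :: real \<Rightarrow> real^2.
               continuous_on {0..tstar} \<psi> \<and>
               (\<exists>t\<in>{0..tstar}. \<psi> t \<noteq> 0) \<and>
               (\<forall>t\<in>{0..<tstar}.
                  (\<lambda>\<tau>. grad_matrix f1 (ystar \<tau>) *v \<psi> \<tau>) absolutely_integrable_on {t..<tstar} \<and>
                  \<psi> t = integral {t..<tstar} (\<lambda>\<tau>. grad_matrix f1 (ystar \<tau>) *v \<psi> \<tau>)) \<and>
               \<psi> tstar = 0 \<and>
               (AE t in lebesgue_on {0..tstar}.
                  is_arg_max (\<lambda>v. \<psi> t \<bullet> (B t *v v)) (\<lambda>v. norm v \<le> \<rho>0) (ustar t))))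
         \<and> optimal_time B \<rho>0 y0 \<le> (y0$1 - 1)\<^sup>2"
proof (intro conjI allI impI, goal_cases)
  case (1 T us ys)
  then have T: "T = optimal_time B \<rho>0 y0" and opt: "optimal_control B \<rho>0 y0 us"
    and sol: "solution_on B us y0 T ys" by auto
  note B = assms(1) and \<rho>0 = assms(3) and y0 = assms(4)
  interpret quenching_start "K0 B \<rho>0" "y0 $ 1 - 1" "y0 $ 2" by (rule quenching_start_S_f1[OF y0])
  have us: "us \<in> U_ad \<rho>0" and qT: "quenching_time B us y0 = T" using opt T by (auto simp: optimal_control_def)
  define b where "b t = B t *v us t" for t
  have bf: "bounded_forcing (K0 B \<rho>0) b"
    unfolding b_def by (rule U_ad_bounded_forcing[OF B \<rho>0 K_pos us])
  obtain w p where tr: "traj b T w p" and van: "vanishing T w"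
    using quenching_control[OF B \<rho>0 y0 us] qT unfolding b_def by metis
  have T0: "0 < T" by (rule trajD(3)[OF tr])
  have trs: "traj b T (\<lambda>t. ys t $ 1 - 1) (\<lambda>t. ys t $ 2)"
    using solution_on_imp_trajectory[OF sol bf[unfolded b_def]] bf T0 sol
    unfolding traj_def b_def[symmetric] by (auto simp: solution_on_def)
  have ysw: "ys t $ 1 = 1 + w t \<and> ys t $ 2 = p t" if "t \<in> {0..<T}" for t
    using traj_unique[OF tr trs that] by auto
  obtain \<psi>1 \<psi>2 C t0 where \<psi>12: "continuous_on {0..T} \<psi>1" "continuous_on {0..T} \<psi>2" "\<psi>1 T = 0" "\<psi>2 T = 0"
    and d1: "\<And>t. t \<in> {0<..<T} \<Longrightarrow> (\<psi>1 has_real_derivative - (p t / (w t)\<^sup>2) * \<psi>1 t - \<psi>2 t) (at t)"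
    and d2: "\<And>t. t \<in> {0<..<T} \<Longrightarrow> (\<psi>2 has_real_derivative \<psi>1 t / w t - \<psi>2 t) (at t)"
    and C: "0 \<le> C" "\<And>t. t \<in> {0..<T} \<Longrightarrow> \<bar>\<psi>1 t\<bar> \<le> C * \<bar>w t\<bar>"
    and t0: "t0 \<in> {0..<T}" "\<And>t. t \<in> {t0..<T} \<Longrightarrow> \<psi>1 t * w t < 0"
    using adjoint_exists[OF tr van] by metis
  define \<psi> :: "real \<Rightarrow> real^2" where "\<psi> t = vector [\<psi>1 t, \<psi>2 t]" for t
  have \<psi>c: "\<psi> t $ 1 = \<psi>1 t" "\<psi> t $ 2 = \<psi>2 t" for t by (simp_all add: \<psi>_def)
  have c\<psi>: "continuous_on {0..T} \<psi>"
  proof -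
    have "\<psi> = (\<lambda>t. \<psi>1 t *\<^sub>R axis 1 1 + \<psi>2 t *\<^sub>R axis 2 1)"
      by (auto simp: fun_eq_iff vec_eq_iff forall_2 \<psi>c axis_def)
    then show ?thesis using \<psi>12 by (auto intro!: continuous_intros)
  qed
  have \<psi>T: "\<psi> T = 0" by (simp add: vec_eq_iff forall_2 \<psi>c \<psi>12)
  have "\<psi>1 t0 * w t0 < 0" using t0 by auto
  then have nontriv: "\<psi> t0 \<noteq> 0" using \<psi>c(1)[of t0] by auto
  obtain um where um: "um \<in> U_ad \<rho>0"
    and umax: "\<And>t v. t \<in> {0..T} \<Longrightarrow> norm v \<le> \<rho>0 \<Longrightarrow> \<psi> t \<bullet> (B t *v v) \<le> \<psi> t \<bullet> (B t *v um t)"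
    using maximizing_control[OF B \<rho>0 c\<psi>] by blast
  define h where "h t = B t *v um t - b t" for t
  have bm: "bounded_forcing (K0 B \<rho>0) (\<lambda>t. B t *v um t)" by (rule U_ad_bounded_forcing[OF B \<rho>0 K_pos um])
  obtain N1 where N1: "negligible N1" "\<And>t. t \<in> {0..} - N1 \<Longrightarrow> norm (b t) \<le> K0 B \<rho>0"
    using bf unfolding bounded_forcing_def by blast
  obtain N2 where N2: "negligible N2" "\<And>t. t \<in> {0..} - N2 \<Longrightarrow> norm (B t *v um t) \<le> K0 B \<rho>0"
    using bm unfolding bounded_forcing_def by blast
  obtain N3 where N3: "negligible N3" "\<And>t. t \<in> {0..} - N3 \<Longrightarrow> norm (us t) \<le> \<rho>0"
    using us unfolding U_ad_def by (auto simp: AE_lebesgue_on_iff_negligible)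
  define N where "N = N1 \<union> N2"
  have N: "negligible N" using N1 N2 by (simp add: N_def)
  have hb: "norm (h t) \<le> 2 * K0 B \<rho>0" if t: "t \<in> {0..} - N" for t
    using norm_triangle_ineq4[of "B t *v um t" "b t"] N1(2)[of t] N2(2)[of t] t by (auto simp: h_def N_def)
  define F where "F t = \<psi> t \<bullet> h t" for t
  have F12: "F t = \<psi>1 t * h t $ 1 + \<psi>2 t * h t $ 2" for t
    by (simp add: F_def inner_vec_def sum_2 \<psi>c)
  have Fm: "F \<in> borel_measurable (lebesgue_on {0..T})"
  proof -
    have "h \<in> borel_measurable (lebesgue_on {0..})"
      using bm bf unfolding h_def bounded_forcing_def by (intro borel_measurable_diff) auto
    then have "h \<in> borel_measurable (lebesgue_on {0..T})" by (rule measurable_restrict_mono) auto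
    moreover have "\<psi> \<in> borel_measurable (lebesgue_on {0..T})"
      using c\<psi> by (rule continuous_imp_measurable_on_sets_lebesgue) simp
    ultimately show ?thesis unfolding F_def by (intro borel_measurable_inner)
  qed
  have "bounded (\<psi> ` {0..T})" using c\<psi> by (intro compact_imp_bounded compact_continuous_image) auto
  then obtain D where D: "D > 0" "\<And>t. t \<in> {0..T} \<Longrightarrow> norm (\<psi> t) \<le> D" unfolding bounded_pos by auto
  have Fb: "AE t in lebesgue_on {0..T}. norm (F t) \<le> D * (2 * K0 B \<rho>0)"
  proof (subst AE_lebesgue_on_iff_negligible)
    have "norm (F t) \<le> D * (2 * K0 B \<rho>0)" if t: "t \<in> {0..T} - N" for t
    proof -
      have "norm (F t) \<le> norm (\<psi> t) * norm (h t)" unfolding F_def real_norm_def by (rule Cauchy_Schwarz_ineq2)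
      also have "\<dots> \<le> D * (2 * K0 B \<rho>0)" using D hb[of t] t by (intro mult_mono) auto
      finally show ?thesis .
    qed
    then show "\<exists>N. negligible N \<and> (\<forall>t\<in>{0..T} - N. norm (F t) \<le> D * (2 * K0 B \<rho>0))" using N by blast
  qed simp
  have fin: "finite_measure (lebesgue_on {0..T})" by (rule finite_measure_lebesgue_on) simp
  have Fi: "integrable (lebesgue_on {0..T}) F"
    by (rule finite_measure.integrable_const_bound[OF fin Fb Fm])
  have "F integrable_on {0..T}" using Fi by (rule integrable_on_lebesgue_on) simp
  then have hint: "(\<lambda>t. \<psi>1 t * h t $ 1 + \<psi>2 t * h t $ 2) integrable_on {0..T}" by (simp add: F12[symmetric])
  have "integral {0..T} (\<lambda>t. \<psi>1 t * h t $ 1 + \<psi>2 t * h t $ 2) \<le> 0"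
  proof (rule variation_inequality[OF tr van \<psi>12(1,2,4) d1 d2 C t0 N _ hint])
    show "norm (h t) \<le> 2 * K0 B \<rho>0" if "t \<in> {0..<T} - N" for t using that by (intro hb) auto
    fix \<epsilon> :: real assume \<epsilon>: "0 < \<epsilon>" "\<epsilon> < 1"
    define v where "v t = us t + \<epsilon> *\<^sub>R (um t - us t)" for t
    have v: "v \<in> U_ad \<rho>0" unfolding v_def using \<epsilon> by (intro U_ad_convex us um) auto
    have Bv: "B t *v v t = b t + \<epsilon> *\<^sub>R h t" for t
      by (simp add: v_def h_def b_def matrix_vector_right_distrib matrix_vector_mult_diff_distrib
          matrix_vector_mult_scaleR algebra_simps)
    obtain T' w' p' where tr': "traj (\<lambda>t. B t *v v t) T' w' p'" "quenching_time B v y0 = T'"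
      using quenching_control[OF B \<rho>0 y0 v] by metis
    have "T \<le> T'" using optimal_time_le[OF B \<rho>0 y0 v] tr'(2) T by simp
    then have "traj (\<lambda>t. b t + \<epsilon> *\<^sub>R h t) T w' p'"
      using traj_restrict[OF tr'(1) T0] by (simp add: Bv)
    then show "\<exists>w' p'. traj (\<lambda>t. b t + \<epsilon> *\<^sub>R h t) T w' p'" by blast
  qed
  then have "integral {0..T} F \<le> 0" by (simp add: F12[symmetric])
  then have int_le: "integral\<^sup>L (lebesgue_on {0..T}) F \<le> 0"
    using lebesgue_integral_eq_integral[OF Fi] by simp
  have us_ae: "AE t in lebesgue_on {0..T}. norm (us t) \<le> \<rho>0"
    using N3 by (subst AE_lebesgue_on_iff_negligible) (auto intro!: exI[of _ N3])
  have F_max: "F t = \<psi> t \<bullet> (B t *v um t) - \<psi> t \<bullet> (B t *v us t)" for t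
    by (simp add: F_def h_def b_def inner_diff_right)
  have in_T: "AE t in lebesgue_on {0..T}. t \<in> {0..T}"
    by (subst AE_lebesgue_on_iff_negligible) (auto intro!: exI[of _ "{}"])
  have F_nonneg: "AE t in lebesgue_on {0..T}. 0 \<le> F t"
    using us_ae in_T by eventually_elim (simp add: F_max umax)
  have "integral\<^sup>L (lebesgue_on {0..T}) F = 0"
    using int_le integral_nonneg_AE[OF F_nonneg] by simp
  then have F_zero: "AE t in lebesgue_on {0..T}. F t = 0"
    using integral_nonneg_eq_0_iff_AE[OF Fi F_nonneg] by simp
  have "AE t in lebesgue_on {0..T}. is_arg_max (\<lambda>v. \<psi> t \<bullet> (B t *v v)) (\<lambda>v. norm v \<le> \<rho>0) (us t)"
    using F_zero us_ae in_T
  proof eventually_elim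
    case (elim t)
    have "\<psi> t \<bullet> (B t *v v) \<le> \<psi> t \<bullet> (B t *v us t)" if "norm v \<le> \<rho>0" for v
      using umax[OF elim(3) that] elim(1) by (simp add: F_max)
    then show ?case using elim(2) by (auto simp: is_arg_max_def not_less)
  qed
  moreover have "(\<lambda>\<tau>. grad_matrix f1 (ys \<tau>) *v \<psi> \<tau>) absolutely_integrable_on {t..<T} \<and>
      \<psi> t = integral {t..<T} (\<lambda>\<tau>. grad_matrix f1 (ys \<tau>) *v \<psi> \<tau>)" if "t \<in> {0..<T}" for t
    using adjoint_integral_equation[OF tr ysw c\<psi> \<psi>T _ _ C(1) _ that] d1 d2 C(2) by (simp add: \<psi>c)
  ultimately show ?case using c\<psi> \<psi>T nontriv t0(1)
    by (intro exI[of _ \<psi>] conjI ballI bexI[of _ t0]) auto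
next
  case 2
  have zero: "(\<lambda>_. 0) \<in> U_ad \<rho>0" using assms(3) by (simp add: U_ad_def)
  have "optimal_time B \<rho>0 y0 \<le> quenching_time B (\<lambda>_. 0) y0"
    by (rule optimal_time_le[OF assms(1,3,4) zero])
  also have "\<dots> \<le> (y0 $ 1 - 1)\<^sup>2"
    using quenching_control[OF assms(1,3,4) zero] by metis
  finally show ?case .
qed

end
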